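(* Let $L$ be a countable lattice which has a minimum element and which contains no infinite strictly increasing sequence. Then there exists a reflexive Banach space $X_L$ such that $(SP_w(X_L),\le)$ is order-isomorphic to $L$.
   Context: A lattice is a partially ordered set in which any two elements have a least upper bound and a greatest lower bound. A normalized basic sequence $(x_i)$ in a Banach space $X$ generates a spreading model $(\tilde x_i)$ if there exist $\varepsilon_n\downarrow0$ such that for all $n$, $(a_i)_{i=1}^n\subseteq[-1,1]$, $n\le k_1<\cdots<k_n$: $(1+\varepsilon_n)^{-1}\|\sum a_i\tilde x_i\|\le\|\sum a_ix_{k_i}\|\le(1+\varepsilon_n)\|\sum a_i\tilde x_i\|$. $(v_i)$ dominates $(u_i)$ if $\|\sum a_iu_i\|\le C\|\sum a_iv_i\|$ for some $C<\infty$ and all finitely supported $(a_i)$; equivalent means mutual domination. $SP_w(X)$ is the set of equivalence classes of spreading models generated by normalized weakly null sequences in $X$, ordered by $[(\tilde x_i)]\le[(\tilde y_i)]$ iff $(\tilde y_i)$ dominates $(\tilde x_i)$. *)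

theory Defs
  imports "HOL-Analysis.Analysis"
begin

text \<open>Ambient space: l-infinity, realised as bounded continuous functions on the
discrete space nat. A Banach space is a closed linear subspace X of it.\<close>

type_synonym linf = "nat \<Rightarrow>\<^sub>C real"

definition banach_subspace :: "linf set \<Rightarrow> bool" where
  "banach_subspace X \<longleftrightarrow> subspace X \<and> closed X"

definition dual_sp :: "linf set \<Rightarrow> (linf \<Rightarrow> real) set" where
  "dual_sp X = {f. (\<forall>x\<in>X. \<forall>y\<in>X. f (x + y) = f x + f y)
                 \<and> (\<forall>c. \<forall>x\<in>X. f (c *\<^sub>R x) = c * f x)
                 \<and> (\<exists>C. \<forall>x\<in>X. \<bar>f x\<bar> \<le> C * norm x)
                 \<and> (\<forall>x. x \<notin> X \<longrightarrow> f x = 0)}"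

definition dual_norm :: "linf set \<Rightarrow> (linf \<Rightarrow> real) \<Rightarrow> real" where
  "dual_norm X f = (SUP x\<in>{x\<in>X. norm x \<le> 1}. \<bar>f x\<bar>)"

definition reflexive_sp :: "linf set \<Rightarrow> bool" where
  "reflexive_sp X \<longleftrightarrow>
     (\<forall>\<Phi> :: (linf \<Rightarrow> real) \<Rightarrow> real.
        (\<forall>f\<in>dual_sp X. \<forall>g\<in>dual_sp X. \<Phi> (\<lambda>x. f x + g x) = \<Phi> f + \<Phi> g)
      \<and> (\<forall>c. \<forall>f\<in>dual_sp X. \<Phi> (\<lambda>x. c * f x) = c * \<Phi> f)
      \<and> (\<exists>C. \<forall>f\<in>dual_sp X. \<bar>\<Phi> f\<bar> \<le> C * dual_norm X f)
      \<longrightarrow> (\<exists>x\<in>X. \<forall>f\<in>dual_sp X. \<Phi> f = f x))"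

definition weakly_null :: "linf set \<Rightarrow> (nat \<Rightarrow> linf) \<Rightarrow> bool" where
  "weakly_null X x \<longleftrightarrow> (\<forall>n. x n \<in> X) \<and> (\<forall>f\<in>dual_sp X. (\<lambda>n. f (x n)) \<longlonglongrightarrow> 0)"

definition basic_seq :: "(nat \<Rightarrow> linf) \<Rightarrow> bool" where
  "basic_seq x \<longleftrightarrow>
     (\<forall>y\<in>closure (span (range x)).
        \<exists>!a::nat \<Rightarrow> real. (\<lambda>n. \<Sum>i<n. a i *\<^sub>R x i) \<longlonglongrightarrow> y)"

definition fin_supp :: "(nat \<Rightarrow> real) \<Rightarrow> bool" where
  "fin_supp a \<longleftrightarrow> finite {i. a i \<noteq> 0}"

text \<open>A spreading model (x~_i) is represented by the function
  N a = norm (sum_i a_i x~_i) on finitely supported coefficient sequences a.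
  Indices are 0-based: a_1..a_n, x_1,x_2,... of the paper are a 0..a (n-1), x 0, x 1, ...;
  the paper's k_1 >= n becomes k 0 + 1 >= n.\<close>
definition sm_seminorm :: "((nat \<Rightarrow> real) \<Rightarrow> real) \<Rightarrow> bool" where
  "sm_seminorm N \<longleftrightarrow>
     (\<forall>a. fin_supp a \<longrightarrow> 0 \<le> N a)
   \<and> (\<forall>a c. fin_supp a \<longrightarrow> N (\<lambda>i. c * a i) = \<bar>c\<bar> * N a)
   \<and> (\<forall>a b. fin_supp a \<longrightarrow> fin_supp b \<longrightarrow> N (\<lambda>i. a i + b i) \<le> N a + N b)"

definition generates_sm :: "(nat \<Rightarrow> linf) \<Rightarrow> ((nat \<Rightarrow> real) \<Rightarrow> real) \<Rightarrow> bool" where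
  "generates_sm x N \<longleftrightarrow>
     (\<forall>n. norm (x n) = 1) \<and> basic_seq x \<and> sm_seminorm N \<and>
     (\<exists>\<epsilon>::nat \<Rightarrow> real. decseq \<epsilon> \<and> \<epsilon> \<longlonglongrightarrow> 0 \<and>
        (\<forall>n (a::nat \<Rightarrow> real) (k::nat \<Rightarrow> nat).
           (\<forall>i<n. \<bar>a i\<bar> \<le> 1) \<and> (\<forall>i\<ge>n. a i = 0) \<and>
           strict_mono_on {..<n} k \<and> n \<le> k 0 + 1 \<longrightarrow>
             N a / (1 + \<epsilon> n) \<le> norm (\<Sum>i<n. a i *\<^sub>R x (k i))
           \<and> norm (\<Sum>i<n. a i *\<^sub>R x (k i)) \<le> (1 + \<epsilon> n) * N a))"

definition dominates :: "((nat \<Rightarrow> real) \<Rightarrow> real) \<Rightarrow> ((nat \<Rightarrow> real) \<Rightarrow> real) \<Rightarrow> bool" where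
  "dominates V U \<longleftrightarrow> (\<exists>C::real. \<forall>a. fin_supp a \<longrightarrow> U a \<le> C * V a)"

definition SPw_models :: "linf set \<Rightarrow> ((nat \<Rightarrow> real) \<Rightarrow> real) set" where
  "SPw_models X = {N. \<exists>x. weakly_null X x \<and> generates_sm x N}"

definition sm_equiv :: "linf set \<Rightarrow> (((nat \<Rightarrow> real) \<Rightarrow> real) \<times> ((nat \<Rightarrow> real) \<Rightarrow> real)) set" where
  "sm_equiv X = {(U, V). U \<in> SPw_models X \<and> V \<in> SPw_models X \<and> dominates U V \<and> dominates V U}"

definition SPw :: "linf set \<Rightarrow> ((nat \<Rightarrow> real) \<Rightarrow> real) set set" where
  "SPw X = SPw_models X // sm_equiv X"

definition SPw_le :: "((nat \<Rightarrow> real) \<Rightarrow> real) set \<Rightarrow> ((nat \<Rightarrow> real) \<Rightarrow> real) set \<Rightarrow> bool" where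
  "SPw_le A B \<longleftrightarrow> (\<exists>U\<in>A. \<exists>V\<in>B. dominates V U)"

end

theory Submission
  imports Defs
begin

text \<open>
  The space is a Musielak--Orlicz sequence space. For a set \<open>B\<close> of indices let
  \<open>weight B t = 1 + \<Sum>n\<in>B. n! min 1 (ln (1 + 1/t) / lam n)\<close>, where \<open>lam\<close> grows so fast that
  \<open>weight B\<close> is dominated by \<open>weight C\<close> near 0 iff \<open>B - C\<close> is finite. The coordinates are split into
  infinitely many colours; coordinate \<open>j\<close> of colour \<open>p\<close> carries the modular function
  \<open>t\<^sup>2 weight (B p) \<bar>t\<bar>\<close>, where colour \<open>p\<close> represents the element \<open>e p\<close> of the lattice and
  \<open>B p = {n. p \<le> n \<and> \<not> e p \<le> y n}\<close> for a sequence \<open>y\<close> that visits each element infinitely often.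
  The sets \<open>{n. \<not> x \<le> y n}\<close> turn joins into unions, so the weights represent the join semilattice.

  The basis of one colour is isometrically symmetric and gives one spreading model per lattice
  element. Conversely, since the modular is additive on disjoint blocks and the weights satisfy
  \<open>weight B (s * t) \<le> weight B s + weight B t\<close>, the spreading model of any normalized weakly null sequence
  is determined by the colours in which its coordinates do not tend uniformly to zero: coordinates that
  tend to zero contribute only an l-two part, and so do colours that escape to infinity because of the
  condition \<open>p \<le> n\<close>. The model is the one of the join of the remaining colours, a finite join by
  the ascending chain condition.

  The norm is the supremum of countably many finitely supported functionals, equivalent to the
  Luxemburg norm up to a constant; this puts the space isometrically into l-infinity and makes convexity of
  the modular functions unnecessary. Averages of disjoint unit blocks tend to zero, which gives
  a shrinking basis and hence reflexivity.
\<close>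

section \<open>Slowly varying weights\<close>

text \<open>Consecutive values have ratio \<open>2 ^ n * fact n\<close>, so
  \<open>fact n * (lam k / lam n)\<close> is summable over \<open>n > k\<close>: later bumps are
  still negligible at the scale where bump \<open>k\<close> is complete.\<close>

definition lam :: "nat \<Rightarrow> real" where
  "lam n = (\<Prod>k\<le>n. 2 ^ k * fact k)"

text \<open>For \<open>t > 0\<close> this is nonincreasing in \<open>t\<close> and saturates at the
  height \<open>fact n\<close> once \<open>ln (1 + 1 / t)\<close> reaches
  \<open>lam n\<close>.\<close>

definition bump :: "nat \<Rightarrow> real \<Rightarrow> real" where
  "bump n t = fact n * min 1 (ln (1 + 1 / t) / lam n)"

definition weight :: "nat set \<Rightarrow> real \<Rightarrow> real" where
  "weight B t = 1 + (\<Sum>n. if n \<in> B then bump n t else 0)"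

lemma lam_ge_1: "1 \<le> lam n"
  unfolding lam_def by (rule prod_ge_1) (simp add: mult_ge1_I fact_ge_1)

lemma lam_pos: "0 < lam n"
  using lam_ge_1[of n] by linarith

lemma lam_Suc: "lam (Suc n) = lam n * (2 ^ Suc n * fact (Suc n))"
  unfolding lam_def by simp

lemma lam_mono: "m \<le> n \<Longrightarrow> lam m \<le> lam n"
proof (induction n rule: dec_induct)
  case (step n)
  have "lam n * 1 \<le> lam n * (2 ^ Suc n * fact (Suc n))"
    using lam_pos[of n] by (intro mult_left_mono mult_ge1_I one_le_power fact_ge_1) auto
  then show ?case using step lam_Suc[of n] by simp
qed simp

lemma lam_ratio: "k < n \<Longrightarrow> fact n * (lam k / lam n) \<le> (1 / 2) ^ n"
proof -
  assume "k < n"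
  then obtain i where i: "n = Suc i" "k \<le> i" by (cases n) auto
  have "fact n * (lam k / lam n) \<le> fact n * (lam i / lam n)"
    using lam_mono[OF i(2)] lam_pos[of n] by (intro mult_left_mono divide_right_mono) auto
  also have "\<dots> = (1 / 2) ^ n"
    unfolding i(1) lam_Suc using lam_pos[of i]
    by (simp del: fact_Suc add: field_simps power_one_over)
  finally show ?thesis .
qed

lemma lam_fact: "fact n / lam n \<le> (1 / 2) ^ n"
proof (cases n)
  case 0
  then show ?thesis by (simp add: lam_def)
next
  case (Suc i)
  have "lam 0 = 1" by (simp add: lam_def)
  then show ?thesis using lam_ratio[of 0 n] Suc by simp
qed

lemma lam_ge: "real n \<le> lam n"
proof -
  have "fact n / lam n \<le> 1" using lam_fact[of n] by (rule order_trans) (simp add: power_le_one)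
  then have "fact n \<le> lam n" using lam_pos[of n] by (simp add: divide_le_eq)
  moreover have "real n \<le> fact n" by (metis fact_ge_self of_nat_fact of_nat_le_iff)
  ultimately show ?thesis by linarith
qed

lemma ln_pos_inv: "0 < t \<Longrightarrow> 0 < ln (1 + 1 / t)" for t :: real
  by (intro ln_gt_zero) simp

lemma bump_nonneg: "0 < t \<Longrightarrow> 0 \<le> bump n t"
  unfolding bump_def using ln_pos_inv[of t] lam_pos[of n] by simp

lemma bump_le_fact: "bump n t \<le> fact n"
  unfolding bump_def by (simp add: mult_left_le)

lemma bump_le: "0 < t \<Longrightarrow> bump n t \<le> ln (1 + 1 / t) * (1 / 2) ^ n"
proof -
  assume t: "0 < t"
  have "bump n t \<le> fact n * (ln (1 + 1 / t) / lam n)"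
    unfolding bump_def by (intro mult_left_mono) auto
  also have "\<dots> = ln (1 + 1 / t) * (fact n / lam n)" by simp
  also have "\<dots> \<le> ln (1 + 1 / t) * (1 / 2) ^ n"
    using lam_fact ln_pos_inv[OF t] by (intro mult_left_mono) auto
  finally show ?thesis .
qed

lemma bump_antimono:
  assumes "0 < s" "s \<le> t"
  shows "bump n t \<le> bump n s"
proof -
  have "ln (1 + 1 / t) \<le> ln (1 + 1 / s)"
    using assms by (subst ln_le_cancel_iff) (auto simp: field_simps add_pos_pos)
  then have "ln (1 + 1 / t) / lam n \<le> ln (1 + 1 / s) / lam n"
    using lam_pos[of n] by (intro divide_right_mono) auto
  then show ?thesis unfolding bump_def by (intro mult_left_mono) auto
qed

text \<open>The derivative is \<open>ln (1 + 1 / x) - 1 / (x + 1)\<close>, which is nonnegative by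
  \<open>ln y \<le> y - 1\<close> at \<open>y = inverse (1 + 1 / x)\<close>.\<close>

lemma mult_ln_inverse_mono:
  fixes s t :: real
  assumes "0 < s" "s \<le> t"
  shows "s * ln (1 + 1 / s) \<le> t * ln (1 + 1 / t)"
proof (rule DERIV_nonneg_imp_nondecreasing[OF assms(2)])
  fix x assume x: "s \<le> x" "x \<le> t"
  then have xp: "0 < x" using assms by linarith
  have nz: "x + x * x \<noteq> 0" using xp by (intro less_imp_neq[symmetric] add_pos_pos mult_pos_pos)
  have p: "0 < 1 + 1 / x" using xp by (simp add: add_pos_pos)
  have D: "((\<lambda>x. x * ln (1 + 1 / x)) has_real_derivative
      (1 * ln (1 + 1 / x) + inverse (1 + 1 / x) * (- 1 / x\<^sup>2) * x)) (at x)"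
    using xp p by (auto intro!: derivative_eq_intros simp: power2_eq_square divide_inverse)
  have "- ln (1 + 1 / x) = ln (inverse (1 + 1 / x))" using p by (simp add: ln_inverse)
  also have "\<dots> \<le> inverse (1 + 1 / x) - 1" using p by (intro ln_le_minus_one) auto
  also have "\<dots> = inverse (1 + 1 / x) * (- 1 / x\<^sup>2) * x"
    using xp nz by (simp add: field_simps power2_eq_square)
  finally show "\<exists>y. ((\<lambda>x. x * ln (1 + 1 / x)) has_real_derivative y) (at x) \<and> 0 \<le> y"
    using D by (intro exI conjI) auto
qed

text \<open>Up to the factor \<open>fact n\<close>, this is the minimum of the nondecreasing
  functions \<open>t\<close> and \<open>t * ln (1 + 1 / t) / lam n\<close>.\<close>

lemma mult_bump_mono:
  assumes "0 < s" "s \<le> t"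
  shows "s * bump n s \<le> t * bump n t"
proof -
  have *: "x * bump n x = fact n * min x (x * ln (1 + 1 / x) / lam n)" if "0 < x" for x
    using that by (simp add: bump_def min_mult_distrib_left mult_ac)
  have "s * ln (1 + 1 / s) / lam n \<le> t * ln (1 + 1 / t) / lam n"
    using mult_ln_inverse_mono[OF assms] lam_pos[of n] by (intro divide_right_mono) auto
  then show ?thesis
    using assms by (subst (1 2) *) (auto intro!: mult_left_mono)
qed

text \<open>Since \<open>1 + 1 / (s * t) \<le> (1 + 1 / s) * (1 + 1 / t)\<close>, the logarithm is
  subadditive here, and truncation at 1 preserves subadditivity of nonnegative quantities.\<close>

lemma bump_mult:
  assumes "0 < s" "0 < t"
  shows "bump n (s * t) \<le> bump n s + bump n t"
proof -
  have "1 + 1 / (s * t) \<le> (1 + 1 / s) * (1 + 1 / t)"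
    using assms by (simp add: field_simps)
  then have "ln (1 + 1 / (s * t)) \<le> ln ((1 + 1 / s) * (1 + 1 / t))"
    using assms by (subst ln_le_cancel_iff) (auto simp: add_pos_pos)
  also have "\<dots> = ln (1 + 1 / s) + ln (1 + 1 / t)"
    using assms by (intro ln_mult_pos) (auto simp: add_pos_pos)
  finally have "ln (1 + 1 / (s * t)) / lam n \<le> ln (1 + 1 / s) / lam n + ln (1 + 1 / t) / lam n"
    using lam_pos[of n] by (simp add: divide_right_mono flip: add_divide_distrib)
  moreover have "0 \<le> ln (1 + 1 / s) / lam n" "0 \<le> ln (1 + 1 / t) / lam n"
    using ln_pos_inv[OF assms(1)] ln_pos_inv[OF assms(2)] lam_pos[of n] by auto
  ultimately have "min 1 (ln (1 + 1 / (s * t)) / lam n)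
      \<le> min 1 (ln (1 + 1 / s) / lam n) + min 1 (ln (1 + 1 / t) / lam n)"
    by linarith
  then show ?thesis unfolding bump_def by (simp flip: distrib_left)
qed

lemma summable_weight:
  assumes "0 < t"
  shows "summable (\<lambda>n. if n \<in> B then bump n t else 0)"
proof (rule summable_comparison_test'[where N = 0])
  show "summable (\<lambda>n. ln (1 + 1 / t) * (1 / 2) ^ n)"
    by (intro summable_mult summable_geometric) auto
  show "norm (if n \<in> B then bump n t else 0) \<le> ln (1 + 1 / t) * (1 / 2) ^ n" for n
    using bump_le[OF assms, of n] bump_nonneg[OF assms, of n] by auto
qed

lemma weight_ge_1: "0 < t \<Longrightarrow> 1 \<le> weight B t"
  unfolding weight_def using suminf_nonneg[OF summable_weight[of t B]] bump_nonneg by simp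

lemma weight_antimono: "0 < s \<Longrightarrow> s \<le> t \<Longrightarrow> weight B t \<le> weight B s"
  unfolding weight_def
  by (intro add_left_mono suminf_le summable_weight) (auto intro: bump_antimono)

lemma mult_weight_mono:
  assumes "0 < s" "s \<le> t"
  shows "s * weight B s \<le> t * weight B t"
proof -
  have "s * (\<Sum>n. if n \<in> B then bump n s else 0) = (\<Sum>n. s * (if n \<in> B then bump n s else 0))"
    using assms by (intro suminf_mult[symmetric] summable_weight)
  also have "\<dots> \<le> (\<Sum>n. t * (if n \<in> B then bump n t else 0))"
    using assms by (intro suminf_le summable_mult summable_weight) (auto intro: mult_bump_mono)
  also have "\<dots> = t * (\<Sum>n. if n \<in> B then bump n t else 0)"
    using assms by (intro suminf_mult summable_weight) auto
  finally show ?thesis unfolding weight_def using assms by (simp add: distrib_left)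
qed

lemma weight_mult:
  assumes "0 < s" "0 < t"
  shows "weight B (s * t) \<le> weight B s + weight B t"
proof -
  have "(\<Sum>n. if n \<in> B then bump n (s * t) else 0)
      \<le> (\<Sum>n. (if n \<in> B then bump n s else 0) + (if n \<in> B then bump n t else 0))"
    using assms by (intro suminf_le summable_add summable_weight) (auto intro: bump_mult)
  also have "\<dots> = (\<Sum>n. if n \<in> B then bump n s else 0) + (\<Sum>n. if n \<in> B then bump n t else 0)"
    using assms by (intro suminf_add[symmetric] summable_weight)
  finally show ?thesis unfolding weight_def by simp
qed

text \<open>Sums the geometric tail of \<open>bump_le\<close>. With \<open>p = 0\<close> it is a
  logarithmic bound for every weight; at a fixed \<open>t\<close> and for large \<open>p\<close> it
  brings the weight close to 1.\<close>

lemma weight_tail_le: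
  assumes "0 < t" "B \<subseteq> {p..}"
  shows "weight B t \<le> 1 + 2 * ln (1 + 1 / t) * (1 / 2) ^ p"
proof -
  let ?L = "ln (1 + 1 / t)"
  have s: "summable (\<lambda>n. ?L * (if p \<le> n then (1 / 2 :: real) ^ n else 0))"
    by (intro summable_mult summable_comparison_test'[OF summable_geometric[of "1/2::real"], where N=0]) auto
  have "(\<Sum>n. if n \<in> B then bump n t else 0) \<le> (\<Sum>n. ?L * (if p \<le> n then (1 / 2) ^ n else 0))"
  proof (intro suminf_le s summable_weight assms)
    fix n
    show "(if n \<in> B then bump n t else 0) \<le> ?L * (if p \<le> n then (1 / 2) ^ n else 0)"
      using assms bump_le[of t n] ln_pos_inv[of t] by auto
  qed
  also have "\<dots> = (\<Sum>n. ?L * (if p \<le> n + p then (1 / 2) ^ (n + p) else 0))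
      + (\<Sum>n<p. ?L * (if p \<le> n then (1 / 2) ^ n else 0))"
    by (rule suminf_split_initial_segment[OF s])
  also have "\<dots> = (\<Sum>n. (?L * (1 / 2) ^ p) * (1 / 2) ^ n)"
    by (simp add: power_add mult_ac)
  also have "\<dots> = (?L * (1 / 2) ^ p) * 2"
    by (subst suminf_mult) (auto simp: suminf_geometric summable_geometric)
  finally show ?thesis unfolding weight_def by simp
qed

text \<open>Every bump is bounded by its height, so finitely many additional indices cost only an
  additive constant.\<close>

lemma weight_le_weight:
  assumes "0 < t" "finite F" "\<And>n. n \<in> B \<Longrightarrow> n \<in> F \<or> n \<in> C"
  shows "weight B t \<le> weight C t + (\<Sum>n\<in>F. fact n)"
proof -
  have "(\<Sum>n. if n \<in> B then bump n t else 0)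
      \<le> (\<Sum>n. (if n \<in> C then bump n t else 0) + (if n \<in> F then fact n else 0))"
    using assms(3) bump_nonneg[OF assms(1)] bump_le_fact
    by (intro suminf_le summable_add summable_weight assms(1) summable_If_finite_set assms(2))
      (auto simp: add_increasing2)
  also have "\<dots> = (\<Sum>n. if n \<in> C then bump n t else 0) + (\<Sum>n. if n \<in> F then fact n else 0)"
    by (intro suminf_add[symmetric] summable_weight assms(1) summable_If_finite_set assms(2))
  also have "(\<Sum>n. if n \<in> F then fact n else 0) = (\<Sum>n\<in>F. fact n :: real)"
    using sums_If_finite_set[OF assms(2)] by (rule sums_unique[symmetric])
  finally show ?thesis unfolding weight_def by simp
qed

lemma weight_union:
  assumes "0 < t"
  shows "weight (B \<union> C) t \<le> weight B t + weight C t"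
proof -
  have "(\<Sum>n. if n \<in> B \<union> C then bump n t else 0)
      \<le> (\<Sum>n. (if n \<in> B then bump n t else 0) + (if n \<in> C then bump n t else 0))"
    using bump_nonneg[OF assms]
    by (intro suminf_le summable_add summable_weight assms) auto
  also have "\<dots> = (\<Sum>n. if n \<in> B then bump n t else 0) + (\<Sum>n. if n \<in> C then bump n t else 0)"
    by (intro suminf_add[symmetric] summable_weight assms)
  finally show ?thesis unfolding weight_def by simp
qed

lemma weight_empty: "weight {} t = 1"
  by (simp add: weight_def)

lemma weight_UN:
  assumes "0 < t" "finite F"
  shows "weight (\<Union>p\<in>F. B p) t \<le> 1 + (\<Sum>p\<in>F. weight (B p) t)"
  using assms(2)
proof induction
  case (insert x F)
  then show ?case using weight_union[OF assms(1), of "B x" "\<Union>p\<in>F. B p"] by simp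
qed (simp add: weight_empty)

lemma sum_fact_lessThan: "(\<Sum>k<Suc n. fact k) \<le> (2 * fact n :: real)"
proof (induction n)
  case (Suc n)
  show ?case
  proof (cases "n = 0")
    case False
    have "(2 :: real) * fact n \<le> real (Suc n) * fact n"
      using False by (intro mult_right_mono) auto
    then have "(2 :: real) * fact n \<le> fact (Suc n)" by simp
    then show ?thesis using Suc by (simp only: sum.lessThan_Suc[of _ "Suc n"])
  qed simp
qed simp

text \<open>Where \<open>ln (1 + 1 / t) = lam (Suc n)\<close>, bump \<open>Suc n\<close> has reached its full height, the earlier
  ones are bounded by lower factorials, and the later ones are still negligible.\<close>

lemma weight_separate:
  assumes "Suc n \<in> B" "Suc n \<notin> C"
  obtains t where "0 < t" "t \<le> 1 / lam (Suc n)" "real (Suc n) * weight C t \<le> 5 * weight B t"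
proof
  define t where "t = 1 / (exp (lam (Suc n)) - 1)"
  have e: "lam (Suc n) \<le> exp (lam (Suc n)) - 1" using exp_ge_add_one_self[of "lam (Suc n)"] by linarith
  then show t: "0 < t" using lam_pos[of "Suc n"] by (simp add: t_def)
  show "t \<le> 1 / lam (Suc n)"
    unfolding t_def using e lam_pos[of "Suc n"] by (intro divide_left_mono) auto
  have L: "ln (1 + 1 / t) = lam (Suc n)" by (simp add: t_def)
  have "fact (Suc n) = bump (Suc n) t"
    using lam_pos[of "Suc n"] by (simp add: bump_def L)
  also have "\<dots> = (\<Sum>k\<in>{Suc n}. if k \<in> B then bump k t else 0)" using assms by simp
  also have "\<dots> \<le> (\<Sum>k. if k \<in> B then bump k t else 0)"
    by (intro sum_le_suminf summable_weight t) (auto intro: bump_nonneg t)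
  finally have 1: "fact (Suc n) \<le> weight B t" unfolding weight_def by simp
  have s: "summable (\<lambda>k. (if k \<in> {..<Suc n} then fact k else 0) + (1 / 2 :: real) ^ k)"
    by (intro summable_add summable_If_finite_set summable_geometric) auto
  have "(\<Sum>k. if k \<in> C then bump k t else 0)
      \<le> (\<Sum>k. (if k \<in> {..<Suc n} then fact k else 0) + (1 / 2) ^ k)"
  proof (intro suminf_le s summable_weight t)
    fix k
    consider "k < Suc n" | "k = Suc n" | "Suc n < k" by linarith
    then show "(if k \<in> C then bump k t else 0) \<le> (if k \<in> {..<Suc n} then fact k else 0) + (1 / 2) ^ k"
    proof cases
      case 3
      have "bump k t \<le> fact k * (lam (Suc n) / lam k)"
        unfolding bump_def L by (intro mult_left_mono) auto
      then show ?thesis using lam_ratio[OF 3] 3 by (auto simp del: fact_Suc)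
    qed (use assms bump_le_fact[of k t] in \<open>auto simp: add_increasing2\<close>)
  qed
  also have "\<dots> = (\<Sum>k. if k \<in> {..<Suc n} then fact k else 0) + (\<Sum>k. (1 / 2) ^ k)"
    by (intro suminf_add[symmetric] summable_If_finite_set summable_geometric) auto
  also have "(\<Sum>k. if k \<in> {..<Suc n} then fact k else 0) = (\<Sum>k<Suc n. fact k :: real)"
    using sums_If_finite_set[of "{..<Suc n}"] by (intro sums_unique[symmetric]) blast
  also have "(\<Sum>k. (1 / 2 :: real) ^ k) = 2" by (simp add: suminf_geometric)
  finally have "weight C t \<le> 3 + 2 * fact n"
    unfolding weight_def using sum_fact_lessThan[of n] by linarith
  moreover have "(1 :: real) \<le> fact n" by (rule fact_ge_1)
  ultimately have "weight C t \<le> 5 * fact n" by linarith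
  \<comment> \<open>The gain \<open>Suc n\<close> is the quotient of \<open>fact (Suc n)\<close>, a
    lower bound for \<open>weight B t\<close>, by \<open>fact n\<close>, which up to the factor 5
    bounds \<open>weight C t\<close>.\<close>
  then have "real (Suc n) * weight C t \<le> real (Suc n) * (5 * fact n)"
    by (intro mult_left_mono) auto
  also have "\<dots> = 5 * fact (Suc n)" by simp
  finally show "real (Suc n) * weight C t \<le> 5 * weight B t" using 1 by linarith
qed

section \<open>A modular sequence space inside l-infinity\<close>

definition restr :: "nat set \<Rightarrow> (nat \<Rightarrow> real) \<Rightarrow> nat \<Rightarrow> real" where
  "restr A a = (\<lambda>j. if j \<in> A then a j else 0)"

definition unit_seq :: "nat \<Rightarrow> nat \<Rightarrow> real" where
  "unit_seq j = (\<lambda>i. if i = j then 1 else 0)"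

text \<open>Index set of the test functionals. Rational values keep it countable, so that a supremum
  over it is the norm of a bounded sequence.\<close>

definition rat_seqs :: "(nat \<Rightarrow> real) set" where
  "rat_seqs = {s. (\<forall>j. s j \<in> \<rat>) \<and> finite {j. s j \<noteq> 0}}"

lemma countable_rat_seqs: "countable rat_seqs"
proof -
  let ?f = "\<lambda>(l :: rat list) j. if j < length l then real_of_rat (l ! j) else 0"
  have "rat_seqs \<subseteq> range ?f"
  proof
    fix s assume s: "s \<in> rat_seqs"
    then obtain n where n: "\<And>j. s j \<noteq> 0 \<Longrightarrow> j < n"
      unfolding rat_seqs_def finite_nat_set_iff_bounded by blast
    have "\<forall>j. \<exists>r. s j = real_of_rat r" using s by (auto simp: rat_seqs_def Rats_def)
    then obtain r where r: "\<And>j. s j = real_of_rat (r j)" by metis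
    have "s = ?f (map r [0..<n])" using n r by fastforce
    then show "s \<in> range ?f" by blast
  qed
  then show ?thesis by (rule countable_subset) simp
qed

lemma zero_in_rat_seqs: "(\<lambda>_. 0) \<in> rat_seqs"
  by (simp add: rat_seqs_def)

lemma unit_seq_in_rat_seqs: "unit_seq j \<in> rat_seqs"
  by (simp add: rat_seqs_def unit_seq_def)

lemma restr_in_rat_seqs: "s \<in> rat_seqs \<Longrightarrow> restr A s \<in> rat_seqs"
  by (auto simp: rat_seqs_def restr_def elim: finite_subset[rotated])

text \<open>\<open>h_antimono\<close> and \<open>mult_h_mono\<close> place the functions
  \<open>m\<close> below between linear and quadratic order under scaling. \<open>h_log\<close> is
  an upper bound uniform in \<open>j\<close>; it makes averages of disjoint blocks small.\<close>

locale modular =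
  fixes h :: "nat \<Rightarrow> real \<Rightarrow> real"
  assumes h_ge_1: "0 < t \<Longrightarrow> 1 \<le> h j t"
    and h_antimono: "0 < s \<Longrightarrow> s \<le> t \<Longrightarrow> h j t \<le> h j s"
    and mult_h_mono: "0 < s \<Longrightarrow> s \<le> t \<Longrightarrow> s * h j s \<le> t * h j t"
    and h_mult: "0 < s \<Longrightarrow> 0 < t \<Longrightarrow> h j (s * t) \<le> h j s + h j t"
    and h_log: "0 < t \<Longrightarrow> h j t \<le> 1 + 2 * ln (1 + 1 / t)"
begin

section \<open>Growth of the modular functions\<close>

definition m :: "nat \<Rightarrow> real \<Rightarrow> real" where
  "m j t = t\<^sup>2 * h j \<bar>t\<bar>"

lemma m_0 [simp]: "m j 0 = 0"
  by (simp add: m_def)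

lemma m_abs [simp]: "m j \<bar>t\<bar> = m j t"
  by (simp add: m_def)

lemma sq_le_m: "t\<^sup>2 \<le> m j t"
  unfolding m_def using h_ge_1[of "\<bar>t\<bar>" j] by (cases "t = 0") (auto simp: mult_le_cancel_left1)

lemma m_nonneg [simp]: "0 \<le> m j t"
  using sq_le_m[of t j] by (smt (verit) zero_le_power2)

lemma m_eq_mult: "m j t = \<bar>t\<bar> * (\<bar>t\<bar> * h j \<bar>t\<bar>)"
  by (simp add: m_def power2_eq_square flip: mult.assoc)

lemma m_mono:
  assumes "\<bar>s\<bar> \<le> \<bar>t\<bar>"
  shows "m j s \<le> m j t"
proof (cases "s = 0")
  case False
  then show ?thesis
    unfolding m_eq_mult using assms h_ge_1[of "\<bar>s\<bar>" j]
    by (intro mult_mono mult_h_mono) auto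
qed simp

text \<open>One factor \<open>t\<close> scales exactly and the other factor \<open>t * h j t\<close>
  is nondecreasing. This is the substitute for convexity.\<close>

lemma m_scale_le:
  assumes "\<bar>c\<bar> \<le> 1"
  shows "m j (c * t) \<le> \<bar>c\<bar> * m j t"
proof (cases "c * t = 0")
  case False
  then have "\<bar>c * t\<bar> * h j \<bar>c * t\<bar> \<le> \<bar>t\<bar> * h j \<bar>t\<bar>"
    using assms by (intro mult_h_mono) (auto simp: abs_mult mult_left_le_one_le)
  then have "\<bar>c * t\<bar> * (\<bar>c * t\<bar> * h j \<bar>c * t\<bar>) \<le> \<bar>c * t\<bar> * (\<bar>t\<bar> * h j \<bar>t\<bar>)"
    by (intro mult_left_mono) auto
  then show ?thesis unfolding m_eq_mult by (simp add: abs_mult mult_ac)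
qed auto

text \<open>The square scales exactly, and the weight can only grow when its argument
  shrinks.\<close>

lemma m_scale_ge:
  assumes "\<bar>c\<bar> \<le> 1"
  shows "c\<^sup>2 * m j t \<le> m j (c * t)"
proof (cases "c * t = 0")
  case False
  then have "h j \<bar>t\<bar> \<le> h j \<bar>c * t\<bar>"
    using assms by (intro h_antimono) (auto simp: abs_mult mult_left_le_one_le)
  then show ?thesis unfolding m_def power_mult_distrib mult.assoc by (intro mult_left_mono) auto
qed auto

lemma m_scale_up:
  assumes "1 \<le> \<bar>c\<bar>"
  shows "m j (c * t) \<le> c\<^sup>2 * m j t"
proof -
  have c: "c \<noteq> 0" using assms by auto
  have "(1 / c)\<^sup>2 * m j (c * t) \<le> m j ((1 / c) * (c * t))"
    using assms by (intro m_scale_ge) auto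
  then show ?thesis using c by (simp add: field_simps)
qed

lemma m_add: "m j (s + t) \<le> 4 * (m j s + m j t)"
proof -
  have "m j (s + t) \<le> m j (2 * max \<bar>s\<bar> \<bar>t\<bar>)"
    by (intro m_mono) auto
  also have "\<dots> \<le> 2\<^sup>2 * m j (max \<bar>s\<bar> \<bar>t\<bar>)" by (intro m_scale_up) auto
  also have "m j (max \<bar>s\<bar> \<bar>t\<bar>) \<le> m j s + m j t"
    by (cases "\<bar>s\<bar> \<le> \<bar>t\<bar>") (auto simp: max_def)
  finally show ?thesis by simp
qed

text \<open>As both weights are at least 1, their sum in \<open>h_mult\<close> is at most
  \<open>h j \<bar>s\<bar> * (1 + h j \<bar>t\<bar>)\<close>. The cost of multiplying by
  \<open>t\<close> thus does not depend on \<open>s\<close> and can be pulled out of a sum over a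
  block.\<close>

lemma m_mult:
  assumes "t \<noteq> 0"
  shows "m j (s * t) \<le> t\<^sup>2 * (1 + h j \<bar>t\<bar>) * m j s"
proof (cases "s = 0")
  case False
  have "h j \<bar>s * t\<bar> \<le> h j \<bar>s\<bar> + h j \<bar>t\<bar>"
    unfolding abs_mult using False assms by (intro h_mult) auto
  also have "\<dots> \<le> h j \<bar>s\<bar> + h j \<bar>t\<bar> * h j \<bar>s\<bar>"
    using h_ge_1[of "\<bar>s\<bar>" j] h_ge_1[of "\<bar>t\<bar>" j] False assms by (simp add: mult_le_cancel_left1)
  finally have "(s * t)\<^sup>2 * h j \<bar>s * t\<bar> \<le> (s * t)\<^sup>2 * (h j \<bar>s\<bar> + h j \<bar>t\<bar> * h j \<bar>s\<bar>)"
    by (intro mult_left_mono) auto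
  then show ?thesis unfolding m_def by (simp add: algebra_simps power_mult_distrib)
qed simp

text \<open>For \<open>s\<close> below \<open>t\<close> the weight at \<open>t\<close> is at most
  the weight at \<open>s\<close>, so multiplying by \<open>t\<close> costs only a square, as in
  l-two.\<close>

lemma m_mult_small:
  assumes "\<bar>s\<bar> \<le> \<bar>t\<bar>"
  shows "m j (s * t) \<le> 2 * t\<^sup>2 * m j s"
proof (cases "s = 0")
  case False
  have "h j \<bar>s * t\<bar> \<le> h j \<bar>s\<bar> + h j \<bar>t\<bar>"
    unfolding abs_mult using False assms by (intro h_mult) auto
  also have "\<dots> \<le> 2 * h j \<bar>s\<bar>"
    using h_antimono[of "\<bar>s\<bar>" "\<bar>t\<bar>" j] False assms by simp
  finally have "(s * t)\<^sup>2 * h j \<bar>s * t\<bar> \<le> (s * t)\<^sup>2 * (2 * h j \<bar>s\<bar>)"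
    by (intro mult_left_mono) auto
  then show ?thesis unfolding m_def by (simp add: algebra_simps power_mult_distrib)
qed simp

text \<open>Replaces Young's inequality: the product is bounded by the modular of whichever of
  \<open>s\<close> and \<open>a\<close> is larger in absolute value.\<close>

lemma m_coeff_young: "\<bar>s * h j \<bar>s\<bar> * a\<bar> \<le> m j s + m j a"
proof (cases "s = 0")
  case False
  have hs: "0 < h j \<bar>s\<bar>" using h_ge_1[of "\<bar>s\<bar>" j] False by simp
  have eq: "\<bar>s * h j \<bar>s\<bar> * a\<bar> = (\<bar>s\<bar> * h j \<bar>s\<bar>) * \<bar>a\<bar>"
    using hs by (simp add: abs_mult)
  show ?thesis
  proof (cases "\<bar>a\<bar> \<le> \<bar>s\<bar>")
    case True
    have "(\<bar>s\<bar> * h j \<bar>s\<bar>) * \<bar>a\<bar> \<le> (\<bar>s\<bar> * h j \<bar>s\<bar>) * \<bar>s\<bar>"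
      using True hs by (intro mult_left_mono) auto
    also have "\<dots> = m j s" by (simp add: m_eq_mult)
    finally show ?thesis unfolding eq using m_nonneg[of j a] by linarith
  next
    case False2: False
    have "(\<bar>s\<bar> * h j \<bar>s\<bar>) * \<bar>a\<bar> \<le> (\<bar>a\<bar> * h j \<bar>a\<bar>) * \<bar>a\<bar>"
      using False2 False by (intro mult_right_mono mult_h_mono) auto
    also have "\<dots> = m j a" by (simp add: m_eq_mult)
    finally show ?thesis unfolding eq using m_nonneg[of j s] by linarith
  qed
qed simp

section \<open>Modular bounds and the sequence space\<close>

text \<open>Phrased through finite partial sums, so that an infinite modular needs no value of its
  own.\<close>

definition modular_le :: "(nat \<Rightarrow> real) \<Rightarrow> real \<Rightarrow> bool" where
  "modular_le a c \<longleftrightarrow> (\<forall>J. finite J \<longrightarrow> (\<Sum>j\<in>J. m j (a j)) \<le> c)"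

definition modular_space :: "(nat \<Rightarrow> real) set" where
  "modular_space = {a. \<exists>c. modular_le a c}"

lemma modular_le_sum: "modular_le a c \<Longrightarrow> finite J \<Longrightarrow> (\<Sum>j\<in>J. m j (a j)) \<le> c"
  by (simp add: modular_le_def)

lemma modular_le_LamI: "modular_le a c \<Longrightarrow> a \<in> modular_space"
  by (auto simp: modular_space_def)

lemma modular_le_mono: "modular_le a c \<Longrightarrow> c \<le> d \<Longrightarrow> modular_le a d"
  unfolding modular_le_def by (meson order_trans)

lemma modular_le_le:
  assumes "modular_le a c" "0 \<le> k" "\<And>j. m j (b j) \<le> k * m j (a j)"
  shows "modular_le b (k * c)"
  unfolding modular_le_def
proof (intro allI impI)
  fix J :: "nat set" assume "finite J"
  have "(\<Sum>j\<in>J. m j (b j)) \<le> k * (\<Sum>j\<in>J. m j (a j))"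
    unfolding sum_distrib_left by (intro sum_mono assms)
  also have "\<dots> \<le> k * c" using assms \<open>finite J\<close> by (intro mult_left_mono modular_le_sum)
  finally show "(\<Sum>j\<in>J. m j (b j)) \<le> k * c" .
qed

lemma modular_le_dom:
  assumes "modular_le a c" "\<And>j. \<bar>b j\<bar> \<le> \<bar>a j\<bar>"
  shows "modular_le b c"
  using modular_le_le[OF assms(1), of 1 b] m_mono[OF assms(2)] by simp

lemma modular_le_restr: "modular_le a c \<Longrightarrow> modular_le (restr A a) c"
  by (erule modular_le_dom) (auto simp: restr_def)

lemma modular_le_scale_down: "modular_le a c \<Longrightarrow> \<bar>r\<bar> \<le> 1 \<Longrightarrow> modular_le (\<lambda>j. r * a j) (\<bar>r\<bar> * c)"
  by (erule modular_le_le) (auto intro: m_scale_le)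

lemma modular_le_scale_up: "modular_le a c \<Longrightarrow> 1 \<le> \<bar>r\<bar> \<Longrightarrow> modular_le (\<lambda>j. r * a j) (r\<^sup>2 * c)"
  by (erule modular_le_le) (auto intro: m_scale_up)

lemma modular_space_scale:
  assumes "a \<in> modular_space"
  shows "(\<lambda>j. r * a j) \<in> modular_space"
  using assms modular_le_scale_up[of a _ r] modular_le_scale_down[of a _ r] unfolding modular_space_def
  by (cases "\<bar>r\<bar> \<le> 1") auto

lemma modular_space_scale_iff:
  assumes "r \<noteq> 0"
  shows "(\<lambda>j. r * a j) \<in> modular_space \<longleftrightarrow> a \<in> modular_space"
  using modular_space_scale[of a r] modular_space_scale[of "\<lambda>j. r * a j" "1 / r"] assms by auto

lemma modular_le_add:
  assumes "modular_le a c" "modular_le b d"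
  shows "modular_le (\<lambda>j. a j + b j) (4 * (c + d))"
  unfolding modular_le_def
proof (intro allI impI)
  fix J :: "nat set" assume J: "finite J"
  have "(\<Sum>j\<in>J. m j (a j + b j)) \<le> 4 * ((\<Sum>j\<in>J. m j (a j)) + (\<Sum>j\<in>J. m j (b j)))"
    unfolding sum_distrib_left sum.distrib[symmetric] by (intro sum_mono m_add)
  also have "\<dots> \<le> 4 * (c + d)" using assms J by (intro mult_left_mono add_mono modular_le_sum) auto
  finally show "(\<Sum>j\<in>J. m j (a j + b j)) \<le> 4 * (c + d)" .
qed

lemma modular_space_add: "a \<in> modular_space \<Longrightarrow> b \<in> modular_space \<Longrightarrow> (\<lambda>j. a j + b j) \<in> modular_space"
  unfolding modular_space_def using modular_le_add by blast

lemma modular_space_diff: "a \<in> modular_space \<Longrightarrow> b \<in> modular_space \<Longrightarrow> (\<lambda>j. a j - b j) \<in> modular_space"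
  using modular_space_add[of a "\<lambda>j. (-1) * b j"] modular_space_scale[of b "-1"] by simp

lemma modular_space_restr: "a \<in> modular_space \<Longrightarrow> restr A a \<in> modular_space"
  unfolding modular_space_def using modular_le_restr by blast

lemma modular_le_finite_support:
  assumes "finite J" "\<And>j. j \<notin> J \<Longrightarrow> a j = 0"
  shows "modular_le a (\<Sum>j\<in>J. m j (a j))"
  unfolding modular_le_def
proof (intro allI impI)
  fix K :: "nat set" assume K: "finite K"
  have "(\<Sum>j\<in>K. m j (a j)) = (\<Sum>j\<in>K \<inter> J. m j (a j))"
    using K assms(2) by (intro sum.mono_neutral_right) auto
  also have "\<dots> \<le> (\<Sum>j\<in>J. m j (a j))" using assms(1) by (intro sum_mono2) auto
  finally show "(\<Sum>j\<in>K. m j (a j)) \<le> (\<Sum>j\<in>J. m j (a j))" .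
qed

lemma modular_space_finite_support: "finite J \<Longrightarrow> (\<And>j. j \<notin> J \<Longrightarrow> a j = 0) \<Longrightarrow> a \<in> modular_space"
  by (rule modular_le_LamI[OF modular_le_finite_support])

lemma modular_space_0: "(\<lambda>j. 0) \<in> modular_space"
  by (rule modular_space_finite_support[of "{}"]) auto

lemma modular_space_unit_seq: "unit_seq j \<in> modular_space"
  by (rule modular_space_finite_support[of "{j}"]) (auto simp: unit_seq_def)

lemma modular_le_tail:
  assumes "a \<in> modular_space" "0 < e"
  shows "\<exists>N. \<forall>n\<ge>N. modular_le (restr {n..} a) e"
proof -
  obtain c where c: "modular_le a c" using assms by (auto simp: modular_space_def)
  have sm: "summable (\<lambda>j. m j (a j))"
    by (rule summableI_nonneg_bounded[where x = c]) (auto intro: modular_le_sum[OF c])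
  obtain N where N: "\<And>n. n \<ge> N \<Longrightarrow> norm (\<Sum>i. m (i + n) (a (i + n))) < e"
    using suminf_exist_split[OF assms(2) sm] by auto
  have "modular_le (restr {n..} a) e" if "n \<ge> N" for n
    unfolding modular_le_def
  proof (intro allI impI)
    fix J :: "nat set" assume J: "finite J"
    have "(\<Sum>j\<in>J. m j (restr {n..} a j)) = (\<Sum>j\<in>J \<inter> {n..}. m j (a j))"
      using J by (intro sum.mono_neutral_cong_right) (auto simp: restr_def)
    also have "\<dots> = (\<Sum>i\<in>(\<lambda>j. j - n) ` (J \<inter> {n..}). m (i + n) (a (i + n)))"
      by (subst sum.reindex) (auto intro!: sum.cong inj_onI)
    also have "\<dots> \<le> (\<Sum>i. m (i + n) (a (i + n)))"
      using J sm by (intro sum_le_suminf) (auto simp: summable_iff_shift[of "\<lambda>j. m j (a j)"])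
    finally show "(\<Sum>j\<in>J. m j (restr {n..} a j)) \<le> e" using N[OF that] by simp
  qed
  then show ?thesis by blast
qed

section \<open>Test functionals and the modular\<close>

text \<open>The coefficient of \<open>a j\<close> is the difference quotient
  \<open>m j (s j) / s j\<close>, in place of a derivative of \<open>m j\<close>. The denominator
  normalises: sequences \<open>a\<close> of modular at most 1 get values at most 1.\<close>

definition Q :: "(nat \<Rightarrow> real) \<Rightarrow> (nat \<Rightarrow> real) \<Rightarrow> real" where
  "Q s a = (\<Sum>j | s j \<noteq> 0. s j * h j \<bar>s j\<bar> * a j) / (1 + (\<Sum>j | s j \<noteq> 0. m j (s j)))"

lemma Q_eq:
  assumes "finite J" "\<And>j. s j \<noteq> 0 \<Longrightarrow> j \<in> J"
  shows "Q s a = (\<Sum>j\<in>J. s j * h j \<bar>s j\<bar> * a j) / (1 + (\<Sum>j\<in>J. m j (s j)))"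
proof -
  have "(\<Sum>j | s j \<noteq> 0. s j * h j \<bar>s j\<bar> * a j) = (\<Sum>j\<in>J. s j * h j \<bar>s j\<bar> * a j)"
    "(\<Sum>j | s j \<noteq> 0. m j (s j)) = (\<Sum>j\<in>J. m j (s j))"
    using assms by (auto intro!: sum.mono_neutral_left)
  then show ?thesis unfolding Q_def by simp
qed

lemma Q_denom_pos: "0 < 1 + (\<Sum>j\<in>J. m j (s j))"
  by (intro add_pos_nonneg sum_nonneg) auto

lemma Q_add: "Q s (\<lambda>j. a j + b j) = Q s a + Q s b"
  unfolding Q_def by (simp add: distrib_left sum.distrib add_divide_distrib)

lemma Q_scale: "Q s (\<lambda>j. r * a j) = r * Q s a"
  unfolding Q_def by (simp add: sum_distrib_left mult_ac)

text \<open>By \<open>m_coeff_young\<close> the numerator is at most \<open>c\<close> plus the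
  modular of \<open>s\<close>; as \<open>1 \<le> c\<close>, this is at most \<open>c\<close> times
  the denominator.\<close>

lemma Q_le_modular_le:
  assumes "modular_le a c" "1 \<le> c" "s \<in> rat_seqs"
  shows "\<bar>Q s a\<bar> \<le> c"
proof -
  let ?J = "{j. s j \<noteq> 0}"
  let ?R = "\<Sum>j\<in>?J. m j (s j)"
  have J: "finite ?J" using assms by (simp add: rat_seqs_def)
  have "\<bar>\<Sum>j\<in>?J. s j * h j \<bar>s j\<bar> * a j\<bar> \<le> (\<Sum>j\<in>?J. \<bar>s j * h j \<bar>s j\<bar> * a j\<bar>)" by (rule sum_abs)
  also have "\<dots> \<le> (\<Sum>j\<in>?J. m j (s j) + m j (a j))" by (intro sum_mono m_coeff_young)
  also have "\<dots> \<le> ?R + c" unfolding sum.distrib using modular_le_sum[OF assms(1) J] by simp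
  also have "\<dots> \<le> c * (1 + ?R)"
    using assms(2) sum_nonneg[of ?J "\<lambda>j. m j (s j)"] by (simp add: algebra_simps mult_le_cancel_left1 mult_le_cancel_right1)
  finally show ?thesis unfolding Q_def using Q_denom_pos[of s ?J] by (simp add: abs_divide divide_le_eq)
qed

text \<open>A rational sequence pinched between \<open>a / (2 * c)\<close> and \<open>3 * a / (4 * c)\<close> serves as test
  functional, so no continuity of the weights is needed.\<close>

lemma modular_le_of_Q_le:
  assumes "0 < c" "\<And>s. s \<in> rat_seqs \<Longrightarrow> \<bar>Q s a\<bar> \<le> c"
  shows "modular_le (\<lambda>j. a j / (2 * c)) 3"
  unfolding modular_le_def
proof (intro allI impI)
  fix J :: "nat set" assume J: "finite J"
  have "\<exists>r\<in>\<rat>. x = 0 \<and> r = 0 \<or> 0 < r * x \<and> \<bar>x\<bar> / 2 \<le> \<bar>r\<bar> \<and> \<bar>r\<bar> \<le> 3 / 4 * \<bar>x\<bar>" for x :: real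
  proof (cases "x = 0")
    case False
    then have "\<bar>x\<bar> / 2 < 3 / 4 * \<bar>x\<bar>" by simp
    then obtain q where q: "q \<in> \<rat>" "\<bar>x\<bar> / 2 < q" "q < 3 / 4 * \<bar>x\<bar>"
      using Rats_dense_in_real by blast
    have "0 < q" using q False by (smt (verit) zero_less_abs_iff field_sum_of_halves)
    then show ?thesis
    proof (cases "0 < x")
      case True
      then show ?thesis using q \<open>0 < q\<close> by (intro bexI[of _ q]) auto
    next
      case False2: False
      then have "x < 0" using False by auto
      then show ?thesis
        using q \<open>0 < q\<close> mult_pos_neg[of q x] by (intro bexI[of _ "- q"]) auto
    qed
  qed auto
  then have "\<forall>j. \<exists>r\<in>\<rat>. a j / c = 0 \<and> r = 0 \<or>
      0 < r * (a j / c) \<and> \<bar>a j / c\<bar> / 2 \<le> \<bar>r\<bar> \<and> \<bar>r\<bar> \<le> 3 / 4 * \<bar>a j / c\<bar>"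
    by blast
  then obtain r where rq: "\<And>j. r j \<in> \<rat>" and r: "\<And>j. a j / c = 0 \<and> r j = 0 \<or>
      0 < r j * (a j / c) \<and> \<bar>a j / c\<bar> / 2 \<le> \<bar>r j\<bar> \<and> \<bar>r j\<bar> \<le> 3 / 4 * \<bar>a j / c\<bar>"
    by metis
  define s where "s = restr J r"
  have s: "s \<in> rat_seqs"
    using J rq by (auto simp: s_def rat_seqs_def restr_def elim: finite_subset[rotated])
  let ?R = "\<Sum>j\<in>J. m j (s j)"
  have Qs: "Q s a = (\<Sum>j\<in>J. s j * h j \<bar>s j\<bar> * a j) / (1 + ?R)"
    by (rule Q_eq[OF J]) (auto simp: s_def restr_def split: if_splits)
  \<comment> \<open>Since \<open>s j\<close> has the sign of \<open>a j\<close> and at most 3/4 of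
    the size of \<open>a j / c\<close>, each pairing term exceeds \<open>c * m j (s j)\<close> by
    the factor 4/3. This surplus yields the bound 3 for \<open>?R\<close>.\<close>
  have "4 / 3 * c * m j (s j) \<le> s j * h j \<bar>s j\<bar> * a j" if "j \<in> J" for j
  proof (cases "s j = 0")
    case False
    have sj: "s j = r j" using that by (simp add: s_def restr_def)
    have p: "0 < r j * (a j / c)" "\<bar>r j\<bar> \<le> 3 / 4 * \<bar>a j / c\<bar>" using r[of j] False sj by auto
    have "(r j)\<^sup>2 = \<bar>r j\<bar> * \<bar>r j\<bar>" by (simp add: power2_eq_square)
    also have "\<dots> \<le> \<bar>r j\<bar> * (3 / 4 * \<bar>a j / c\<bar>)" using p by (intro mult_left_mono) auto
    also have "\<dots> = 3 / 4 * \<bar>r j * (a j / c)\<bar>" by (simp add: abs_mult)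
    also have "\<dots> = 3 / 4 * (r j * (a j / c))" using p(1) by (simp only: abs_of_pos)
    finally have "4 / 3 * c * (r j)\<^sup>2 \<le> r j * a j" using assms(1) by (simp add: field_simps)
    then have "4 / 3 * c * (r j)\<^sup>2 * h j \<bar>r j\<bar> \<le> r j * a j * h j \<bar>r j\<bar>"
      using h_ge_1[of "\<bar>r j\<bar>" j] False sj by (intro mult_right_mono) auto
    then show ?thesis by (simp add: sj m_def mult_ac)
  qed simp
  then have "4 / 3 * c * ?R \<le> (\<Sum>j\<in>J. s j * h j \<bar>s j\<bar> * a j)"
    unfolding sum_distrib_left by (rule sum_mono)
  also have "\<dots> = Q s a * (1 + ?R)" unfolding Qs using Q_denom_pos[of s J] by simp
  also have "\<dots> \<le> c * (1 + ?R)"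
    using assms(2)[OF s] Q_denom_pos[of s J] by (intro mult_right_mono) auto
  finally have "c * (4 / 3 * ?R) \<le> c * (1 + ?R)" by (simp add: mult_ac)
  then have "4 / 3 * ?R \<le> 1 + ?R" using assms(1) by simp
  then have R: "?R \<le> 3" by simp
  have "(\<Sum>j\<in>J. m j (a j / (2 * c))) \<le> ?R"
  proof (intro sum_mono m_mono)
    fix j assume "j \<in> J"
    then show "\<bar>a j / (2 * c)\<bar> \<le> \<bar>s j\<bar>" using r[of j] by (auto simp: s_def restr_def abs_mult abs_divide)
  qed
  then show "(\<Sum>j\<in>J. m j (a j / (2 * c))) \<le> 3" using R by linarith
qed

section \<open>The embedding into l-infinity\<close>

text \<open>The values of all test functionals along an enumeration. \<open>Bcontfun\<close> is
  meaningful only for bounded sequences, so \<open>T\<close> is used on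
  \<open>modular_space\<close>, where \<open>apply_T\<close> unfolds it.\<close>

definition T :: "(nat \<Rightarrow> real) \<Rightarrow> linf" where
  "T a = Bcontfun (\<lambda>n. Q (from_nat_into rat_seqs n) a)"

lemma from_nat_into_rat_seqs: "from_nat_into rat_seqs n \<in> rat_seqs"
  using zero_in_rat_seqs by (intro from_nat_into) auto

lemma Q_le_modular_space:
  assumes "a \<in> modular_space"
  shows "\<exists>c. \<forall>s\<in>rat_seqs. \<bar>Q s a\<bar> \<le> c"
proof -
  obtain c where "modular_le a c" using assms by (auto simp: modular_space_def)
  then have "modular_le a (max 1 c)" by (rule modular_le_mono) simp
  then show ?thesis using Q_le_modular_le by (meson max.cobounded1)
qed

lemma apply_T:
  assumes "a \<in> modular_space"
  shows "apply_bcontfun (T a) n = Q (from_nat_into rat_seqs n) a"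
proof -
  obtain c where "\<And>s. s \<in> rat_seqs \<Longrightarrow> \<bar>Q s a\<bar> \<le> c" using Q_le_modular_space[OF assms] by blast
  then have "(\<lambda>n. Q (from_nat_into rat_seqs n) a) \<in> bcontfun"
    using from_nat_into_rat_seqs by (intro bcontfun_normI[where b = c]) auto
  then show ?thesis unfolding T_def by (simp add: Bcontfun_inverse)
qed

lemma Q_le_norm_T:
  assumes "a \<in> modular_space" "s \<in> rat_seqs"
  shows "\<bar>Q s a\<bar> \<le> norm (T a)"
proof -
  obtain n where "from_nat_into rat_seqs n = s"
    using from_nat_into_surj[OF countable_rat_seqs assms(2)] by blast
  then show ?thesis using norm_bounded[of "T a" n] apply_T[OF assms(1), of n] by simp
qed

lemma norm_T_le:
  assumes "a \<in> modular_space" "\<And>s. s \<in> rat_seqs \<Longrightarrow> \<bar>Q s a\<bar> \<le> c"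
  shows "norm (T a) \<le> c"
  by (rule norm_bound) (simp add: apply_T assms from_nat_into_rat_seqs)

lemma norm_T_le_modular_le: "modular_le a c \<Longrightarrow> 1 \<le> c \<Longrightarrow> norm (T a) \<le> c"
  by (intro norm_T_le modular_le_LamI Q_le_modular_le)

text \<open>Together with \<open>norm_T_le_modular_le\<close>, this is the equivalence with the
  Luxemburg norm up to constants.\<close>

lemma modular_le_of_norm_T:
  assumes "a \<in> modular_space" "norm (T a) \<le> c" "0 < c"
  shows "modular_le (\<lambda>j. a j / (2 * c)) 3"
  using assms Q_le_norm_T[OF assms(1)] by (intro modular_le_of_Q_le) (auto intro: order_trans)

lemma T_add: "a \<in> modular_space \<Longrightarrow> b \<in> modular_space \<Longrightarrow> T (\<lambda>j. a j + b j) = T a + T b"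
  by (rule bcontfun_eqI) (simp add: apply_T modular_space_add Q_add)

lemma T_scale: "a \<in> modular_space \<Longrightarrow> T (\<lambda>j. r * a j) = r *\<^sub>R T a"
  by (rule bcontfun_eqI) (simp add: apply_T modular_space_scale Q_scale)

lemma T_diff: "a \<in> modular_space \<Longrightarrow> b \<in> modular_space \<Longrightarrow> T (\<lambda>j. a j - b j) = T a - T b"
  using T_add[of a "\<lambda>j. (-1) * b j"] modular_space_scale[of b "-1"] T_scale[of b "-1"] by simp

lemma T_0: "T (\<lambda>j. 0) = 0"
  using T_scale[OF modular_space_0, of 0] by simp

lemma modular_space_sum: "(\<And>i. i \<in> I \<Longrightarrow> a i \<in> modular_space) \<Longrightarrow> (\<lambda>j. \<Sum>i\<in>I. a i j) \<in> modular_space"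
  by (induction I rule: infinite_finite_induct) (auto simp: modular_space_0 modular_space_add)

lemma T_sum: "(\<And>i. i \<in> I \<Longrightarrow> a i \<in> modular_space) \<Longrightarrow> T (\<lambda>j. \<Sum>i\<in>I. a i j) = (\<Sum>i\<in>I. T (a i))"
  by (induction I rule: infinite_finite_induct) (auto simp: T_0 T_add modular_space_sum)

lemma T_lincomb:
  assumes "\<And>i. i \<in> I \<Longrightarrow> a i \<in> modular_space"
  shows "(\<lambda>j. \<Sum>i\<in>I. c i * a i j) \<in> modular_space"
    and "T (\<lambda>j. \<Sum>i\<in>I. c i * a i j) = (\<Sum>i\<in>I. c i *\<^sub>R T (a i))"
  using modular_space_sum[of I "\<lambda>i j. c i * a i j"] T_sum[of I "\<lambda>i j. c i * a i j"] assms
  by (auto simp: modular_space_scale T_scale)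

text \<open>The restriction can be moved to the test sequence, where it leaves the numerator
  unchanged and only lowers the denominator. Hence restrictions are contractions.\<close>

lemma Q_restr:
  assumes "s \<in> rat_seqs"
  shows "\<bar>Q s (restr A a)\<bar> \<le> \<bar>Q (restr A s) a\<bar>"
proof -
  let ?J = "{j. s j \<noteq> 0}"
  have J: "finite ?J" using assms by (simp add: rat_seqs_def)
  have "(\<Sum>j\<in>?J. m j (restr A s j)) \<le> (\<Sum>j\<in>?J. m j (s j))"
    by (intro sum_mono m_mono) (auto simp: restr_def)
  moreover have "Q (restr A s) a =
      (\<Sum>j\<in>?J. restr A s j * h j \<bar>restr A s j\<bar> * a j) / (1 + (\<Sum>j\<in>?J. m j (restr A s j)))"
    by (rule Q_eq[OF J]) (auto simp: restr_def split: if_splits)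
  moreover have "(\<Sum>j\<in>?J. restr A s j * h j \<bar>restr A s j\<bar> * a j)
      = (\<Sum>j\<in>?J. s j * h j \<bar>s j\<bar> * restr A a j)"
    by (intro sum.cong) (auto simp: restr_def)
  ultimately show ?thesis
    unfolding Q_def[of s] abs_divide using Q_denom_pos[of s ?J] Q_denom_pos[of "restr A s" ?J]
    by (auto intro!: divide_left_mono)
qed

lemma norm_T_restr:
  assumes "a \<in> modular_space"
  shows "norm (T (restr A a)) \<le> norm (T a)"
  using Q_restr Q_le_norm_T[OF assms restr_in_rat_seqs]
  by (intro norm_T_le modular_space_restr assms) (meson order_trans)

text \<open>Testing with \<open>unit_seq j\<close> gives \<open>h j 1 * a j / (1 + h j 1)\<close>,
  which is at least half of \<open>a j\<close> in absolute value because
  \<open>1 \<le> h j 1\<close>.\<close>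

lemma coord_le_norm_T:
  assumes "a \<in> modular_space"
  shows "\<bar>a j\<bar> \<le> 2 * norm (T a)"
proof -
  have "Q (unit_seq j) a = h j 1 * a j / (1 + h j 1)"
    by (subst Q_eq[of "{j}"]) (auto simp: unit_seq_def m_def split: if_splits)
  moreover have h: "1 \<le> h j 1" by (simp add: h_ge_1)
  ultimately have "h j 1 * \<bar>a j\<bar> / (1 + h j 1) \<le> norm (T a)"
    using Q_le_norm_T[OF assms unit_seq_in_rat_seqs[of j]] by (simp add: abs_mult)
  then have "h j 1 * \<bar>a j\<bar> \<le> norm (T a) * (1 + h j 1)" using h by (simp add: divide_le_eq)
  also have "\<dots> \<le> norm (T a) * (2 * h j 1)" using h by (intro mult_left_mono) auto
  finally have "h j 1 * \<bar>a j\<bar> \<le> h j 1 * (2 * norm (T a))" by (simp add: mult_ac)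
  then show ?thesis using h by simp
qed

lemma inj_on_T: "inj_on T modular_space"
proof (rule inj_onI)
  fix a b assume ab: "a \<in> modular_space" "b \<in> modular_space" "T a = T b"
  have "\<bar>a j - b j\<bar> \<le> 0" for j
    using coord_le_norm_T[OF modular_space_diff[OF ab(1,2)], of j] ab by (simp add: T_diff)
  then show "a = b" by (auto intro!: ext)
qed

lemma T_unit_pos: "0 < norm (T (unit_seq j))"
  using coord_le_norm_T[OF modular_space_unit_seq, of j j] by (simp add: unit_seq_def[of j] del: zero_less_norm_iff)

lemma norm_T_tail:
  assumes "a \<in> modular_space" "0 < e"
  shows "\<exists>N. \<forall>n\<ge>N. norm (T (restr {n..} a)) \<le> e"
proof -
  \<comment> \<open>Modular bounds below 1 do not give equally small norms, so the sequence is
    divided by \<open>e\<close> first.\<close>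
  obtain N where N: "\<And>n. n \<ge> N \<Longrightarrow> modular_le (restr {n..} (\<lambda>j. (1 / e) * a j)) 1"
    using modular_le_tail[OF modular_space_scale[OF assms(1), of "1 / e"], of 1] by auto
  have "norm (T (restr {n..} a)) \<le> e" if "n \<ge> N" for n
  proof -
    have "restr {n..} (\<lambda>j. (1 / e) * a j) = (\<lambda>j. (1 / e) * restr {n..} a j)"
      by (auto simp: restr_def)
    then have "norm (T (\<lambda>j. (1 / e) * restr {n..} a j)) \<le> 1"
      using norm_T_le_modular_le[OF N[OF that]] by simp
    then show ?thesis
      using assms by (subst (asm) T_scale) (auto simp: modular_space_restr divide_le_eq)
  qed
  then show ?thesis by blast
qed

section \<open>The subspace, its coordinates and completeness\<close>

definition X :: "linf set" where
  "X = T ` modular_space"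

definition coeff :: "linf \<Rightarrow> nat \<Rightarrow> real" where
  "coeff z = inv_into modular_space T z"

lemma coeff_modular_space: "z \<in> X \<Longrightarrow> coeff z \<in> modular_space"
  unfolding coeff_def X_def by (rule inv_into_into)

lemma T_coeff: "z \<in> X \<Longrightarrow> T (coeff z) = z"
  unfolding coeff_def X_def by (rule f_inv_into_f[of _ T modular_space])

lemma coeff_T: "a \<in> modular_space \<Longrightarrow> coeff (T a) = a"
  unfolding coeff_def by (rule inv_into_f_f[OF inj_on_T])

lemma T_in_X: "a \<in> modular_space \<Longrightarrow> T a \<in> X"
  by (simp add: X_def)

lemma subspace_X: "subspace X"
  unfolding subspace_def
proof (intro conjI ballI allI)
  show "0 \<in> X" using T_in_X[OF modular_space_0] by (simp add: T_0)
next
  fix x y assume "x \<in> X" "y \<in> X"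
  then show "x + y \<in> X" unfolding X_def by (auto simp: T_add[symmetric] intro!: imageI modular_space_add)
next
  fix c x assume "x \<in> X"
  then show "c *\<^sub>R x \<in> X" unfolding X_def by (auto simp: T_scale[symmetric] intro!: imageI modular_space_scale)
qed

lemma coeff_add: "x \<in> X \<Longrightarrow> y \<in> X \<Longrightarrow> coeff (x + y) = (\<lambda>j. coeff x j + coeff y j)"
  using coeff_T[OF modular_space_add[OF coeff_modular_space coeff_modular_space]] by (simp add: T_add coeff_modular_space T_coeff)

lemma coeff_scale: "x \<in> X \<Longrightarrow> coeff (c *\<^sub>R x) = (\<lambda>j. c * coeff x j)"
  using coeff_T[OF modular_space_scale[OF coeff_modular_space]] by (simp add: T_scale coeff_modular_space T_coeff)

lemma coeff_diff: "x \<in> X \<Longrightarrow> y \<in> X \<Longrightarrow> coeff (x - y) = (\<lambda>j. coeff x j - coeff y j)"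
  using coeff_T[OF modular_space_diff[OF coeff_modular_space coeff_modular_space]] by (simp add: T_diff coeff_modular_space T_coeff)

lemma coeff_le: "x \<in> X \<Longrightarrow> \<bar>coeff x j\<bar> \<le> 2 * norm x"
  using coord_le_norm_T[OF coeff_modular_space] by (simp add: T_coeff)

text \<open>Coordinates are bounded functionals, so they converge; a Fatou argument puts their limit
  into \<open>modular_space\<close>, and the test functionals, which see finitely many coordinates
  each, identify its image with \<open>z\<close>.\<close>

lemma closed_X_coords:
  assumes x: "\<And>k. x k \<in> X" and lim: "x \<longlonglongrightarrow> z"
  shows "z \<in> X" "\<And>j. (\<lambda>k. coeff (x k) j) \<longlonglongrightarrow> coeff z j"
proof -
  have "Cauchy (\<lambda>k. coeff (x k) j)" for j
  proof (rule CauchyI)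
    fix e :: real assume "0 < e"
    then obtain M where M: "\<And>k l. k \<ge> M \<Longrightarrow> l \<ge> M \<Longrightarrow> norm (x k - x l) < e / 2"
      using CauchyD[OF LIMSEQ_imp_Cauchy[OF lim], of "e / 2"] by auto
    have "norm (coeff (x k) j - coeff (x l) j) < e" if "k \<ge> M" "l \<ge> M" for k l
      using coeff_le[of "x k - x l" j] M[OF that] x by (simp add: coeff_diff subspace_diff[OF subspace_X])
    then show "\<exists>M. \<forall>k\<ge>M. \<forall>l\<ge>M. norm (coeff (x k) j - coeff (x l) j) < e" by blast
  qed
  then have "\<forall>j. \<exists>l. (\<lambda>k. coeff (x k) j) \<longlonglongrightarrow> l"
    by (simp add: Cauchy_convergent_iff convergent_def)
  then obtain a where a: "\<And>j. (\<lambda>k. coeff (x k) j) \<longlonglongrightarrow> a j" by metis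
  have "Bseq x" using lim by (meson convergentI convergent_imp_Bseq)
  then obtain c where c: "0 < c" "\<And>k. norm (x k) \<le> c" by (auto elim: BseqE)
  have bdk: "modular_le (\<lambda>j. coeff (x k) j / (2 * c)) 3" for k
    using modular_le_of_norm_T[OF coeff_modular_space[OF x[of k]]] c by (simp add: T_coeff x)
  \<comment> \<open>The extra factor 2 against the bound for \<open>x k\<close> replaces continuity
    of \<open>m\<close>: eventually
    \<open>\<bar>a j\<bar> / 2 \<le> \<bar>coeff (x k) j\<bar>\<close> on a finite set, and
    monotonicity suffices.\<close>
  have "modular_le (\<lambda>j. 1 / (4 * c) * a j) 3"
    unfolding modular_le_def
  proof (intro allI impI)
    fix J :: "nat set" assume J: "finite J"
    have "\<forall>\<^sub>F k in sequentially. \<bar>a j\<bar> / 2 \<le> \<bar>coeff (x k) j\<bar>" for j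
    proof (cases "a j = 0")
      case False
      have "\<forall>\<^sub>F k in sequentially. \<bar>a j\<bar> / 2 < \<bar>coeff (x k) j\<bar>"
        using tendsto_rabs[OF a[of j]] False by (intro order_tendstoD(1)) auto
      then show ?thesis by eventually_elim simp
    qed simp
    then have "\<forall>\<^sub>F k in sequentially. \<forall>j\<in>J. \<bar>a j\<bar> / 2 \<le> \<bar>coeff (x k) j\<bar>"
      by (intro eventually_ball_finite J) auto
    then obtain k where k: "\<And>j. j \<in> J \<Longrightarrow> \<bar>a j\<bar> / 2 \<le> \<bar>coeff (x k) j\<bar>"
      by (metis (no_types, lifting) eventually_happens trivial_limit_sequentially)
    have "(\<Sum>j\<in>J. m j (1 / (4 * c) * a j)) \<le> (\<Sum>j\<in>J. m j (coeff (x k) j / (2 * c)))"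
      using k c by (intro sum_mono m_mono) (auto simp: abs_mult abs_divide field_simps)
    also have "\<dots> \<le> 3" by (rule modular_le_sum[OF bdk J])
    finally show "(\<Sum>j\<in>J. m j (1 / (4 * c) * a j)) \<le> 3" .
  qed
  then have aL: "a \<in> modular_space" using modular_space_scale_iff[of "1 / (4 * c)" a] c modular_le_LamI by auto
  have "apply_bcontfun z n = apply_bcontfun (T a) n" for n
  proof -
    let ?s = "from_nat_into rat_seqs n"
    have "(\<lambda>k. Q ?s (coeff (x k))) \<longlonglongrightarrow> Q ?s a"
      unfolding Q_def using a Q_denom_pos[of ?s] by (intro tendsto_intros) (auto simp: less_imp_neq[symmetric])
    moreover have "(\<lambda>k. apply_bcontfun (x k) n) \<longlonglongrightarrow> apply_bcontfun z n"
      by (rule tendsto_uniform_limitI[OF tendsto_bcontfun_uniform_limit[OF lim]]) simp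
    moreover have "(\<lambda>k. apply_bcontfun (x k) n) = (\<lambda>k. Q ?s (coeff (x k)))"
      using apply_T[OF coeff_modular_space[OF x], of _ n] by (simp add: T_coeff x)
    ultimately have "apply_bcontfun z n = Q ?s a" by (simp only: LIMSEQ_unique)
    then show ?thesis by (simp only: apply_T[OF aL])
  qed
  then have z: "z = T a" by (rule bcontfun_eqI)
  then show "z \<in> X" using T_in_X[OF aL] by simp
  show "(\<lambda>k. coeff (x k) j) \<longlonglongrightarrow> coeff z j" for j using a z coeff_T[OF aL] by simp
qed

lemma banach_X: "banach_subspace X"
  unfolding banach_subspace_def closed_sequential_limits
  using subspace_X closed_X_coords(1) by blast

end

section \<open>Reflexivity\<close>

lemma restr_finite:
  assumes "finite J"
  shows "restr J a = (\<lambda>i. \<Sum>j\<in>J. a j * unit_seq j i)"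
proof
  fix i
  have "(\<Sum>j\<in>J. a j * unit_seq j i) = (\<Sum>j\<in>J. if j = i then a j else 0)"
    by (intro sum.cong) (auto simp: unit_seq_def)
  then show "restr J a i = (\<Sum>j\<in>J. a j * unit_seq j i)"
    using assms by (simp add: restr_def)
qed

lemma restr_split: "a = (\<lambda>j. restr {..<n} a j + restr {n..} a j)"
  by (auto simp: restr_def)

definition disjoint_seqs :: "nat \<Rightarrow> (nat \<Rightarrow> nat \<Rightarrow> real) \<Rightarrow> bool" where
  "disjoint_seqs n v \<longleftrightarrow> (\<forall>j. \<forall>k<n. \<forall>l<n. k \<noteq> l \<longrightarrow> v k j = 0 \<or> v l j = 0)"

lemma disjoint_seqs_blocks:
  assumes "mono N" "\<And>k j. v k j \<noteq> 0 \<Longrightarrow> N k \<le> j \<and> j < N (Suc k)"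
  shows "disjoint_seqs n v"
  unfolding disjoint_seqs_def
proof (intro allI impI)
  fix j k l :: nat assume "k \<noteq> l"
  show "v k j = 0 \<or> v l j = 0"
  proof (rule ccontr)
    assume "\<not> (v k j = 0 \<or> v l j = 0)"
    then have "N k \<le> j" "j < N (Suc k)" "N l \<le> j" "j < N (Suc l)" using assms(2) by auto
    moreover have "N (Suc k) \<le> N l \<or> N (Suc l) \<le> N k"
      using \<open>k \<noteq> l\<close> monoD[OF assms(1), of "Suc k" l] monoD[OF assms(1), of "Suc l" k] by linarith
    ultimately show False by linarith
  qed
qed

lemma disjoint_seqs_scale: "disjoint_seqs n v \<Longrightarrow> disjoint_seqs n (\<lambda>k j. c k * v k j)"
  unfolding disjoint_seqs_def by (metis mult_zero_right)

section \<open>Linear combinations in the dual and bidual\<close>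

lemma dual_spD:
  assumes "f \<in> dual_sp Y"
  shows "x \<in> Y \<Longrightarrow> y \<in> Y \<Longrightarrow> f (x + y) = f x + f y"
    and "x \<in> Y \<Longrightarrow> f (c *\<^sub>R x) = c * f x"
  using assms by (auto simp: dual_sp_def)

lemma dual_sp_bound:
  assumes "f \<in> dual_sp Y"
  obtains K where "0 < K" "\<And>x. x \<in> Y \<Longrightarrow> \<bar>f x\<bar> \<le> K * norm x"
proof -
  obtain C where C: "\<And>x. x \<in> Y \<Longrightarrow> \<bar>f x\<bar> \<le> C * norm x" using assms unfolding dual_sp_def by blast
  have "\<bar>f x\<bar> \<le> (\<bar>C\<bar> + 1) * norm x" if "x \<in> Y" for x
  proof -
    have "C * norm x \<le> (\<bar>C\<bar> + 1) * norm x" by (intro mult_right_mono) auto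
    then show ?thesis using C[OF that] by linarith
  qed
  then show ?thesis using that[of "\<bar>C\<bar> + 1"] by auto
qed

lemma dual_sp_sum:
  assumes "f \<in> dual_sp Y" "subspace Y" "\<And>i. i \<in> I \<Longrightarrow> x i \<in> Y"
  shows "f (\<Sum>i\<in>I. c i *\<^sub>R x i) = (\<Sum>i\<in>I. c i * f (x i))"
  using assms(3)
proof (induction I rule: infinite_finite_induct)
  case (insert i I)
  then have "(\<Sum>i\<in>I. c i *\<^sub>R x i) \<in> Y" "c i *\<^sub>R x i \<in> Y"
    by (auto intro!: subspace_sum[OF assms(2)] subspace_scale[OF assms(2)])
  then show ?case using insert by (simp add: dual_spD[OF assms(1)])
qed (use dual_spD(2)[OF assms(1) subspace_0[OF assms(2)], of 0] in auto)

lemma dual_norm_le: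
  assumes "0 \<in> Y" "\<And>x. x \<in> Y \<Longrightarrow> norm x \<le> 1 \<Longrightarrow> \<bar>f x\<bar> \<le> c"
  shows "dual_norm Y f \<le> c"
  unfolding dual_norm_def using assms by (intro cSUP_least) (auto intro: exI[of _ 0])

lemma dual_sp_add:
  assumes "f \<in> dual_sp Y" "g \<in> dual_sp Y"
  shows "(\<lambda>x. f x + g x) \<in> dual_sp Y"
proof -
  obtain K L where "\<And>x. x \<in> Y \<Longrightarrow> \<bar>f x\<bar> \<le> K * norm x" "\<And>x. x \<in> Y \<Longrightarrow> \<bar>g x\<bar> \<le> L * norm x"
    using dual_sp_bound[OF assms(1)] dual_sp_bound[OF assms(2)] by metis
  then have "\<forall>x\<in>Y. \<bar>f x + g x\<bar> \<le> (K + L) * norm x"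
    by (fastforce simp: distrib_right intro: order_trans[OF abs_triangle_ineq])
  then have bnd: "\<exists>C. \<forall>x\<in>Y. \<bar>f x + g x\<bar> \<le> C * norm x" by blast
  show ?thesis
    unfolding dual_sp_def mem_Collect_eq
    by (intro conjI bnd) (use assms in \<open>auto simp: dual_sp_def algebra_simps\<close>)
qed

lemma dual_sp_scale:
  assumes "f \<in> dual_sp Y"
  shows "(\<lambda>x. c * f x) \<in> dual_sp Y"
proof -
  obtain K where "\<And>x. x \<in> Y \<Longrightarrow> \<bar>f x\<bar> \<le> K * norm x" using dual_sp_bound[OF assms] by metis
  then have "\<forall>x\<in>Y. \<bar>c * f x\<bar> \<le> (\<bar>c\<bar> * K) * norm x"
    by (simp add: abs_mult mult.assoc mult_left_mono)
  then have bnd: "\<exists>C. \<forall>x\<in>Y. \<bar>c * f x\<bar> \<le> C * norm x" by blast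
  show ?thesis
    unfolding dual_sp_def mem_Collect_eq
    by (intro conjI bnd) (use assms in \<open>auto simp: dual_sp_def algebra_simps\<close>)
qed

lemma dual_sp_zero: "(\<lambda>x. 0) \<in> dual_sp Y"
  unfolding dual_sp_def by (auto intro: exI[of _ 0])

lemma dual_sp_lincomb:
  "(\<And>i. i \<in> I \<Longrightarrow> g i \<in> dual_sp Y) \<Longrightarrow> (\<lambda>x. \<Sum>i\<in>I. c i * g i x) \<in> dual_sp Y"
  by (induction I rule: infinite_finite_induct) (auto simp: dual_sp_zero dual_sp_add dual_sp_scale)

lemma bidual_lincomb:
  assumes "\<And>f g. f \<in> dual_sp Y \<Longrightarrow> g \<in> dual_sp Y \<Longrightarrow> \<Phi> (\<lambda>x. f x + g x) = \<Phi> f + \<Phi> g"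
    and "\<And>c f. f \<in> dual_sp Y \<Longrightarrow> \<Phi> (\<lambda>x. c * f x) = c * \<Phi> f"
    and "\<And>i. i \<in> I \<Longrightarrow> g i \<in> dual_sp Y"
  shows "\<Phi> (\<lambda>x. \<Sum>i\<in>I. c i * g i x) = (\<Sum>i\<in>I. c i * \<Phi> (g i) :: real)"
proof -
  have 0: "\<Phi> (\<lambda>x. 0) = 0" using assms(2)[OF dual_sp_zero, of 0] by simp
  show ?thesis using assms(3)
  proof (induction I rule: infinite_finite_induct)
    case (insert i I)
    then show ?case by (simp add: assms(1,2) dual_sp_scale dual_sp_lincomb)
  qed (auto simp: 0)
qed

text \<open>Squeezed from above by means of
  \<open>ln y = 2 * ln (sqrt y) \<le> 2 * sqrt y\<close>.\<close>

lemma mult_ln_inverse_tendsto_0: "((\<lambda>r::real. r * (2 + 2 * ln (1 + 1 / r))) \<longlongrightarrow> 0) (at_right 0)"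
proof (rule tendsto_sandwich[of "\<lambda>_. 0" _ _ "\<lambda>r. 2 * r + 4 * sqrt (r\<^sup>2 + r)"])
  have "0 \<le> r * (2 + 2 * ln (1 + 1 / r)) \<and> r * (2 + 2 * ln (1 + 1 / r)) \<le> 2 * r + 4 * sqrt (r\<^sup>2 + r)"
    if r: "0 < r" for r :: real
  proof -
    have p: "0 < 1 + 1 / r" using r by (simp add: add_pos_pos)
    have "ln (1 + 1 / r) = 2 * ln (sqrt (1 + 1 / r))" using p by (simp add: ln_sqrt)
    also have "\<dots> \<le> 2 * sqrt (1 + 1 / r)"
      using p ln_le_minus_one[of "sqrt (1 + 1 / r)"] by simp
    finally have "r * ln (1 + 1 / r) \<le> r * (2 * sqrt (1 + 1 / r))"
      using r by (intro mult_left_mono) auto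
    also have "\<dots> = 2 * (sqrt (r\<^sup>2) * sqrt (1 + 1 / r))" using r by simp
    also have "\<dots> = 2 * sqrt (r\<^sup>2 + r)"
      using r by (simp add: distrib_left power2_eq_square del: real_sqrt_abs2 flip: real_sqrt_mult)
    finally show ?thesis using r ln_pos_inv[OF r] by (simp add: algebra_simps)
  qed
  then show "\<forall>\<^sub>F r::real in at_right 0. 0 \<le> r * (2 + 2 * ln (1 + 1 / r))"
    "\<forall>\<^sub>F r::real in at_right 0. r * (2 + 2 * ln (1 + 1 / r)) \<le> 2 * r + 4 * sqrt (r\<^sup>2 + r)"
    by (auto simp: eventually_at_right_less intro: eventually_mono[OF eventually_at_right_less])
  have "((\<lambda>r::real. 2 * r + 4 * sqrt (r\<^sup>2 + r)) \<longlongrightarrow> 2 * 0 + 4 * sqrt (0\<^sup>2 + 0)) (at_right 0)"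
    by (intro tendsto_intros)
  then show "((\<lambda>r::real. 2 * r + 4 * sqrt (r\<^sup>2 + r)) \<longlongrightarrow> 0) (at_right 0)" by simp
qed simp

context modular
begin

lemma T_restr_finite:
  "finite J \<Longrightarrow> T (restr J a) = (\<Sum>j\<in>J. a j *\<^sub>R T (unit_seq j))"
  by (simp add: restr_finite T_lincomb(2) modular_space_unit_seq)

lemma m_sum_disjoint:
  assumes "disjoint_seqs n v"
  shows "m j (\<Sum>k<n. v k j) = (\<Sum>k<n. m j (v k j))"
proof (cases "\<exists>k<n. v k j \<noteq> 0")
  case True
  then obtain k where k: "k < n" "v k j \<noteq> 0" by blast
  then have z: "\<And>l. l < n \<Longrightarrow> l \<noteq> k \<Longrightarrow> v l j = 0"
    using assms unfolding disjoint_seqs_def by blast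
  have "(\<Sum>l<n. v l j) = v k j" "(\<Sum>l<n. m j (v l j)) = m j (v k j)"
    using k z by (auto simp: sum.remove[of "{..<n}" k])
  then show ?thesis by simp
qed auto

lemma modular_le_sum_disjoint:
  assumes "disjoint_seqs n v" "\<And>k. k < n \<Longrightarrow> modular_le (v k) (c k)"
  shows "modular_le (\<lambda>j. \<Sum>k<n. v k j) (\<Sum>k<n. c k)"
  unfolding modular_le_def
proof (intro allI impI)
  fix J :: "nat set" assume J: "finite J"
  have "(\<Sum>j\<in>J. m j (\<Sum>k<n. v k j)) = (\<Sum>k<n. \<Sum>j\<in>J. m j (v k j))"
    by (simp add: m_sum_disjoint[OF assms(1)] sum.swap[of _ J])
  also have "\<dots> \<le> (\<Sum>k<n. c k)" using assms(2) J by (intro sum_mono) (auto intro: modular_le_sum)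
  finally show "(\<Sum>j\<in>J. m j (\<Sum>k<n. v k j)) \<le> (\<Sum>k<n. c k)" .
qed

lemma norm_T_unit_le: "norm (T (unit_seq j)) \<le> 3"
proof -
  have "m j 1 \<le> 1 + 2 * ln 2" using h_log[of 1 j] by (simp add: m_def)
  also have "\<dots> \<le> 3" using ln_le_minus_one[of "2::real"] by simp
  finally have "modular_le (unit_seq j) 3"
    using modular_le_mono[OF modular_le_finite_support[of "{j}" "unit_seq j"]] by (simp add: unit_seq_def)
  then show ?thesis by (rule norm_T_le_modular_le) simp
qed

text \<open>Averages of \<open>n\<close> disjoint unit blocks tend to zero in norm, since the modular of each summand is
  of order \<open>ln n / n\<^sup>2\<close>. This bounds every functional on tails.\<close>

lemma dual_tail:
  assumes f: "f \<in> dual_sp X" and e: "0 < e"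
  shows "\<exists>N. \<forall>n\<ge>N. \<forall>a\<in>modular_space. norm (T a) \<le> 1 \<longrightarrow> \<bar>f (T (restr {n..} a))\<bar> \<le> e"
proof (rule ccontr)
  assume neg: "\<not> ?thesis"
  obtain K where K: "0 < K" "\<And>x. x \<in> X \<Longrightarrow> \<bar>f x\<bar> \<le> K * norm x" using dual_sp_bound[OF f] by blast
  have step: "\<exists>v n'. N \<le> n' \<and> v \<in> modular_space \<and> (\<forall>j. v j \<noteq> 0 \<longrightarrow> N \<le> j \<and> j < n') \<and> norm (T v) \<le> 1 \<and> e < f (T v)"
    for N
  proof -
    obtain n a where na: "N \<le> n" "a \<in> modular_space" "norm (T a) \<le> 1" "e < \<bar>f (T (restr {n..} a))\<bar>"
      using neg by (meson not_le)
    \<comment> \<open>Half of the excess over \<open>e\<close>, divided by \<open>K\<close>: cutting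
      off a tail of norm at most \<open>d\<close> keeps the value of \<open>f\<close> above
      \<open>e\<close>.\<close>
    define d where "d = (\<bar>f (T (restr {n..} a))\<bar> - e) / (2 * K)"
    have d: "0 < d" using na K by (simp add: d_def)
    obtain N' where N': "\<And>l. l \<ge> N' \<Longrightarrow> norm (T (restr {l..} a)) \<le> d"
      using norm_T_tail[OF na(2) d] by blast
    define n' where "n' = max n N'"
    let ?v = "restr {n..<n'} a"
    have "restr {n..} a = (\<lambda>j. ?v j + restr {n'..} a j)"
      by (auto simp: restr_def n'_def fun_eq_iff)
    then have "T (restr {n..} a) = T ?v + T (restr {n'..} a)"
      using T_add[OF modular_space_restr[OF na(2)] modular_space_restr[OF na(2)]] by metis
    then have "f (T (restr {n..} a)) = f (T ?v) + f (T (restr {n'..} a))"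
      using dual_spD(1)[OF f] T_in_X modular_space_restr na(2) by metis
    moreover have "\<bar>f (T (restr {n'..} a))\<bar> \<le> K * d"
      using K(2)[OF T_in_X[OF modular_space_restr[OF na(2), of "{n'..}"]]] N'[of n'] K(1)
      by (smt (verit) mult_left_mono max.cobounded2 n'_def)
    moreover have "K * d < \<bar>f (T (restr {n..} a))\<bar> - e" using na K by (simp add: d_def field_simps)
    ultimately have big: "e < \<bar>f (T ?v)\<bar>" by linarith
    have v: "?v \<in> modular_space" "norm (T ?v) \<le> 1" using modular_space_restr[OF na(2)] norm_T_restr[OF na(2)] na(3)
      by (auto intro: order_trans)
    show ?thesis
    proof (cases "0 < f (T ?v)")
      case True
      then show ?thesis using v big na(1)
        by (intro exI[of _ ?v] exI[of _ n']) (auto simp: restr_def n'_def)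
    next
      case False
      have "T (\<lambda>j. (-1) * ?v j) = (-1) *\<^sub>R T ?v" by (rule T_scale[OF v(1)])
      then have "norm (T (\<lambda>j. (-1) * ?v j)) \<le> 1" "f (T (\<lambda>j. (-1) * ?v j)) = - f (T ?v)"
        using v dual_spD(2)[OF f T_in_X[OF v(1)], of "-1"] by simp_all
      then show ?thesis using modular_space_scale[OF v(1), of "-1"] big na(1) False
        by (intro exI[of _ "\<lambda>j. (-1) * ?v j"] exI[of _ n']) (auto simp: restr_def n'_def)
    qed
  qed
  obtain V G where VG: "\<And>N. N \<le> G N \<and> V N \<in> modular_space \<and> (\<forall>j. V N j \<noteq> 0 \<longrightarrow> N \<le> j \<and> j < G N)
      \<and> norm (T (V N)) \<le> 1 \<and> e < f (T (V N))"
    using step by metis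
  \<comment> \<open>Iterating the end points makes the blocks consecutive, hence disjoint.\<close>
  define N where "N k = (G ^^ k) 0" for k
  define v where "v k = V (N k)" for k
  have NS: "N (Suc k) = G (N k)" for k by (simp add: N_def)
  have mN: "mono N" unfolding mono_iff_le_Suc using VG NS by simp
  have v: "v k \<in> modular_space" "norm (T (v k)) \<le> 1" "e < f (T (v k))" for k using VG by (auto simp: v_def)
  have dis: "disjoint_seqs n v" for n
    by (rule disjoint_seqs_blocks[OF mN]) (use VG in \<open>auto simp: v_def NS\<close>)
  have bdv: "modular_le (\<lambda>j. v k j / 2) 3" for k using modular_le_of_norm_T[OF v(1) v(2)] by simp
  \<comment> \<open>The combination of \<open>n\<close> blocks with coefficients
    \<open>r / 2 = c / n\<close> gets a value of \<open>f\<close> above \<open>c * e = K\<close>.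
    Its modular is at most \<open>6 * c\<close> times a quantity tending to 0 with \<open>r\<close>,
    so for large \<open>n\<close> its norm is at most 1, a contradiction.\<close>
  define c where "c = K / e"
  have c: "0 < c" using K e by (simp add: c_def)
  have "filterlim (\<lambda>n. 2 * c / real n) (at_right 0) sequentially"
    using c by (intro tendsto_imp_filterlim_at_right lim_const_over_n eventually_sequentiallyI[of 1]) auto
  from filterlim_compose[OF mult_ln_inverse_tendsto_0 this]
  have "(\<lambda>n. (2 * c / real n) * (2 + 2 * ln (1 + 1 / (2 * c / real n)))) \<longlonglongrightarrow> 0" by simp
  then have "\<forall>\<^sub>F n in sequentially. (2 * c / real n) * (2 + 2 * ln (1 + 1 / (2 * c / real n))) < 1 / (6 * c)"
    using c by (intro order_tendstoD(2)) auto
  then have "\<forall>\<^sub>F n in sequentially. (2 * c / real n) * (2 + 2 * ln (1 + 1 / (2 * c / real n))) < 1 / (6 * c) \<and> n > 0"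
    using eventually_gt_at_top[of 0] by eventually_elim auto
  then obtain n where n: "(2 * c / real n) * (2 + 2 * ln (1 + 1 / (2 * c / real n))) < 1 / (6 * c)" "n > 0"
    by (metis (mono_tags, lifting) eventually_happens trivial_limit_sequentially)
  define r where "r = 2 * c / real n"
  have r: "0 < r" using c n by (simp add: r_def)
  let ?k = "r\<^sup>2 * (2 + 2 * ln (1 + 1 / r))"
  have L: "0 < ln (1 + 1 / r)" using r by (rule ln_pos_inv)
  have "modular_le (\<lambda>j. v k j / 2 * r) (?k * 3)" for k
  proof (rule modular_le_le[OF bdv])
    show "0 \<le> ?k" using L by simp
    fix j
    have "m j (v k j / 2 * r) \<le> r\<^sup>2 * (1 + h j \<bar>r\<bar>) * m j (v k j / 2)"
      using r by (intro m_mult) auto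
    also have "\<dots> \<le> ?k * m j (v k j / 2)"
      using h_log[OF r, of j] r by (intro mult_right_mono mult_left_mono) auto
    finally show "m j (v k j / 2 * r) \<le> ?k * m j (v k j / 2)" .
  qed
  then have b: "modular_le (\<lambda>j. \<Sum>k<n. (r / 2) * v k j) (\<Sum>k<n. ?k * 3)"
    using dis by (intro modular_le_sum_disjoint disjoint_seqs_scale) (auto simp: mult_ac)
  have "(\<Sum>k<n. ?k * 3) = 3 * (real n * r) * (r * (2 + 2 * ln (1 + 1 / r)))"
    by (simp add: power2_eq_square mult_ac)
  also have "\<dots> = 6 * c * (r * (2 + 2 * ln (1 + 1 / r)))" using n by (simp add: r_def)
  also have "\<dots> \<le> 6 * c * (1 / (6 * c))" using n c unfolding r_def by (intro mult_left_mono) auto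
  also have "\<dots> = 1" using c by simp
  finally have nrm: "norm (T (\<lambda>j. \<Sum>k<n. (r / 2) * v k j)) \<le> 1"
    using norm_T_le_modular_le modular_le_mono[OF b] by simp
  have TA: "T (\<lambda>j. \<Sum>k<n. (r / 2) * v k j) = (\<Sum>k<n. (r / 2) *\<^sub>R T (v k))"
    "(\<lambda>j. \<Sum>k<n. (r / 2) * v k j) \<in> modular_space"
    using T_lincomb[of "{..<n}" v "\<lambda>_. r / 2"] v(1) by auto
  have "f (T (\<lambda>j. \<Sum>k<n. (r / 2) * v k j)) = (\<Sum>k<n. (r / 2) * f (T (v k)))"
    unfolding TA using v(1) by (intro dual_sp_sum[OF f subspace_X] T_in_X)
  moreover have "(\<Sum>k<n. (r / 2) * e) < (\<Sum>k<n. (r / 2) * f (T (v k)))"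
    using v(3) r n by (intro sum_strict_mono) auto
  moreover have "(\<Sum>k<n. (r / 2) * e) = c * e" using n by (simp add: r_def)
  moreover have "\<bar>f (T (\<lambda>j. \<Sum>k<n. (r / 2) * v k j))\<bar> \<le> K * 1"
    using K(2)[OF T_in_X[OF TA(2)]] nrm K(1) by (meson mult_left_mono order_trans less_imp_le)
  moreover have "c * e = K" using e by (simp add: c_def)
  ultimately show False by linarith
qed

section \<open>Coordinate functionals and reflexivity\<close>

text \<open>Zero off \<open>X\<close>, as membership in \<open>dual_sp\<close> demands.\<close>

definition coord :: "nat \<Rightarrow> linf \<Rightarrow> real" where
  "coord j z = (if z \<in> X then coeff z j else 0)"

lemma coord_dual: "coord j \<in> dual_sp X"
  unfolding dual_sp_def
  by (auto simp: coord_def coeff_add coeff_scale subspace_add[OF subspace_X] subspace_scale[OF subspace_X]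
      intro!: exI[of _ 2] coeff_le)

text \<open>A unit vector is its own tail from its index on, so \<open>dual_tail\<close> applies
  after scaling it by 1/3 into the unit ball.\<close>

lemma dual_unit_tendsto_0:
  assumes "f \<in> dual_sp X"
  shows "(\<lambda>j. f (T (unit_seq j))) \<longlonglongrightarrow> 0"
proof (rule LIMSEQ_I)
  fix e :: real assume e: "0 < e"
  obtain N where N: "\<And>n a. n \<ge> N \<Longrightarrow> a \<in> modular_space \<Longrightarrow> norm (T a) \<le> 1 \<Longrightarrow> \<bar>f (T (restr {n..} a))\<bar> \<le> e / 6"
    using dual_tail[OF assms, of "e / 6"] e by auto
  have "norm (f (T (unit_seq n)) - 0) < e" if "n \<ge> N" for n
  proof -
    let ?a = "\<lambda>j. 1 / 3 * unit_seq n j"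
    have T: "T ?a = (1 / 3) *\<^sub>R T (unit_seq n)" by (rule T_scale[OF modular_space_unit_seq])
    have "restr {n..} ?a = ?a" by (auto simp: restr_def unit_seq_def)
    then have "\<bar>f (T ?a)\<bar> \<le> e / 6"
      using N[OF that modular_space_scale[OF modular_space_unit_seq[of n], of "1 / 3"]] norm_T_unit_le[of n] T by simp
    then show ?thesis
      unfolding T using e dual_spD(2)[OF assms T_in_X[OF modular_space_unit_seq[of n]], of "1 / 3"] by simp
  qed
  then show "\<exists>N. \<forall>n\<ge>N. norm (f (T (unit_seq n)) - 0) < e" by blast
qed

lemma dual_restr_finite:
  assumes "f \<in> dual_sp X" "finite J"
  shows "f (T (restr J a)) = (\<Sum>j\<in>J. f (T (unit_seq j)) * a j)"
  unfolding T_restr_finite[OF assms(2)]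
  by (subst dual_sp_sum[OF assms(1) subspace_X]) (auto simp: T_in_X modular_space_unit_seq mult_ac)

lemma dual_split:
  assumes "f \<in> dual_sp X" "a \<in> modular_space"
  shows "f (T a) = (\<Sum>j<n. f (T (unit_seq j)) * a j) + f (T (restr {n..} a))"
proof -
  have "T a = T (restr {..<n} a) + T (restr {n..} a)"
    using T_add[OF modular_space_restr[OF assms(2)] modular_space_restr[OF assms(2)]] restr_split[of a n] by metis
  then have "f (T a) = f (T (restr {..<n} a)) + f (T (restr {n..} a))"
    using dual_spD(1)[OF assms(1)] T_in_X modular_space_restr assms(2) by metis
  then show ?thesis by (simp add: dual_restr_finite[OF assms(1)])
qed

text \<open>The candidate for \<open>\<Phi>\<close> has coordinates \<open>\<Phi> (coord j)\<close>.
  Each \<open>Q s\<close> is a finite combination of coordinate functionals bounded by the norm, so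
  \<open>\<Phi>\<close> bounds all \<open>Q s \<xi>\<close> and \<open>\<xi>\<close> lies in
  \<open>modular_space\<close>. By \<open>dual_tail\<close> every \<open>f\<close> is a norm limit
  of such combinations, on which \<open>\<Phi>\<close> and evaluation at \<open>T \<xi>\<close>
  agree.\<close>

lemma reflexive_X: "reflexive_sp X"
  unfolding reflexive_sp_def
proof (intro allI impI, elim conjE exE)
  fix \<Phi> :: "(linf \<Rightarrow> real) \<Rightarrow> real" and C
  assume add: "\<forall>f\<in>dual_sp X. \<forall>g\<in>dual_sp X. \<Phi> (\<lambda>x. f x + g x) = \<Phi> f + \<Phi> g"
    and scale: "\<forall>c. \<forall>f\<in>dual_sp X. \<Phi> (\<lambda>x. c * f x) = c * \<Phi> f"
    and bound: "\<forall>f\<in>dual_sp X. \<bar>\<Phi> f\<bar> \<le> C * dual_norm X f"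
  have zX: "0 \<in> X" by (rule subspace_0[OF subspace_X])
  \<comment> \<open>A strictly positive replacement for \<open>C\<close>, whose sign is
    unknown.\<close>
  define D where "D = \<bar>C\<bar> + 1"
  have D: "0 < D" by (simp add: D_def)
  have \<Phi>_le: "\<bar>\<Phi> g\<bar> \<le> D * r"
    if "g \<in> dual_sp X" "\<And>x. x \<in> X \<Longrightarrow> norm x \<le> 1 \<Longrightarrow> \<bar>g x\<bar> \<le> r" for g r
  proof -
    have r: "0 \<le> r" using that(2)[OF zX] by (smt (verit) norm_zero abs_ge_zero)
    have n: "dual_norm X g \<le> r" by (rule dual_norm_le[OF zX that(2)])
    have n0: "0 \<le> dual_norm X g"
    proof -
      have "bdd_above ((\<lambda>x. \<bar>g x\<bar>) ` {x \<in> X. norm x \<le> 1})"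
        using that(2) by (auto intro: bdd_aboveI[where M = r])
      then have "\<bar>g 0\<bar> \<le> dual_norm X g" unfolding dual_norm_def
        using zX by (intro cSUP_upper) auto
      then show ?thesis by linarith
    qed
    have "\<bar>\<Phi> g\<bar> \<le> C * dual_norm X g" using bound that(1) by blast
    also have "\<dots> \<le> D * dual_norm X g" using n0 by (intro mult_right_mono) (auto simp: D_def)
    also have "\<dots> \<le> D * r" using n D by simp
    finally show ?thesis .
  qed
  define \<xi> where "\<xi> j = \<Phi> (coord j)" for j
  have lin: "\<Phi> (\<lambda>x. \<Sum>i\<in>I. c i * coord i x) = (\<Sum>i\<in>I. c i * \<xi> i)" for I c
    unfolding \<xi>_def by (rule bidual_lincomb) (use add scale coord_dual in auto)
  have "\<bar>Q s \<xi>\<bar> \<le> D" if s: "s \<in> rat_seqs" for s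
  proof -
    let ?J = "{j. s j \<noteq> 0}"
    let ?d = "1 + (\<Sum>j\<in>?J. m j (s j))"
    \<comment> \<open>The functional \<open>Q s\<close>, read as an element of the dual of
      \<open>X\<close>.\<close>
    let ?g = "\<lambda>x. \<Sum>j\<in>?J. (s j * h j \<bar>s j\<bar> / ?d) * coord j x"
    have Qe: "Q s a = (\<Sum>j\<in>?J. (s j * h j \<bar>s j\<bar> / ?d) * a j)" for a
      unfolding Q_def by (simp add: sum_divide_distrib)
    have "\<bar>\<Phi> ?g\<bar> \<le> D * 1"
    proof (rule \<Phi>_le)
      show "?g \<in> dual_sp X" by (intro dual_sp_lincomb coord_dual)
      fix x assume x: "x \<in> X" "norm x \<le> 1"
      have "?g x = Q s (coeff x)" unfolding Qe using x by (simp add: coord_def)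
      then show "\<bar>?g x\<bar> \<le> 1" using Q_le_norm_T[OF coeff_modular_space[OF x(1)] s] x by (simp add: T_coeff)
    qed
    then show ?thesis unfolding lin Qe by simp
  qed
  then have "modular_le (\<lambda>j. \<xi> j / (2 * D)) 3" using D by (intro modular_le_of_Q_le)
  then have \<xi>: "\<xi> \<in> modular_space" using modular_space_scale_iff[of "1 / (2 * D)" \<xi>] D modular_le_LamI by auto
  have "\<Phi> f = f (T \<xi>)" if f: "f \<in> dual_sp X" for f
  proof -
    obtain K where K: "0 < K" "\<And>x. x \<in> X \<Longrightarrow> \<bar>f x\<bar> \<le> K * norm x" using dual_sp_bound[OF f] by blast
    have "\<bar>\<Phi> f - f (T \<xi>)\<bar> \<le> 0 + e" if e: "0 < e" for e
    proof -
      \<comment> \<open>Splits \<open>e\<close> into the error \<open>D * d\<close> of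
        \<open>\<Phi>\<close> on the remainder of \<open>f\<close> and the error
        \<open>K * d\<close> of \<open>f\<close> on the tail of \<open>\<xi>\<close>.\<close>
      define d where "d = e / (D + K)"
      have d: "0 < d" "(D + K) * d = e" using e D K by (auto simp: d_def)
      obtain N where N: "\<And>n a. n \<ge> N \<Longrightarrow> a \<in> modular_space \<Longrightarrow> norm (T a) \<le> 1 \<Longrightarrow> \<bar>f (T (restr {n..} a))\<bar> \<le> d"
        using dual_tail[OF f d(1)] by blast
      obtain N' where N': "\<And>n. n \<ge> N' \<Longrightarrow> norm (T (restr {n..} \<xi>)) \<le> d"
        using norm_T_tail[OF \<xi> d(1)] by blast
      define n where "n = max N N'"
      \<comment> \<open>A partial sum of the expansion of \<open>f\<close>; the remainder is
        \<open>f\<close> evaluated on tails from \<open>n\<close> on.\<close>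
      let ?p = "\<lambda>x. \<Sum>j<n. f (T (unit_seq j)) * coord j x"
      let ?g = "\<lambda>x. f x + (-1) * ?p x"
      have p: "?p \<in> dual_sp X" by (intro dual_sp_lincomb coord_dual)
      have "\<bar>\<Phi> ?g\<bar> \<le> D * d"
      proof (rule \<Phi>_le)
        show "?g \<in> dual_sp X" by (intro dual_sp_add dual_sp_scale f p)
        fix x assume x: "x \<in> X" "norm x \<le> 1"
        have "?g x = f (T (restr {n..} (coeff x)))"
          using dual_split[OF f coeff_modular_space[OF x(1)], of n] x by (simp add: T_coeff coord_def)
        then show "\<bar>?g x\<bar> \<le> d" using N[of n "coeff x"] x coeff_modular_space by (simp add: T_coeff n_def)
      qed
      moreover have "\<Phi> ?g = \<Phi> f + (-1) * \<Phi> ?p"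
        using add[rule_format, OF f dual_sp_scale[OF p, of "-1"]] scale[rule_format, OF p, of "-1"]
        by simp
      moreover have "f (T \<xi>) = \<Phi> ?p + f (T (restr {n..} \<xi>))"
        unfolding lin using dual_split[OF f \<xi>] .
      moreover have "\<bar>f (T (restr {n..} \<xi>))\<bar> \<le> K * d"
        using K(2)[OF T_in_X[OF modular_space_restr[OF \<xi>, of "{n..}"]]] N'[of n] K(1)
        by (smt (verit) mult_left_mono max.cobounded2 n_def)
      ultimately show ?thesis using d(2) by (simp add: algebra_simps)
    qed
    then have "\<bar>\<Phi> f - f (T \<xi>)\<bar> \<le> 0" by (rule field_le_epsilon)
    then show ?thesis by simp
  qed
  then show "\<exists>x\<in>X. \<forall>f\<in>dual_sp X. \<Phi> f = f x" using T_in_X[OF \<xi>] by blast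
qed

end

section \<open>Block sequences\<close>

text \<open>The pairing function splits the indices into infinitely many infinite classes. The same
  map later provides a sequence taking every value infinitely often.\<close>

definition colour :: "nat \<Rightarrow> nat" where
  "colour j = fst (prod_decode j)"

definition place :: "nat \<Rightarrow> nat \<Rightarrow> nat" where
  "place p i = prod_encode (p, i)"

lemma colour_place [simp]: "colour (place p i) = p"
  by (simp add: colour_def place_def)

lemma place_eq [simp]: "place p i = place q k \<longleftrightarrow> p = q \<and> i = k"
  by (simp add: place_def)

lemma place_ge: "i \<le> place p i"
  unfolding place_def by (rule le_prod_encode_2)

lemma place_exhaust:
  obtains i where "j = place (colour j) i"
  by (metis colour_def place_def prod.collapse prod_decode_inverse)

lemma sum_place: "(\<Sum>j\<in>place p ` I. f j) = (\<Sum>i\<in>I. f (place p i))"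
  by (subst sum.reindex) (auto intro: inj_onI)

definition emb :: "nat \<Rightarrow> (nat \<Rightarrow> real) \<Rightarrow> nat \<Rightarrow> real" where
  "emb p a j = (if colour j = p then a (snd (prod_decode j)) else 0)"

lemma emb_place [simp]: "emb p a (place p i) = a i"
  by (simp add: emb_def place_def colour_def)

lemma emb_other: "colour j \<noteq> p \<Longrightarrow> emb p a j = 0"
  by (simp add: emb_def)

lemma emb_eq_sum:
  assumes "\<And>i. i \<ge> n \<Longrightarrow> a i = 0"
  shows "emb p a = (\<lambda>j. \<Sum>i<n. a i * unit_seq (place p i) j)"
proof
  fix j
  obtain i where j: "j = place (colour j) i" using place_exhaust .
  have "(\<Sum>k<n. a k * unit_seq (place p k) j) = (\<Sum>k<n. if k = i then (if colour j = p then a k else 0) else 0)"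
    by (subst j, intro sum.cong) (auto simp: unit_seq_def)
  also have "\<dots> = (if colour j = p then a i else 0)" using assms[of i] by auto
  also have "\<dots> = emb p a (place (colour j) i)" by (simp add: emb_other)
  also have "\<dots> = emb p a j" by (simp only: j[symmetric])
  finally show "emb p a j = (\<Sum>i<n. a i * unit_seq (place p i) j)" by (rule sym)
qed

section \<open>Finitely supported coefficients, domination and spreading models\<close>

lemma fin_suppE:
  assumes "fin_supp a"
  obtains n where "\<And>i. i \<ge> n \<Longrightarrow> a i = 0"
proof -
  obtain n where "\<forall>i\<in>{i. a i \<noteq> 0}. i < n"
    using assms unfolding fin_supp_def finite_nat_set_iff_bounded by blast
  then show ?thesis using that[of n] by (meson mem_Collect_eq not_le)
qed

lemma fin_suppI:
  assumes "\<And>i. i \<ge> n \<Longrightarrow> a i = 0"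
  shows "fin_supp a"
  unfolding fin_supp_def finite_nat_set_iff_bounded using assms by (meson mem_Collect_eq not_le)

text \<open>By homogeneity it suffices to bound \<open>U\<close> on the unit ball of
  \<open>V\<close>. Sequences in the kernel of \<open>V\<close> stay in that ball under all
  scalings, which forces \<open>U\<close> to vanish on them.\<close>

lemma dominatesI_unit_ball:
  assumes U: "sm_seminorm U" and V: "sm_seminorm V"
    and le: "\<And>a. fin_supp a \<Longrightarrow> V a \<le> 1 \<Longrightarrow> U a \<le> C"
  shows "dominates V U"
proof -
  have fs: "fin_supp (\<lambda>i. c * a i)" if "fin_supp a" for c a
    using that unfolding fin_supp_def by (rule finite_subset[rotated]) auto
  have sc: "U (\<lambda>i. c * a i) = \<bar>c\<bar> * U a" "V (\<lambda>i. c * a i) = \<bar>c\<bar> * V a" "0 \<le> V a" "0 \<le> U a"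
    if "fin_supp a" for c a
    using U V that by (auto simp: sm_seminorm_def)
  have "U a \<le> C * V a" if a: "fin_supp a" for a
  proof (cases "V a = 0")
    case False
    then have v: "0 < V a" using sc(3)[OF a] by simp
    have "U (\<lambda>i. (1 / V a) * a i) \<le> C" using v by (intro le fs a) (simp only: sc[OF a], simp)
    then show ?thesis using v by (simp only: sc[OF a]) (simp add: divide_le_eq)
  next
    case True
    have "U a \<le> 0"
    proof (rule ccontr)
      assume "\<not> U a \<le> 0"
      then have u: "0 < U a" by simp
      have "U (\<lambda>i. ((\<bar>C\<bar> + 1) / U a) * a i) \<le> C" using True by (intro le fs a) (subst sc(2)[OF a], simp)
      then show False using u by (simp only: sc[OF a]) simp
    qed
    then show ?thesis using True by simp
  qed
  then show ?thesis unfolding dominates_def by blast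
qed

text \<open>Frees the generating condition from the bound 1 on coefficients and from the link
  between length and starting index, at the price of the factor 2.\<close>

lemma generates_smD:
  assumes g: "generates_sm x N" and a: "\<And>i. i \<ge> n \<Longrightarrow> a i = 0"
  shows "\<exists>K. \<forall>k. strict_mono k \<longrightarrow> K \<le> k 0 \<longrightarrow>
     N a \<le> 2 * norm (\<Sum>i<n. a i *\<^sub>R x (k i)) \<and> norm (\<Sum>i<n. a i *\<^sub>R x (k i)) \<le> 2 * N a"
proof -
  obtain \<epsilon> where \<epsilon>: "decseq \<epsilon>" "\<epsilon> \<longlonglongrightarrow> 0" and
    ap: "\<And>n a k. (\<forall>i<n. \<bar>a i\<bar> \<le> 1) \<Longrightarrow> (\<forall>i\<ge>n. a i = 0) \<Longrightarrow> strict_mono_on {..<n} k \<Longrightarrow> n \<le> k 0 + 1 \<Longrightarrow>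
       N a / (1 + \<epsilon> n) \<le> norm (\<Sum>i<n. a i *\<^sub>R x (k i)) \<and>
       norm (\<Sum>i<n. a i *\<^sub>R x (k i)) \<le> (1 + \<epsilon> n) * N a"
    using g unfolding generates_sm_def by blast
  have sn: "sm_seminorm N" using g by (simp add: generates_sm_def)
  \<comment> \<open>Dividing by \<open>A\<close> brings the coefficients into the interval from -1
    to 1; the summand 1 keeps \<open>A\<close> positive.\<close>
  define A where "A = 1 + (\<Sum>i<n. \<bar>a i\<bar>)"
  have A: "0 < A" unfolding A_def by (intro add_pos_nonneg sum_nonneg) auto
  define b where "b = (\<lambda>i. (1 / A) * a i)"
  have aA: "\<bar>a i\<bar> \<le> A" if "i < n" for i
  proof -
    have "\<bar>a i\<bar> \<le> (\<Sum>i<n. \<bar>a i\<bar>)" using that by (intro member_le_sum) auto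
    then show ?thesis by (simp add: A_def)
  qed
  have b1: "\<bar>b i\<bar> \<le> 1" for i
    using aA[of i] a[of i] A by (cases "i < n") (auto simp: b_def)
  have fa: "fin_supp a" by (rule fin_suppI[OF a])
  have fb: "fin_supp b" by (rule fin_suppI[of n]) (simp add: b_def a)
  have "N b = \<bar>1 / A\<bar> * N a" using sn fa unfolding sm_seminorm_def b_def by blast
  then have Nb: "N b = N a / A" using A by simp
  have Nb0: "0 \<le> N b" using sn fb by (simp add: sm_seminorm_def)
  have "\<forall>\<^sub>F k in sequentially. \<epsilon> k < 1" using \<epsilon>(2) by (rule order_tendstoD(2)) simp
  then obtain n0 where n0: "\<And>k. k \<ge> n0 \<Longrightarrow> \<epsilon> k < 1" by (auto simp: eventually_sequentially)
  \<comment> \<open>The sequence is padded with zeros to a length at which the error is below 1.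
    This length is also the required lower bound for \<open>k 0\<close>.\<close>
  define n' where "n' = max n n0"
  have e: "\<epsilon> n' < 1" "0 \<le> \<epsilon> n'" using n0[of n'] decseq_ge[OF \<epsilon>, of n'] by (auto simp: n'_def)
  have "N a \<le> 2 * norm (\<Sum>i<n. a i *\<^sub>R x (k i)) \<and> norm (\<Sum>i<n. a i *\<^sub>R x (k i)) \<le> 2 * N a"
    if k: "strict_mono k" "n' \<le> k 0" for k
  proof -
    have s: "(\<Sum>i<n'. b i *\<^sub>R x (k i)) = (1 / A) *\<^sub>R (\<Sum>i<n. a i *\<^sub>R x (k i))"
    proof -
      have "(\<Sum>i<n'. b i *\<^sub>R x (k i)) = (\<Sum>i<n. b i *\<^sub>R x (k i))"
        by (intro sum.mono_neutral_right) (auto simp: n'_def b_def a)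
      then show ?thesis by (simp add: b_def scaleR_sum_right)
    qed
    have 1: "N b / (1 + \<epsilon> n') \<le> norm (\<Sum>i<n'. b i *\<^sub>R x (k i))"
      "norm (\<Sum>i<n'. b i *\<^sub>R x (k i)) \<le> (1 + \<epsilon> n') * N b"
      using ap[of n' b k] b1 a k monotone_on_subset[OF k(1) subset_UNIV] by (auto simp: b_def n'_def)
    have "N b / 2 \<le> N b / (1 + \<epsilon> n')" using e Nb0 by (intro divide_left_mono) auto
    moreover have "(1 + \<epsilon> n') * N b \<le> 2 * N b" using e Nb0 by (intro mult_right_mono) auto
    ultimately have "N b / 2 \<le> norm (\<Sum>i<n'. b i *\<^sub>R x (k i))" "norm (\<Sum>i<n'. b i *\<^sub>R x (k i)) \<le> 2 * N b"
      using 1 by linarith+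
    then show ?thesis unfolding s Nb using A by (auto simp: field_simps)
  qed
  then show ?thesis by blast
qed

context modular
begin

section \<open>Gliding hump: approximation by disjoint blocks\<close>

lemma coeff_tendsto_0: "weakly_null X x \<Longrightarrow> (\<lambda>k. coeff (x k) j) \<longlonglongrightarrow> 0"
  using coord_dual[of j] unfolding weakly_null_def coord_def by auto

lemma head_tendsto_0:
  assumes "weakly_null X x"
  shows "(\<lambda>k. norm (T (restr {..<M} (coeff (x k))))) \<longlonglongrightarrow> 0"
proof -
  have "(\<lambda>k. norm (\<Sum>j<M. coeff (x k) j *\<^sub>R T (unit_seq j))) \<longlonglongrightarrow> norm (\<Sum>j<M. 0 *\<^sub>R T (unit_seq j))"
    by (intro tendsto_intros coeff_tendsto_0 assms)
  then show ?thesis by (simp add: T_restr_finite)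
qed

text \<open>Far out in the sequence the part before \<open>M\<close> is small because finitely many
  coordinates tend to 0; then \<open>M'\<close> cuts off a small tail of the chosen element.\<close>

lemma block_step:
  assumes x: "weakly_null X x" and I: "infinite I" and \<eta>: "0 < \<eta>"
  shows "\<exists>k M'. l < k \<and> k \<in> I \<and> M \<le> M' \<and> norm (x k - T (restr {M..<M'} (coeff (x k)))) \<le> \<eta>"
proof -
  have "\<forall>\<^sub>F k in sequentially. norm (T (restr {..<M} (coeff (x k)))) < \<eta> / 2"
    using head_tendsto_0[OF x] \<eta> by (intro order_tendstoD(2)) auto
  then obtain k0 where k0: "\<And>k. k \<ge> k0 \<Longrightarrow> norm (T (restr {..<M} (coeff (x k)))) < \<eta> / 2"
    by (auto simp: eventually_sequentially)
  obtain k where k: "k \<in> I" "max k0 l < k" using I unfolding infinite_nat_iff_unbounded by blast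
  have xk: "x k \<in> X" using x by (simp add: weakly_null_def)
  note c = coeff_modular_space[OF xk]
  obtain N where N: "\<And>n. n \<ge> N \<Longrightarrow> norm (T (restr {n..} (coeff (x k)))) \<le> \<eta> / 2"
    using norm_T_tail[OF c, of "\<eta> / 2"] \<eta> by auto
  define M' where "M' = max M N"
  have "coeff (x k) = (\<lambda>j. (restr {..<M} (coeff (x k)) j + restr {M'..} (coeff (x k)) j) + restr {M..<M'} (coeff (x k)) j)"
    by (auto simp: restr_def fun_eq_iff M'_def)
  then have "T (coeff (x k)) = (T (restr {..<M} (coeff (x k))) + T (restr {M'..} (coeff (x k)))) + T (restr {M..<M'} (coeff (x k)))"
    using T_add modular_space_restr[OF c] modular_space_add by metis
  then have "x k - T (restr {M..<M'} (coeff (x k))) = T (restr {..<M} (coeff (x k))) + T (restr {M'..} (coeff (x k)))"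
    using T_coeff[OF xk] by (metis add_diff_cancel_right')
  also have "norm \<dots> \<le> \<eta> / 2 + \<eta> / 2"
    using k0[of k] N[of M'] k by (intro order_trans[OF norm_triangle_ineq] add_mono) (auto simp: M'_def)
  finally show ?thesis using k by (intro exI[of _ k] exI[of _ M']) (auto simp: M'_def)
qed

text \<open>The set \<open>I\<close> allows restricting the choice to elements with a prescribed
  large coordinate, and \<open>K\<close> forces a late start.\<close>

lemma block_selection:
  assumes x: "weakly_null X x" and I: "infinite I" and \<eta>: "0 < \<eta>"
  obtains k M where "strict_mono k" "K \<le> k 0" "\<And>i. k i \<in> I" "mono M"
    "\<And>i. norm (x (k i) - T (restr {M i..<M (Suc i)} (coeff (x (k i))))) \<le> \<eta>"
proof -
  obtain f g where fg: "\<And>l M. l < f l M \<and> f l M \<in> I \<and> M \<le> g l M \<and>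
      norm (x (f l M) - T (restr {M..<g l M} (coeff (x (f l M))))) \<le> \<eta>"
    using block_step[OF x I \<eta>] by metis
  define st where "st = rec_nat (K, 0) (\<lambda>_ (l, M). (f l M, g l M))"
  have st: "st 0 = (K, 0)" "st (Suc i) = (f (fst (st i)) (snd (st i)), g (fst (st i)) (snd (st i)))" for i
    by (auto simp: st_def split: prod.splits)
  show ?thesis
  proof (rule that[of "\<lambda>i. fst (st (Suc i))" "\<lambda>i. snd (st i)"])
    show "strict_mono (\<lambda>i. fst (st (Suc i)))"
      unfolding strict_mono_Suc_iff using fg by (simp add: st(2)[of "Suc _"])
    show "K \<le> fst (st (Suc 0))" using fg[of K 0] by (simp add: st)
    show "fst (st (Suc i)) \<in> I" for i using fg by (simp add: st)
    show "mono (\<lambda>i. snd (st i))" unfolding mono_iff_le_Suc using fg by (simp add: st)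
    show "norm (x (fst (st (Suc i))) - T (restr {snd (st i)..<snd (st (Suc i))} (coeff (x (fst (st (Suc i))))))) \<le> \<eta>" for i
      using fg by (simp add: st)
  qed
qed

lemma norm_block_error:
  assumes "\<And>i. norm (x (k i) - T (u i)) \<le> \<eta>" "\<And>i. u i \<in> modular_space" "0 \<le> \<eta>"
  shows "norm ((\<Sum>i<n. a i *\<^sub>R x (k i)) - T (\<lambda>j. \<Sum>i<n. a i * u i j)) \<le> (\<Sum>i<n. \<bar>a i\<bar>) * \<eta>"
proof -
  have "(\<Sum>i<n. a i *\<^sub>R x (k i)) - T (\<lambda>j. \<Sum>i<n. a i * u i j) = (\<Sum>i<n. a i *\<^sub>R (x (k i) - T (u i)))"
    using T_lincomb(2)[of "{..<n}" u a] assms(2) by (simp add: sum_subtractf scaleR_diff_right)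
  also have "norm \<dots> \<le> (\<Sum>i<n. \<bar>a i\<bar> * \<eta>)"
    using assms(1) by (intro sum_norm_le) (simp add: mult_left_mono)
  finally show ?thesis by (simp add: sum_distrib_right)
qed

lemma modular_le_half_unit:
  assumes "z \<in> X" "norm z = 1"
  shows "modular_le (\<lambda>j. coeff z j / 2) 3"
  using modular_le_of_norm_T[OF coeff_modular_space[OF assms(1)], of 1] assms by (simp add: T_coeff)

section \<open>Lower estimates for spreading models\<close>

text \<open>Passes from the model to a modular bound: the norm of a combination of blocks controls
  the modular of a fraction of it, which splits over the blocks by disjointness.\<close>

lemma lower_core:
  assumes x: "weakly_null X x" and g: "generates_sm x N" and I: "infinite I" and \<eta>0: "0 < \<eta>0"
    and a: "\<And>i. i \<ge> n \<Longrightarrow> a i = 0" and Na: "N a \<le> 1"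
  obtains k M where "\<And>i. k i \<in> I"
    "\<And>i. norm (x (k i) - T (restr {M i..<M (Suc i)} (coeff (x (k i))))) \<le> \<eta>0"
    "mono M"
    "(\<Sum>i<n. \<Sum>j<M n. m j (a i * restr {M i..<M (Suc i)} (coeff (x (k i))) j / 6)) \<le> 3"
proof -
  have xX: "x i \<in> X" for i using x by (simp add: weakly_null_def)
  obtain K where K: "\<And>k. strict_mono k \<Longrightarrow> K \<le> k 0 \<Longrightarrow> norm (\<Sum>i<n. a i *\<^sub>R x (k i)) \<le> 2 * N a"
    using generates_smD[OF g, of n a] a by blast
  define A where "A = 1 + (\<Sum>i<n. \<bar>a i\<bar>)"
  have A: "0 < A" unfolding A_def by (intro add_pos_nonneg sum_nonneg) auto
  \<comment> \<open>The part \<open>1 / A\<close> keeps the total perturbation of the combination at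
    most 1.\<close>
  define \<eta> where "\<eta> = min \<eta>0 (1 / A)"
  have \<eta>: "0 < \<eta>" using A \<eta>0 by (simp add: \<eta>_def)
  obtain k M where k: "strict_mono k" "K \<le> k 0" "\<And>i. k i \<in> I" and M: "mono M"
    and er: "\<And>i. norm (x (k i) - T (restr {M i..<M (Suc i)} (coeff (x (k i))))) \<le> \<eta>"
    using block_selection[OF x I \<eta>] by metis
  define u where "u i = restr {M i..<M (Suc i)} (coeff (x (k i)))" for i
  have uL: "u i \<in> modular_space" for i unfolding u_def by (intro modular_space_restr coeff_modular_space xX)
  let ?b = "\<lambda>j. \<Sum>i<n. a i * u i j"
  have "norm ((\<Sum>i<n. a i *\<^sub>R x (k i)) - T ?b) \<le> (\<Sum>i<n. \<bar>a i\<bar>) * \<eta>"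
    using er uL \<eta> unfolding u_def by (intro norm_block_error) auto
  also have "\<dots> \<le> A * (1 / A)" by (intro mult_mono) (use A \<eta>0 in \<open>auto simp: A_def \<eta>_def\<close>)
  finally have "norm ((\<Sum>i<n. a i *\<^sub>R x (k i)) - T ?b) \<le> 1" using A by simp
  moreover have "norm (\<Sum>i<n. a i *\<^sub>R x (k i)) \<le> 2" using K[OF k(1,2)] Na by linarith
  \<comment> \<open>At most 2 comes from the model and at most 1 from the perturbation; the divisor
    6 below is twice this bound.\<close>
  ultimately have "norm (T ?b) \<le> 3"
    using norm_triangle_ineq4[of "\<Sum>i<n. a i *\<^sub>R x (k i)" "(\<Sum>i<n. a i *\<^sub>R x (k i)) - T ?b"] by simp
  then have b: "modular_le (\<lambda>j. ?b j / 6) 3"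
    using modular_le_of_norm_T[OF T_lincomb(1)[of "{..<n}" u a], of 3] uL by simp
  have dis: "disjoint_seqs n (\<lambda>i j. (a i / 6) * u i j)"
    by (rule disjoint_seqs_scale[OF disjoint_seqs_blocks[OF M]]) (auto simp: u_def restr_def split: if_splits)
  have "(\<Sum>i<n. \<Sum>j<M n. m j (a i * u i j / 6)) = (\<Sum>j<M n. \<Sum>i<n. m j ((a i / 6) * u i j))"
    by (subst sum.swap) simp
  also have "\<dots> = (\<Sum>j<M n. m j (\<Sum>i<n. (a i / 6) * u i j))"
    by (simp only: m_sum_disjoint[OF dis])
  also have "\<dots> = (\<Sum>j<M n. m j (?b j / 6))" by (simp add: sum_divide_distrib)
  also have "\<dots> \<le> 3" by (rule modular_le_sum[OF b]) simp
  finally have "(\<Sum>i<n. \<Sum>j<M n. m j (a i * u i j / 6)) \<le> 3" .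
  moreover have "norm (x (k i) - T (restr {M i..<M (Suc i)} (coeff (x (k i))))) \<le> \<eta>0" for i
    using er[of i] by (simp add: \<eta>_def)
  ultimately show ?thesis using that[of k M] k M unfolding u_def by blast
qed

text \<open>Every model dominates l-two: each block has norm above 1/2, hence modular bounded below,
  and by \<open>m_scale_ge\<close> a coefficient enters at least quadratically. The constant is
  \<open>432 = 3 * 144\<close>.\<close>

lemma lower_l2:
  assumes x: "weakly_null X x" and g: "generates_sm x N"
    and a: "\<And>i. i \<ge> n \<Longrightarrow> a i = 0" and Na: "N a \<le> 1"
  shows "(\<Sum>i<n. (a i / 432)\<^sup>2) \<le> 432"
proof -
  have xX: "x i \<in> X" "norm (x i) = 1" for i
    using x g by (simp_all add: weakly_null_def generates_sm_def)
  obtain k M where er: "\<And>i. norm (x (k i) - T (restr {M i..<M (Suc i)} (coeff (x (k i))))) \<le> 1 / 4"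
    and M: "mono M"
    and le: "(\<Sum>i<n. \<Sum>j<M n. m j (a i * restr {M i..<M (Suc i)} (coeff (x (k i))) j / 6)) \<le> 3"
    using lower_core[OF x g infinite_UNIV_nat _ a Na, of "1 / 4"] by auto
  define u where "u i = restr {M i..<M (Suc i)} (coeff (x (k i)))" for i
  have uL: "u i \<in> modular_space" for i unfolding u_def by (intro modular_space_restr coeff_modular_space xX)
  have low: "1 / 144 \<le> (\<Sum>j<M n. m j (u i j / 6))" if i: "i < n" for i
  proof -
    have "norm (x (k i) - T (u i)) \<le> 1 / 4" using er[of i] by (simp add: u_def)
    then have "1 / 2 < norm (T (u i))"
      using norm_triangle_ineq2[of "x (k i)" "T (u i)"] xX(2)[of "k i"] by linarith
    then have "\<not> norm (T (\<lambda>j. 2 * u i j)) \<le> 1" by (simp add: T_scale[OF uL])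
    then have "\<not> modular_le (\<lambda>j. 2 * u i j) 1" using norm_T_le_modular_le[of _ 1] by auto
    moreover have "modular_le (\<lambda>j. 2 * u i j) (\<Sum>j<M n. m j (2 * u i j))"
    proof (rule modular_le_finite_support)
      fix j assume "j \<notin> {..<M n}"
      then show "2 * u i j = 0" using monoD[OF M, of "Suc i" n] i by (auto simp: u_def restr_def)
    qed simp
    ultimately have "1 < (\<Sum>j<M n. m j (2 * u i j))" using modular_le_mono by (meson not_less)
    also have "\<dots> \<le> (\<Sum>j<M n. 144 * m j (u i j / 6))"
    proof (rule sum_mono)
      fix j
      have "m j (12 * (u i j / 6)) \<le> 12\<^sup>2 * m j (u i j / 6)" by (rule m_scale_up) simp
      then show "m j (2 * u i j) \<le> 144 * m j (u i j / 6)" by simp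
    qed
    finally show ?thesis by (simp flip: sum_distrib_left)
  qed
  have each: "(\<Sum>j<M n. m j (a i * u i j / 6)) \<le> 3" if "i < n" for i
  proof -
    have "(\<Sum>j<M n. m j (a i * u i j / 6)) \<le> (\<Sum>i<n. \<Sum>j<M n. m j (a i * u i j / 6))"
      using that by (intro member_le_sum[of i "{..<n}" "\<lambda>i. \<Sum>j<M n. m j (a i * u i j / 6)"] sum_nonneg) auto
    then show ?thesis using le by (simp add: u_def)
  qed
  \<comment> \<open>A bound on single coefficients is needed first, since \<open>m_scale_ge\<close>
    requires a factor of absolute value at most 1. It comes from the linear bound
    \<open>m_scale_le\<close> applied with \<open>1 / a i\<close>.\<close>
  have small: "\<bar>a i\<bar> \<le> 432" if i: "i < n" for i
  proof (cases "\<bar>a i\<bar> \<le> 1")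
    case False
    have "1 / 144 \<le> (\<Sum>j<M n. m j (u i j / 6))" by (rule low[OF i])
    also have "\<dots> \<le> (\<Sum>j<M n. (1 / \<bar>a i\<bar>) * m j (a i * u i j / 6))"
    proof (rule sum_mono)
      fix j
      have "m j ((1 / a i) * (a i * u i j / 6)) \<le> \<bar>1 / a i\<bar> * m j (a i * u i j / 6)"
        using False by (intro m_scale_le) (auto simp: abs_divide)
      moreover have "a i \<noteq> 0" using False by auto
      ultimately show "m j (u i j / 6) \<le> (1 / \<bar>a i\<bar>) * m j (a i * u i j / 6)" by (simp add: abs_divide)
    qed
    also have "\<dots> \<le> (1 / \<bar>a i\<bar>) * 3"
      unfolding sum_distrib_left[symmetric] by (intro mult_left_mono each i) auto
    finally show ?thesis using False by (simp add: field_simps)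
  qed simp
  have "(\<Sum>i<n. (a i / 432)\<^sup>2 * (1 / 144)) \<le> (\<Sum>i<n. \<Sum>j<M n. m j (a i * u i j / 6))"
  proof (rule sum_mono)
    fix i assume "i \<in> {..<n}"
    then have i: "i < n" by simp
    have "(a i / 432)\<^sup>2 * (1 / 144) \<le> (a i / 432)\<^sup>2 * (\<Sum>j<M n. m j (u i j / 6))"
      by (intro mult_left_mono low i) simp
    also have "\<dots> \<le> (\<Sum>j<M n. m j (a i / 432 * (u i j / 6)))"
      unfolding sum_distrib_left using small[OF i] by (intro sum_mono m_scale_ge) auto
    also have "\<dots> \<le> (\<Sum>j<M n. m j (a i * u i j / 6))"
      by (intro sum_mono m_mono) (simp add: abs_mult)
    finally show "(a i / 432)\<^sup>2 * (1 / 144) \<le> (\<Sum>j<M n. m j (a i * u i j / 6))" .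
  qed
  also have "\<dots> \<le> 3" using le by (simp add: u_def)
  finally show ?thesis by (simp only: sum_distrib_right[symmetric])
qed

end

section \<open>Coloured coordinates and their spreading models\<close>

text \<open>All coordinates of one colour share a weight. By \<open>H_escape\<close> far colours
  look like l-two at any fixed scale, though not uniformly in the scale.\<close>

locale coloured =
  fixes H :: "nat \<Rightarrow> real \<Rightarrow> real"
  assumes H_ge_1: "0 < t \<Longrightarrow> 1 \<le> H p t"
    and H_antimono: "0 < s \<Longrightarrow> s \<le> t \<Longrightarrow> H p t \<le> H p s"
    and mult_H_mono: "0 < s \<Longrightarrow> s \<le> t \<Longrightarrow> s * H p s \<le> t * H p t"
    and H_mult: "0 < s \<Longrightarrow> 0 < t \<Longrightarrow> H p (s * t) \<le> H p s + H p t"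
    and H_log: "0 < t \<Longrightarrow> H p t \<le> 1 + 2 * ln (1 + 1 / t)"
    and H_escape: "0 < t \<Longrightarrow> \<exists>P. \<forall>p\<ge>P. H p t \<le> 2"
begin

sublocale modular "\<lambda>j. H (colour j)"
  by unfold_locales (auto intro: H_ge_1 H_antimono mult_H_mono H_mult H_log)

definition m_colour :: "nat \<Rightarrow> real \<Rightarrow> real" where
  "m_colour p t = t\<^sup>2 * H p \<bar>t\<bar>"

lemma m_eq_m_colour: "m j t = m_colour (colour j) t"
  by (simp add: m_def m_colour_def)

lemma m_colour_eq_m: "m_colour p t = m (place p 0) t"
  by (simp add: m_eq_m_colour)

lemma m_colour_0 [simp]: "m_colour p 0 = 0"
  by (simp add: m_colour_def)

lemma m_colour_nonneg: "0 \<le> m_colour p t"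
  by (simp add: m_colour_eq_m)

lemma m_colour_mono: "\<bar>s\<bar> \<le> \<bar>t\<bar> \<Longrightarrow> m_colour p s \<le> m_colour p t"
  unfolding m_colour_eq_m by (rule m_mono)

lemma emb_modular_space:
  assumes "\<And>i. i \<ge> n \<Longrightarrow> a i = 0"
  shows "emb p a \<in> modular_space"
  by (subst emb_eq_sum[of n a p]) (auto intro!: assms T_lincomb(1) modular_space_unit_seq)

lemma T_emb:
  assumes "\<And>i. i \<ge> n \<Longrightarrow> a i = 0"
  shows "T (emb p a) = (\<Sum>i<n. a i *\<^sub>R T (unit_seq (place p i)))"
  by (subst emb_eq_sum[of n a p]) (auto intro!: assms T_lincomb(2) modular_space_unit_seq)

lemma modular_le_embI:
  assumes "\<And>i. i \<ge> n \<Longrightarrow> a i = 0" "(\<Sum>i<n. m_colour p (a i)) \<le> c"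
  shows "modular_le (emb p a) c"
proof (rule modular_le_mono[OF modular_le_finite_support])
  show "finite (place p ` {..<n})" by simp
  show "(\<Sum>j\<in>place p ` {..<n}. m j (emb p a j)) \<le> c"
    using assms(2) by (simp add: sum_place m_eq_m_colour)
  fix j assume j: "j \<notin> place p ` {..<n}"
  obtain i where i: "j = place (colour j) i" using place_exhaust .
  show "emb p a j = 0"
  proof (cases "colour j = p")
    case True
    then have "j = place p i" using i by simp
    then show ?thesis using j assms(1)[of i] by (cases "i < n") auto
  qed (simp add: emb_other)
qed

lemma modular_le_embD: "modular_le (emb p a) c \<Longrightarrow> (\<Sum>i<n. m_colour p (a i)) \<le> c"
  using modular_le_sum[of "emb p a" c "place p ` {..<n}"] by (simp add: sum_place m_eq_m_colour)

section \<open>The symmetric basis of one colour\<close>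

text \<open>A test sequence is transported from the places of \<open>k\<close> to those of
  \<open>l\<close>, which carry the same weight. Its values elsewhere pair with 0 and only enlarge
  the denominator, so they are dropped.\<close>

lemma norm_spread_le:
  fixes k l :: "nat \<Rightarrow> nat"
  assumes k: "inj_on k {..<n}" and l: "inj_on l {..<n}"
  shows "norm (\<Sum>i<n. a i *\<^sub>R T (unit_seq (place p (k i)))) \<le> norm (\<Sum>i<n. a i *\<^sub>R T (unit_seq (place p (l i))))"
proof -
  define W where "W k = (\<lambda>j. \<Sum>i<n. a i * unit_seq (place p (k i)) j)" for k :: "nat \<Rightarrow> nat"
  have WL: "W k \<in> modular_space" and TW: "T (W k) = (\<Sum>i<n. a i *\<^sub>R T (unit_seq (place p (k i))))" for k
    unfolding W_def using T_lincomb[of "{..<n}" "\<lambda>i. unit_seq (place p (k i))" a] by (auto simp: modular_space_unit_seq)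
  define P where "P k = (\<lambda>i. place p (k i)) ` {..<n}" for k :: "nat \<Rightarrow> nat"
  have inj: "inj_on (\<lambda>i. place p (k i)) {..<n}" if "inj_on k {..<n}" for k
    using that by (auto simp: inj_on_def)
  have Wv: "W k (place p (k i)) = a i" if "inj_on k {..<n}" "i < n" for k i
  proof -
    have "W k (place p (k i)) = (\<Sum>i'<n. if i' = i then a i' else 0)"
      unfolding W_def using that by (intro sum.cong) (auto simp: unit_seq_def inj_on_def)
    then show ?thesis using that by simp
  qed
  have W0: "W k j = 0" if "j \<notin> P k" for k j
    unfolding W_def using that by (intro sum.neutral) (auto simp: unit_seq_def P_def)
  have sumP: "(\<Sum>j\<in>P k. f j) = (\<Sum>i<n. f (place p (k i)))" if "inj_on k {..<n}" for k and f :: "nat \<Rightarrow> real"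
    unfolding P_def using inj[OF that] by (simp add: sum.reindex)
  have "norm (T (W k)) \<le> norm (T (W l))"
  proof (rule norm_T_le[OF WL])
    fix s assume s: "s \<in> rat_seqs"
    define g where "g = inv_into {..<n} (\<lambda>i. place p (l i))"
    define s' where "s' j = (if j \<in> P l then s (place p (k (g j))) else 0)" for j
    have s'v: "s' (place p (l i)) = s (place p (k i))" if "i < n" for i
      using that inv_into_f_f[OF inj[OF l], of i] by (auto simp: s'_def g_def P_def)
    have fin: "finite (P l)" "finite (P k)" by (auto simp: P_def)
    have s': "s' \<in> rat_seqs"
      using s fin(1) by (auto simp: rat_seqs_def s'_def elim: finite_subset[rotated])
    let ?J = "{j. s j \<noteq> 0} \<union> P k"
    let ?n = "\<Sum>i<n. s (place p (k i)) * H p \<bar>s (place p (k i))\<bar> * a i"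
    let ?d = "\<Sum>i<n. m_colour p (s (place p (k i)))"
    have J: "finite ?J" using s fin by (simp add: rat_seqs_def)
    have d: "0 \<le> ?d" by (intro sum_nonneg m_colour_nonneg)
    have "(\<Sum>j\<in>?J. s j * H (colour j) \<bar>s j\<bar> * W k j) = (\<Sum>j\<in>P k. s j * H (colour j) \<bar>s j\<bar> * W k j)"
      using J W0 by (intro sum.mono_neutral_right) auto
    then have num: "(\<Sum>j\<in>?J. s j * H (colour j) \<bar>s j\<bar> * W k j) = ?n"
      by (simp add: sumP[OF k] Wv[OF k])
    have "(\<Sum>j\<in>P k. m j (s j)) \<le> (\<Sum>j\<in>?J. m j (s j))" using J by (intro sum_mono2) auto
    then have den: "?d \<le> (\<Sum>j\<in>?J. m j (s j))" by (simp add: sumP[OF k] m_eq_m_colour)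
    have Qs: "Q s (W k) = ?n / (1 + (\<Sum>j\<in>?J. m j (s j)))"
      using Q_eq[OF J, of s "W k"] num by simp
    have "Q s' (W l) = (\<Sum>j\<in>P l. s' j * H (colour j) \<bar>s' j\<bar> * W l j) / (1 + (\<Sum>j\<in>P l. m j (s' j)))"
      by (rule Q_eq[OF fin(1)]) (auto simp: s'_def split: if_splits)
    also have "\<dots> = ?n / (1 + ?d)" by (simp add: sumP[OF l] s'v Wv[OF l] m_eq_m_colour)
    finally have "\<bar>Q s (W k)\<bar> \<le> \<bar>Q s' (W l)\<bar>"
      unfolding Qs abs_divide using den d by (auto intro!: divide_left_mono mult_pos_pos)
    also have "\<dots> \<le> norm (T (W l))" by (rule Q_le_norm_T[OF WL s'])
    finally show "\<bar>Q s (W k)\<bar> \<le> norm (T (W l))" .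
  qed
  then show ?thesis unfolding TW .
qed

lemma norm_spread:
  fixes k :: "nat \<Rightarrow> nat"
  assumes "inj_on k {..<n}"
  shows "norm (\<Sum>i<n. a i *\<^sub>R T (unit_seq (place p (k i)))) = norm (\<Sum>i<n. a i *\<^sub>R T (unit_seq (place p i)))"
  using norm_spread_le[OF assms inj_on_id2] norm_spread_le[OF inj_on_id2 assms]
  by (intro antisym) auto

definition unit_norm :: "nat \<Rightarrow> real" where
  "unit_norm p = norm (T (unit_seq (place p 0)))"

lemma unit_norm_pos: "0 < unit_norm p"
  unfolding unit_norm_def by (rule T_unit_pos)

lemma unit_norm_eq: "norm (T (unit_seq (place p i))) = unit_norm p"
  using norm_spread[of "\<lambda>_. i" 1 "\<lambda>_. 1" p] by (simp add: unit_norm_def inj_on_def)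

definition colour_basis :: "nat \<Rightarrow> nat \<Rightarrow> linf" where
  "colour_basis p i = (1 / unit_norm p) *\<^sub>R T (unit_seq (place p i))"

definition colour_norm :: "nat \<Rightarrow> (nat \<Rightarrow> real) \<Rightarrow> real" where
  "colour_norm p a = norm (T (emb p a)) / unit_norm p"

lemma colour_basis_X: "colour_basis p i \<in> X"
  unfolding colour_basis_def by (intro subspace_scale[OF subspace_X] T_in_X modular_space_unit_seq)

lemma coeff_colour_basis: "coeff (colour_basis p i) = (\<lambda>j. 1 / unit_norm p * unit_seq (place p i) j)"
  unfolding colour_basis_def using coeff_scale[OF T_in_X[OF modular_space_unit_seq]] by (simp add: coeff_T modular_space_unit_seq)

lemma colour_norm_eq:
  assumes "\<And>i. i \<ge> n \<Longrightarrow> a i = 0"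
  shows "colour_norm p a = norm (\<Sum>i<n. a i *\<^sub>R colour_basis p i)"
proof -
  have "(\<Sum>i<n. a i *\<^sub>R colour_basis p i) = (1 / unit_norm p) *\<^sub>R T (emb p a)"
    by (simp add: T_emb[of n a, OF assms] colour_basis_def scaleR_sum_right)
  then show ?thesis using unit_norm_pos[of p] by (simp add: colour_norm_def)
qed

lemma colour_norm_spread:
  fixes k :: "nat \<Rightarrow> nat"
  assumes "\<And>i. i \<ge> n \<Longrightarrow> a i = 0" "inj_on k {..<n}"
  shows "norm (\<Sum>i<n. a i *\<^sub>R colour_basis p (k i)) = colour_norm p a"
proof -
  have "(\<Sum>i<n. a i *\<^sub>R colour_basis p (k i)) = (1 / unit_norm p) *\<^sub>R (\<Sum>i<n. a i *\<^sub>R T (unit_seq (place p (k i))))" for k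
    by (simp add: colour_basis_def scaleR_sum_right)
  then have "norm (\<Sum>i<n. a i *\<^sub>R colour_basis p (k i)) = norm (\<Sum>i<n. a i *\<^sub>R colour_basis p i)"
    using norm_spread[OF assms(2), of a p] by simp
  also have "\<dots> = colour_norm p a" by (rule colour_norm_eq[symmetric]) (rule assms(1))
  finally show ?thesis .
qed

lemma sm_seminorm_colour_norm: "sm_seminorm (colour_norm p)"
  unfolding sm_seminorm_def
proof (intro conjI allI impI)
  fix a :: "nat \<Rightarrow> real" and c :: real
  show "0 \<le> colour_norm p a" using unit_norm_pos[of p] by (simp add: colour_norm_def)
  assume "fin_supp a"
  then obtain n where n: "\<And>i. i \<ge> n \<Longrightarrow> a i = 0" using fin_suppE by metis
  have "emb p (\<lambda>i. c * a i) = (\<lambda>j. c * emb p a j)" by (auto simp: emb_def)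
  then show "colour_norm p (\<lambda>i. c * a i) = \<bar>c\<bar> * colour_norm p a"
    unfolding colour_norm_def using T_scale[OF emb_modular_space[of n a, OF n]] by simp
next
  fix a b :: "nat \<Rightarrow> real"
  assume "fin_supp a" "fin_supp b"
  then obtain n k where n: "\<And>i. i \<ge> n \<Longrightarrow> a i = 0" and k: "\<And>i. i \<ge> k \<Longrightarrow> b i = 0"
    using fin_suppE by metis
  have "emb p (\<lambda>i. a i + b i) = (\<lambda>j. emb p a j + emb p b j)" by (auto simp: emb_def)
  then have "T (emb p (\<lambda>i. a i + b i)) = T (emb p a) + T (emb p b)"
    using T_add[OF emb_modular_space[of n a, OF n] emb_modular_space[of k b, OF k]] by simp
  then show "colour_norm p (\<lambda>i. a i + b i) \<le> colour_norm p a + colour_norm p b"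
    unfolding colour_norm_def using unit_norm_pos[of p] norm_triangle_ineq[of "T (emb p a)" "T (emb p b)"]
    by (simp add: divide_right_mono flip: add_divide_distrib)
qed

lemma weakly_null_colour_basis: "weakly_null X (colour_basis p)"
  unfolding weakly_null_def
proof (intro conjI allI ballI colour_basis_X)
  fix f assume f: "f \<in> dual_sp X"
  have "filterlim (place p) at_top sequentially"
    by (rule filterlim_at_top_mono[OF filterlim_ident]) (simp add: place_ge)
  then have "(\<lambda>i. f (T (unit_seq (place p i)))) \<longlonglongrightarrow> 0"
    by (rule filterlim_compose[OF dual_unit_tendsto_0[OF f]])
  then have "(\<lambda>i. (1 / unit_norm p) * f (T (unit_seq (place p i)))) \<longlonglongrightarrow> (1 / unit_norm p) * 0"
    by (rule tendsto_mult_left)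
  then show "(\<lambda>i. f (colour_basis p i)) \<longlonglongrightarrow> 0"
    unfolding colour_basis_def by (simp add: dual_spD(2)[OF f T_in_X[OF modular_space_unit_seq]])
qed

lemma coeff_lincomb_colour_basis:
  "coeff (\<Sum>i<n. c i *\<^sub>R colour_basis p i) (place p l) = (if l < n then c l / unit_norm p else 0)"
  "(\<Sum>i<n. c i *\<^sub>R colour_basis p i) \<in> X"
proof -
  have eq: "(\<Sum>i<n. c i *\<^sub>R colour_basis p i) = T (\<lambda>j. \<Sum>i<n. c i / unit_norm p * unit_seq (place p i) j)"
    by (subst T_lincomb(2)) (auto simp: modular_space_unit_seq colour_basis_def)
  have L: "(\<lambda>j. \<Sum>i<n. c i / unit_norm p * unit_seq (place p i) j) \<in> modular_space"
    by (intro T_lincomb(1) modular_space_unit_seq)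
  show "(\<Sum>i<n. c i *\<^sub>R colour_basis p i) \<in> X" unfolding eq by (rule T_in_X[OF L])
  have "coeff (\<Sum>i<n. c i *\<^sub>R colour_basis p i) (place p l) = (\<Sum>i<n. c i / unit_norm p * unit_seq (place p i) (place p l))"
    unfolding eq coeff_T[OF L] ..
  also have "\<dots> = (\<Sum>i<n. if i = l then c i / unit_norm p else 0)"
    by (intro sum.cong) (auto simp: unit_seq_def)
  finally show "coeff (\<Sum>i<n. c i *\<^sub>R colour_basis p i) (place p l) = (if l < n then c l / unit_norm p else 0)" by simp
qed

text \<open>Expansions converge because their remainders are restrictions of tails of
  \<open>y\<close>; they are unique because coordinates are continuous.\<close>

lemma basic_seq_colour_basis: "basic_seq (colour_basis p)"
  unfolding basic_seq_def
proof
  fix y assume y: "y \<in> closure (span (range (colour_basis p)))"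
  \<comment> \<open>A closed subspace containing the basis, hence also the closure of its
    span.\<close>
  let ?Z = "{z \<in> X. \<forall>j. colour j \<noteq> p \<longrightarrow> coeff z j = 0}"
  have "subspace ?Z"
    unfolding subspace_def
    using subspace_0[OF subspace_X] subspace_add[OF subspace_X] subspace_scale[OF subspace_X]
      coeff_T[OF modular_space_0] by (auto simp: coeff_add coeff_scale T_0)
  moreover have "range (colour_basis p) \<subseteq> ?Z"
    by (auto simp: colour_basis_X coeff_colour_basis unit_seq_def)
  moreover have "closed ?Z"
    unfolding closed_sequential_limits
  proof (intro allI impI, elim conjE)
    fix x l assume x: "\<forall>n. x n \<in> ?Z" and l: "x \<longlonglongrightarrow> l"
    have xX: "x n \<in> X" for n using x by auto
    have "coeff l j = 0" if "colour j \<noteq> p" for j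
      using closed_X_coords(2)[OF xX l, of j] x that by (simp add: LIMSEQ_const_iff)
    then show "l \<in> ?Z" using closed_X_coords(1)[OF xX l] by simp
  qed
  ultimately have "closure (span (range (colour_basis p))) \<subseteq> ?Z"
    by (intro closure_minimal span_minimal)
  with y have yX: "y \<in> X" and y0: "\<And>j. colour j \<noteq> p \<Longrightarrow> coeff y j = 0" by auto
  let ?a = "\<lambda>i. unit_norm p * coeff y (place p i)"
  show "\<exists>!a. (\<lambda>n. \<Sum>i<n. a i *\<^sub>R colour_basis p i) \<longlonglongrightarrow> y"
  proof (rule ex1I[of _ ?a])
    \<comment> \<open>By \<open>place_ge\<close> the places of index \<open>n\<close> and above lie
      in \<open>{n..}\<close>, so the inner restriction removes nothing that the outer one
      keeps.\<close>
    have part: "y - (\<Sum>i<n. ?a i *\<^sub>R colour_basis p i) = T (restr (- place p ` {..<n}) (restr {n..} (coeff y)))" for n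
    proof -
      have "(\<Sum>i<n. ?a i *\<^sub>R colour_basis p i) = T (restr (place p ` {..<n}) (coeff y))"
        using unit_norm_pos[of p] by (simp add: T_restr_finite sum.reindex inj_on_def colour_basis_def)
      moreover have "restr (- place p ` {..<n}) (restr {n..} (coeff y)) j = coeff y j - restr (place p ` {..<n}) (coeff y) j" for j
      proof -
        obtain i where i: "j = place (colour j) i" using place_exhaust .
        show ?thesis
        proof (cases "colour j = p")
          case True
          then have j: "j = place p i" using i by simp
          then show ?thesis using place_ge[of i p] by (cases "i < n") (auto simp: restr_def)
        qed (simp add: restr_def y0)
      qed
      ultimately show ?thesis
        using T_diff[OF coeff_modular_space[OF yX] modular_space_restr[OF coeff_modular_space[OF yX]]] T_coeff[OF yX]
        by (metis (no_types, lifting) ext)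
    qed
    show "(\<lambda>n. \<Sum>i<n. ?a i *\<^sub>R colour_basis p i) \<longlonglongrightarrow> y"
    proof (rule LIMSEQ_I)
      fix r :: real assume r: "0 < r"
      obtain N where N: "\<And>n. n \<ge> N \<Longrightarrow> norm (T (restr {n..} (coeff y))) \<le> r / 2"
        using norm_T_tail[OF coeff_modular_space[OF yX], of "r / 2"] r by auto
      have "norm ((\<Sum>i<n. ?a i *\<^sub>R colour_basis p i) - y) < r" if "n \<ge> N" for n
      proof -
        have "norm ((\<Sum>i<n. ?a i *\<^sub>R colour_basis p i) - y) = norm (y - (\<Sum>i<n. ?a i *\<^sub>R colour_basis p i))"
          by (rule norm_minus_commute)
        also have "\<dots> \<le> norm (T (restr {n..} (coeff y)))"
          unfolding part by (intro norm_T_restr modular_space_restr coeff_modular_space yX)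
        also have "\<dots> \<le> r / 2" by (rule N[OF that])
        finally show ?thesis using r by linarith
      qed
      then show "\<exists>N. \<forall>n\<ge>N. norm ((\<Sum>i<n. ?a i *\<^sub>R colour_basis p i) - y) < r" by blast
    qed
  next
    fix c assume c: "(\<lambda>n. \<Sum>i<n. c i *\<^sub>R colour_basis p i) \<longlonglongrightarrow> y"
    show "c = ?a"
    proof
      fix l
      have "(\<lambda>n. coeff (\<Sum>i<n. c i *\<^sub>R colour_basis p i) (place p l)) \<longlonglongrightarrow> coeff y (place p l)"
        by (rule closed_X_coords(2)[OF coeff_lincomb_colour_basis(2) c])
      moreover have "(\<lambda>n. coeff (\<Sum>i<n. c i *\<^sub>R colour_basis p i) (place p l)) \<longlonglongrightarrow> c l / unit_norm p"
        unfolding coeff_lincomb_colour_basis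
        by (rule tendsto_eventually, rule eventually_sequentiallyI[of "Suc l"]) auto
      ultimately have "coeff y (place p l) = c l / unit_norm p" by (rule LIMSEQ_unique)
      then show "c l = ?a l" using unit_norm_pos[of p] by simp
    qed
  qed
qed

text \<open>Invariance under spreading is exact, so the error sequence is 0.\<close>

lemma generates_colour_basis: "generates_sm (colour_basis p) (colour_norm p)"
  unfolding generates_sm_def
proof (intro conjI exI[of _ "\<lambda>_. 0"] allI impI basic_seq_colour_basis sm_seminorm_colour_norm; (elim conjE)?)
  show "norm (colour_basis p n) = 1" for n using unit_norm_pos[of p] by (simp add: colour_basis_def unit_norm_eq)
  fix n and k :: "nat \<Rightarrow> nat" and a :: "nat \<Rightarrow> real"
  assume "\<forall>i\<ge>n. a i = 0" "strict_mono_on {..<n} k"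
  then have "norm (\<Sum>i<n. a i *\<^sub>R colour_basis p (k i)) = colour_norm p a"
    by (intro colour_norm_spread strict_mono_on_imp_inj_on) auto
  then show "colour_norm p a / (1 + 0) \<le> norm (\<Sum>i<n. a i *\<^sub>R colour_basis p (k i))"
    "norm (\<Sum>i<n. a i *\<^sub>R colour_basis p (k i)) \<le> (1 + 0) * colour_norm p a" by simp_all
qed (auto simp: decseq_def)

lemma colour_norm_model: "colour_norm p \<in> SPw_models X"
  unfolding SPw_models_def using weakly_null_colour_basis generates_colour_basis by blast

section \<open>Domination between colours\<close>

lemma colour_norm_le_1D:
  assumes "\<And>i. i \<ge> n \<Longrightarrow> a i = 0" "colour_norm p a \<le> r" "0 < r"
  shows "(\<Sum>i<n. m_colour p (1 / (2 * r * unit_norm p) * a i)) \<le> 3"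
proof -
  have "norm (T (emb p a)) \<le> r * unit_norm p" using assms(2) unit_norm_pos[of p] by (simp add: colour_norm_def divide_le_eq)
  then have "modular_le (\<lambda>j. emb p a j / (2 * (r * unit_norm p))) 3"
    using modular_le_of_norm_T[OF emb_modular_space[of n a, OF assms(1)]] unit_norm_pos[of p] assms(3) by simp
  moreover have "(\<lambda>j. emb p a j / (2 * (r * unit_norm p))) = emb p (\<lambda>i. 1 / (2 * r * unit_norm p) * a i)"
    by (auto simp: emb_def)
  ultimately show ?thesis using modular_le_embD by metis
qed

text \<open>With \<open>colour_norm_le_1D\<close>, this reduces comparisons of colour norms to
  comparisons of modular sums.\<close>

lemma colour_norm_leI:
  assumes "\<And>i. i \<ge> n \<Longrightarrow> a i = 0" "(\<Sum>i<n. m_colour p (c * a i)) \<le> K" "1 \<le> K" "0 < c"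
  shows "colour_norm p a \<le> K / (c * unit_norm p)"
proof -
  have "modular_le (emb p (\<lambda>i. c * a i)) K" using assms by (intro modular_le_embI) auto
  moreover have "emb p (\<lambda>i. c * a i) = (\<lambda>j. c * emb p a j)" by (auto simp: emb_def)
  ultimately have "norm (T (\<lambda>j. c * emb p a j)) \<le> K" using norm_T_le_modular_le assms(3) by metis
  then have "c * norm (T (emb p a)) \<le> K"
    using assms(4) by (simp add: T_scale[OF emb_modular_space[of n a, OF assms(1)]])
  then show ?thesis unfolding colour_norm_def using unit_norm_pos[of p] assms(4) by (simp add: field_simps)
qed

lemma m_colour_le_m_colour:
  assumes "\<And>t. 0 < t \<Longrightarrow> H p t \<le> C * H q t"
  shows "m_colour p t \<le> C * m_colour q t"
  using mult_left_mono[OF assms[of "\<bar>t\<bar>"], of "t\<^sup>2"] by (cases "t = 0") (auto simp: m_colour_def mult_ac)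

lemma dominates_colour_norm:
  assumes "\<And>t. 0 < t \<Longrightarrow> H p t \<le> C * H q t"
  shows "dominates (colour_norm q) (colour_norm p)"
proof (rule dominatesI_unit_ball[OF sm_seminorm_colour_norm sm_seminorm_colour_norm])
  let ?c = "1 / (2 * 1 * unit_norm q)"
  fix a assume "fin_supp a" and le: "colour_norm q a \<le> 1"
  then obtain n where n: "\<And>i. i \<ge> n \<Longrightarrow> a i = 0" using fin_suppE by metis
  have C: "0 < C" using assms[of 1] H_ge_1[of 1 p] H_ge_1[of 1 q]
    by (smt (verit) mult_nonpos_nonneg)
  have "(\<Sum>i<n. m_colour p (?c * a i)) \<le> C * (\<Sum>i<n. m_colour q (?c * a i))"
    unfolding sum_distrib_left by (intro sum_mono m_colour_le_m_colour assms)
  also have "\<dots> \<le> C * 3" using colour_norm_le_1D[of n a, OF n le] C by (intro mult_left_mono) auto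
  finally have "(\<Sum>i<n. m_colour p (?c * a i)) \<le> max 1 (C * 3)" by simp
  then show "colour_norm p a \<le> max 1 (C * 3) / (?c * unit_norm p)"
    using unit_norm_pos[of q] by (intro colour_norm_leI[of n] n) auto
qed

text \<open>Domination is tested on \<open>n\<close> equal coefficients \<open>t\<close>, with
  \<open>n\<close> about \<open>1 / m_colour q t\<close>. The modular in colour \<open>q\<close> is
  then about 1, so the modular in colour \<open>p\<close>, about \<open>n * m_colour p t\<close>, is
  bounded.\<close>

lemma dominates_NmD:
  assumes "dominates (colour_norm q) (colour_norm p)"
  shows "\<exists>C t0. 0 < t0 \<and> (\<forall>t. 0 < t \<longrightarrow> t \<le> t0 \<longrightarrow> H p t \<le> C * H q t)"
proof -
  obtain C0 where C0: "\<And>a. fin_supp a \<Longrightarrow> colour_norm p a \<le> C0 * colour_norm q a" using assms unfolding dominates_def by blast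
  \<comment> \<open>Up to \<open>t0\<close> the value \<open>m_colour q t\<close> is at most 1, so
    that \<open>n\<close> below is at least 1.\<close>
  define t0 where "t0 = 1 / H q 1"
  have Hq: "1 \<le> H q 1" by (simp add: H_ge_1)
  \<comment> \<open>The second entry bounds \<open>colour_norm p a\<close> for the test sequences;
    the first ensures \<open>1 \<le> R\<close>, so that \<open>m_scale_ge\<close> applies to the
    factor \<open>1 / R\<close>.\<close>
  define D where "D = max (1 / (2 * unit_norm p)) ((\<bar>C0\<bar> + 1) / unit_norm q)"
  have D: "0 < D" "1 \<le> 2 * D * unit_norm p" "(\<bar>C0\<bar> + 1) / unit_norm q \<le> D"
  proof -
    have "0 < (\<bar>C0\<bar> + 1) / unit_norm q" using unit_norm_pos[of q] by simp
    then show "0 < D" unfolding D_def by linarith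
    have "1 / (2 * unit_norm p) \<le> D" by (simp add: D_def)
    then show "1 \<le> 2 * D * unit_norm p" using unit_norm_pos[of p] by (simp add: field_simps)
  qed (simp add: D_def)
  define R where "R = 2 * D * unit_norm p"
  have R1: "1 \<le> R" using D(2) by (simp add: R_def)
  have "H p t \<le> (6 * R\<^sup>2) * H q t" if t: "0 < t" "t \<le> t0" for t
  proof -
    have t1: "t \<le> 1" using t Hq by (auto simp: t0_def elim: order_trans)
    have "m_colour q t = t * (t * H q t)" using t by (simp add: m_colour_def power2_eq_square)
    also have "\<dots> \<le> t * (1 * H q 1)" using t t1 by (intro mult_left_mono mult_H_mono) auto
    also have "\<dots> \<le> 1" using t Hq by (simp add: t0_def field_simps)
    finally have mq1: "m_colour q t \<le> 1" .
    have mq0: "0 < m_colour q t" using t H_ge_1[of t q] by (simp add: m_colour_def)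
    define n where "n = nat \<lfloor>1 / m_colour q t\<rfloor>"
    have "1 \<le> 1 / m_colour q t" using mq0 mq1 by simp
    then have "1 \<le> \<lfloor>1 / m_colour q t\<rfloor>" by linarith
    moreover from this have "real n = of_int \<lfloor>1 / m_colour q t\<rfloor>" by (subst n_def) (rule of_nat_nat, linarith)
    ultimately have n: "real n \<le> 1 / m_colour q t" "1 / m_colour q t \<le> 2 * real n"
      by linarith+
    define a where "a i = (if i < n then t else 0)" for i
    have a: "\<And>i. i \<ge> n \<Longrightarrow> a i = 0" by (simp add: a_def)
    have sa: "(\<Sum>i<n. m_colour r (c * a i)) = real n * m_colour r (c * t)" for r c by (simp add: a_def)
    have "(\<Sum>i<n. m_colour q (1 * a i)) \<le> 1" unfolding sa using n(1) mq0 by (simp add: field_simps)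
    from colour_norm_leI[of n a, OF a this] have "colour_norm q a \<le> 1 / unit_norm q" by simp
    moreover have "0 \<le> colour_norm q a" using unit_norm_pos[of q] by (simp add: colour_norm_def)
    moreover have "C0 * colour_norm q a \<le> (\<bar>C0\<bar> + 1) * colour_norm q a"
      using \<open>0 \<le> colour_norm q a\<close> by (intro mult_right_mono) auto
    moreover have "(\<bar>C0\<bar> + 1) * colour_norm q a \<le> (\<bar>C0\<bar> + 1) * (1 / unit_norm q)"
      using \<open>colour_norm q a \<le> 1 / unit_norm q\<close> by (intro mult_left_mono) auto
    ultimately have "colour_norm p a \<le> D" using C0[OF fin_suppI[of n a, OF a]] D(3) by simp
    from colour_norm_le_1D[of n a, OF a this D(1)] have "real n * m_colour p (1 / R * t) \<le> 3"
      unfolding sa R_def .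
    moreover have "(1 / R)\<^sup>2 * m_colour p t \<le> m_colour p (1 / R * t)"
      unfolding m_colour_eq_m using R1 by (intro m_scale_ge) auto
    then have "real n * ((1 / R)\<^sup>2 * m_colour p t) \<le> real n * m_colour p (1 / R * t)" by (rule mult_left_mono) simp
    ultimately have 1: "real n * ((1 / R)\<^sup>2 * m_colour p t) \<le> 3" by linarith
    have R: "0 < R" using D by (simp add: R_def unit_norm_pos)
    have "1 \<le> 2 * real n * m_colour q t" using n(2) mq0 by (simp add: field_simps)
    then have "m_colour p t * 1 \<le> m_colour p t * (2 * real n * m_colour q t)" by (intro mult_left_mono m_colour_nonneg)
    also have "\<dots> = (2 * R\<^sup>2 * m_colour q t) * (real n * ((1 / R)\<^sup>2 * m_colour p t))"
      using R by (simp add: field_simps)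
    also have "\<dots> \<le> (2 * R\<^sup>2 * m_colour q t) * 3" using 1 mq0 by (intro mult_left_mono) auto
    finally have "t\<^sup>2 * H p t \<le> t\<^sup>2 * ((6 * R\<^sup>2) * H q t)" using t by (simp add: m_colour_def mult_ac)
    then show ?thesis using t by simp
  qed
  moreover have "0 < t0" using Hq by (simp add: t0_def)
  ultimately show ?thesis by blast
qed

section \<open>Spreading models of arbitrary weakly null sequences\<close>

definition persistent :: "(nat \<Rightarrow> linf) \<Rightarrow> nat \<Rightarrow> real \<Rightarrow> nat set" where
  "persistent x p \<delta> = {i. \<exists>j. colour j = p \<and> \<delta> < \<bar>coeff (x i) j\<bar>}"

text \<open>In the remaining colours the coordinates of \<open>x i\<close> tend to 0 uniformly as
  \<open>i\<close> grows.\<close>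

definition active :: "(nat \<Rightarrow> linf) \<Rightarrow> nat set" where
  "active x = {p. \<exists>\<delta>>0. infinite (persistent x p \<delta>)}"

text \<open>With blocks chosen from persistent indices, a single large coordinate of colour
  \<open>p\<close> in each block already accounts for the modular of that colour.\<close>

lemma lower_active:
  assumes x: "weakly_null X x" and g: "generates_sm x N" and \<delta>: "0 < \<delta>" "infinite (persistent x p \<delta>)"
    and a: "\<And>i. i \<ge> n \<Longrightarrow> a i = 0" and Na: "N a \<le> 1"
  shows "(\<Sum>i<n. m_colour p (\<delta> / 6 * a i)) \<le> 3"
proof -
  have xX: "x i \<in> X" for i using x by (simp add: weakly_null_def)
  obtain k M where k: "\<And>i. k i \<in> persistent x p \<delta>"
    and er: "\<And>i. norm (x (k i) - T (restr {M i..<M (Suc i)} (coeff (x (k i))))) \<le> \<delta> / 2"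
    and M: "mono M"
    and le: "(\<Sum>i<n. \<Sum>j<M n. m j (a i * restr {M i..<M (Suc i)} (coeff (x (k i))) j / 6)) \<le> 3"
    using lower_core[OF x g \<delta>(2) _ a Na, of "\<delta> / 2"] \<delta>(1) by auto
  define u where "u i = restr {M i..<M (Suc i)} (coeff (x (k i)))" for i
  have uL: "u i \<in> modular_space" for i unfolding u_def by (intro modular_space_restr coeff_modular_space xX)
  have "(\<Sum>i<n. m_colour p (\<delta> / 6 * a i)) \<le> (\<Sum>i<n. \<Sum>j<M n. m j (a i * u i j / 6))"
  proof (rule sum_mono)
    fix i assume "i \<in> {..<n}"
    then have i: "i < n" by simp
    obtain j where j: "colour j = p" "\<delta> < \<bar>coeff (x (k i)) j\<bar>" using k[of i] by (auto simp: persistent_def)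
    \<comment> \<open>Coordinates have bound 2 and the block error is \<open>\<delta> / 2\<close>,
      so the large coordinate cannot have been cut off; on the block it is unchanged.\<close>
    have "\<bar>coeff (x (k i)) j - u i j\<bar> \<le> 2 * norm (x (k i) - T (u i))"
      using coeff_le[OF subspace_diff[OF subspace_X xX[of "k i"] T_in_X[OF uL[of i]]], of j]
      by (simp add: coeff_diff xX T_in_X uL coeff_T)
    also have "\<dots> \<le> \<delta>" using er[of i] by (simp add: u_def)
    finally have "u i j \<noteq> 0" using j(2) by auto
    then have ju: "j < M (Suc i)" "u i j = coeff (x (k i)) j" by (auto simp: u_def restr_def split: if_splits)
    then have jM: "j \<in> {..<M n}" using monoD[OF M, of "Suc i" n] i by auto
    have "m_colour p (\<delta> / 6 * a i) \<le> m_colour p (a i * u i j / 6)"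
      using j(2) \<delta>(1) ju(2) mult_right_mono[of \<delta> "\<bar>u i j\<bar>" "\<bar>a i\<bar>"]
      by (intro m_colour_mono) (simp add: abs_mult mult_ac)
    also have "\<dots> = m j (a i * u i j / 6)" using j(1) by (simp add: m_eq_m_colour)
    also have "\<dots> \<le> (\<Sum>j<M n. m j (a i * u i j / 6))"
      using jM by (intro member_le_sum) auto
    finally show "m_colour p (\<delta> / 6 * a i) \<le> (\<Sum>j<M n. m j (a i * u i j / 6))" .
  qed
  then show ?thesis using le by (simp add: u_def)
qed

text \<open>The summand 1 in the hypothesis is handled by \<open>lower_l2\<close>, and the weight of
  each \<open>p\<close> in \<open>F\<close> by \<open>lower_active\<close>.\<close>

lemma model_dominates_colour_norm:
  assumes x: "weakly_null X x" and g: "generates_sm x N" and F: "finite F" "F \<subseteq> active x"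
    and H: "\<And>t. 0 < t \<Longrightarrow> H q t \<le> C * (1 + (\<Sum>p\<in>F. H p t))"
  shows "dominates N (colour_norm q)"
proof -
  have "\<forall>p\<in>F. \<exists>\<delta>. 0 < \<delta> \<and> infinite (persistent x p \<delta>)" using F(2) by (auto simp: active_def)
  then obtain \<delta> where \<delta>: "\<And>p. p \<in> F \<Longrightarrow> 0 < \<delta> p" "\<And>p. p \<in> F \<Longrightarrow> infinite (persistent x p (\<delta> p))"
    by metis
  \<comment> \<open>One scale that serves the l-two bound and the bounds of all colours in
    \<open>F\<close> simultaneously.\<close>
  define c where "c = Min (insert (1 / 432) ((\<lambda>p. \<delta> p / 6) ` F))"
  have c: "0 < c" unfolding c_def using F(1) \<delta>(1) by auto
  have c432: "c \<le> 1 / 432" unfolding c_def using F(1) by (intro Min_le) auto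
  have c\<delta>: "c \<le> \<delta> p / 6" if "p \<in> F" for p unfolding c_def using F(1) that by (intro Min_le) auto
  define K where "K = 432 + 3 * real (card F)"
  have C: "0 < C"
  proof (rule ccontr)
    assume "\<not> 0 < C"
    moreover have "0 \<le> (\<Sum>p\<in>F. H p 1)" using H_ge_1[of 1] by (intro sum_nonneg) (meson order_trans zero_le_one zero_less_one)
    ultimately have "C * (1 + (\<Sum>p\<in>F. H p 1)) \<le> 0" by (intro mult_nonpos_nonneg) auto
    then show False using H[of 1] H_ge_1[of 1 q] by simp
  qed
  show ?thesis
  proof (rule dominatesI_unit_ball[OF sm_seminorm_colour_norm])
    show "sm_seminorm N" using g by (simp add: generates_sm_def)
    fix a assume "fin_supp a" and Na: "N a \<le> 1"
    then obtain n where n: "\<And>i. i \<ge> n \<Longrightarrow> a i = 0" using fin_suppE by metis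
    have mq: "m_colour q t \<le> C * (t\<^sup>2 + (\<Sum>p\<in>F. m_colour p t))" for t
    proof (cases "t = 0")
      case False
      then have "t\<^sup>2 * H q \<bar>t\<bar> \<le> t\<^sup>2 * (C * (1 + (\<Sum>p\<in>F. H p \<bar>t\<bar>)))"
        using H by (intro mult_left_mono) auto
      then show ?thesis by (simp add: m_colour_def sum_distrib_left algebra_simps)
    qed simp
    have l2: "(\<Sum>i<n. (c * a i)\<^sup>2) \<le> 432"
    proof -
      have "(\<Sum>i<n. (c * a i)\<^sup>2) \<le> (\<Sum>i<n. (a i / 432)\<^sup>2)"
      proof (rule sum_mono)
        fix i
        have "c\<^sup>2 * (a i)\<^sup>2 \<le> (1 / 432)\<^sup>2 * (a i)\<^sup>2" using c c432 by (intro mult_right_mono power_mono) auto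
        then show "(c * a i)\<^sup>2 \<le> (a i / 432)\<^sup>2" by (simp add: power_mult_distrib power_divide)
      qed
      then show ?thesis using lower_l2[OF x g, of n a] n Na by simp
    qed
    have "(\<Sum>i<n. m_colour p (c * a i)) \<le> 3" if p: "p \<in> F" for p
    proof -
      have "(\<Sum>i<n. m_colour p (c * a i)) \<le> (\<Sum>i<n. m_colour p (\<delta> p / 6 * a i))"
        using c c\<delta>[OF p] by (intro sum_mono m_colour_mono) (simp only: abs_mult, intro mult_right_mono, auto)
      also have "\<dots> \<le> 3" using lower_active[OF x g \<delta>(1)[OF p] \<delta>(2)[OF p], of n a] n Na by simp
      finally show ?thesis .
    qed
    then have "(\<Sum>p\<in>F. \<Sum>i<n. m_colour p (c * a i)) \<le> (\<Sum>p\<in>F. 3)" by (rule sum_mono)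
    then have lp: "(\<Sum>i<n. \<Sum>p\<in>F. m_colour p (c * a i)) \<le> 3 * real (card F)" by (subst sum.swap) simp
    have "(\<Sum>i<n. m_colour q (c * a i)) \<le> (\<Sum>i<n. C * ((c * a i)\<^sup>2 + (\<Sum>p\<in>F. m_colour p (c * a i))))"
      by (intro sum_mono mq)
    also have "\<dots> = C * ((\<Sum>i<n. (c * a i)\<^sup>2) + (\<Sum>i<n. \<Sum>p\<in>F. m_colour p (c * a i)))"
      by (simp only: sum_distrib_left[symmetric] sum.distrib)
    also have "\<dots> \<le> C * K" unfolding K_def using l2 lp C by (intro mult_left_mono add_mono) auto
    finally have "(\<Sum>i<n. m_colour q (c * a i)) \<le> max 1 (C * K)" by simp
    then show "colour_norm q a \<le> max 1 (C * K) / (c * unit_norm q)" using c by (intro colour_norm_leI[of n] n) auto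
  qed
qed

text \<open>Given coefficients \<open>a\<close>, only finitely many colours matter above the threshold \<open>\<delta>\<close>. Coordinates
  below it are absorbed by submultiplicativity, inactive colours eventually stay below it, and the
  weights of the remaining colours are at most 2 at the finitely many relevant scales.\<close>

lemma colour_norm_dominates_model:
  assumes x: "weakly_null X x" and g: "generates_sm x N"
    and H: "\<And>p t. p \<in> active x \<Longrightarrow> 0 < t \<Longrightarrow> H p t \<le> C * H q t"
  shows "dominates (colour_norm q) N"
proof (rule dominatesI_unit_ball[OF _ sm_seminorm_colour_norm])
  show "sm_seminorm N" using g by (simp add: generates_sm_def)
  have xX: "x i \<in> X" "norm (x i) = 1" for i
    using x g by (simp_all add: weakly_null_def generates_sm_def)
  define c where "c = 1 / (2 * 1 * unit_norm q)"
  have c: "0 < c" using unit_norm_pos[of q] by (simp add: c_def)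
  define D where "D = 2 + \<bar>C\<bar>"
  fix a assume "fin_supp a" and Na: "colour_norm q a \<le> 1"
  then obtain n where n: "\<And>i. i \<ge> n \<Longrightarrow> a i = 0" using fin_suppE by metis
  define t where "t i = c * a i" for i
  have st: "(\<Sum>i<n. m_colour q (t i)) \<le> 3" using colour_norm_le_1D[of n a q 1] n Na by (simp add: t_def c_def)
  \<comment> \<open>Below every nonzero coefficient, as \<open>m_mult_small\<close> needs; the entry
    1 covers the case without such coefficients.\<close>
  define \<delta> where "\<delta> = Min (insert 1 ((\<lambda>i. \<bar>t i\<bar>) ` {i. i < n \<and> t i \<noteq> 0}))"
  have \<delta>: "0 < \<delta>" "\<And>i. i < n \<Longrightarrow> t i \<noteq> 0 \<Longrightarrow> \<delta> \<le> \<bar>t i\<bar>"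
    unfolding \<delta>_def by (auto intro: Min_le)
  \<comment> \<open>A coordinate above \<open>\<delta>\<close> times a nonzero coefficient is at
    least \<open>\<delta> * \<delta>\<close>; from there on the weights of all colours from
    \<open>P\<close> on are at most 2.\<close>
  obtain P where P: "\<And>p. p \<ge> P \<Longrightarrow> H p (\<delta> * \<delta>) \<le> 2" using H_escape[of "\<delta> * \<delta>"] \<delta>(1) by auto
  \<comment> \<open>From \<open>K0\<close> on, an inactive colour with a coordinate above
    \<open>\<delta>\<close> must therefore be at least \<open>P\<close>.\<close>
  have "finite (\<Union>p\<in>{..<P} - active x. persistent x p \<delta>)"
    using \<delta>(1) by (auto simp: active_def)
  then obtain K0 where K0: "\<And>i. i \<in> (\<Union>p\<in>{..<P} - active x. persistent x p \<delta>) \<Longrightarrow> i < K0"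
    unfolding finite_nat_set_iff_bounded by blast
  obtain K1 where K1: "\<And>k. strict_mono k \<Longrightarrow> K1 \<le> k 0 \<Longrightarrow> N a \<le> 2 * norm (\<Sum>i<n. a i *\<^sub>R x (k i))"
    using generates_smD[OF g, of n a] n by blast
  define A where "A = 1 + (\<Sum>i<n. \<bar>a i\<bar>)"
  have A: "0 < A" unfolding A_def by (intro add_pos_nonneg sum_nonneg) auto
  obtain k M where k: "strict_mono k" "max K0 K1 \<le> k 0" and M: "mono M"
    and er: "\<And>i. norm (x (k i) - T (restr {M i..<M (Suc i)} (coeff (x (k i))))) \<le> 1 / A"
    using block_selection[OF x infinite_UNIV_nat, of "1 / A"] A by (metis zero_less_divide_1_iff)
  define u where "u i = restr {M i..<M (Suc i)} (coeff (x (k i)))" for i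
  have uL: "u i \<in> modular_space" for i unfolding u_def by (intro modular_space_restr coeff_modular_space xX)
  have kK: "K0 \<le> k i" for i using k(2) strict_mono_less_eq[OF k(1), of 0 i] by simp
  let ?b = "\<lambda>j. \<Sum>i<n. a i * u i j"
  have bu: "modular_le (\<lambda>j. u i j / 2) 3" for i
    by (rule modular_le_dom[OF modular_le_half_unit[OF xX(1)[of "k i"] xX(2)]]) (auto simp: u_def restr_def)
  have pt: "m j (u i j / 2 * t i) \<le> D * m_colour q (t i) * m j (u i j / 2)" if i: "i < n" for i j
  proof (cases "t i = 0 \<or> u i j = 0")
    case False
    let ?s = "u i j / 2"
    have t0: "0 < \<bar>t i\<bar>" using False by simp
    have Hq: "1 \<le> H q \<bar>t i\<bar>" using H_ge_1[OF t0] .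
    have two: "2 * (t i)\<^sup>2 \<le> D * m_colour q (t i)"
    proof -
      have "2 * 1 \<le> D * H q \<bar>t i\<bar>" using Hq by (intro mult_mono) (auto simp: D_def)
      then have "(t i)\<^sup>2 * (2 * 1) \<le> (t i)\<^sup>2 * (D * H q \<bar>t i\<bar>)" by (intro mult_left_mono) auto
      then show ?thesis by (simp add: m_colour_def mult_ac)
    qed
    \<comment> \<open>In the first and third case the coefficient costs only
      \<open>2 * (t i)\<^sup>2\<close>; in the second the hypothesis compares the weight of the
      colour with that of \<open>q\<close>. The constant \<open>D\<close> covers all three.\<close>
    consider "\<bar>?s\<bar> \<le> \<delta>" | "\<delta> < \<bar>?s\<bar>" "colour j \<in> active x" | "\<delta> < \<bar>?s\<bar>" "colour j \<notin> active x"
      by linarith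
    then show ?thesis
    proof cases
      case 1
      then have "m j (?s * t i) \<le> 2 * (t i)\<^sup>2 * m j ?s"
        using \<delta>(2)[OF i] False by (intro m_mult_small) auto
      also have "\<dots> \<le> D * m_colour q (t i) * m j ?s" using two by (intro mult_right_mono) auto
      finally show ?thesis .
    next
      case 2
      have "1 + H (colour j) \<bar>t i\<bar> \<le> 1 + C * H q \<bar>t i\<bar>" using H[OF 2(2) t0] by simp
      also have "\<dots> \<le> 2 * H q \<bar>t i\<bar> + \<bar>C\<bar> * H q \<bar>t i\<bar>"
        using Hq by (intro add_mono mult_right_mono) auto
      also have "\<dots> = D * H q \<bar>t i\<bar>" by (simp add: D_def algebra_simps)
      finally have "(t i)\<^sup>2 * (1 + H (colour j) \<bar>t i\<bar>) \<le> (t i)\<^sup>2 * (D * H q \<bar>t i\<bar>)"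
        by (intro mult_left_mono) auto
      then have "(t i)\<^sup>2 * (1 + H (colour j) \<bar>t i\<bar>) * m j ?s \<le> D * m_colour q (t i) * m j ?s"
        by (intro mult_right_mono) (auto simp: m_colour_def mult_ac)
      moreover have "m j (?s * t i) \<le> (t i)\<^sup>2 * (1 + H (colour j) \<bar>t i\<bar>) * m j ?s"
        using False by (intro m_mult) auto
      ultimately show ?thesis by linarith
    next
      case 3
      have "u i j = coeff (x (k i)) j" using False by (auto simp: u_def restr_def split: if_splits)
      then have "\<delta> < \<bar>coeff (x (k i)) j\<bar>" using 3(1) \<delta>(1) by simp
      then have "k i \<in> persistent x (colour j) \<delta>" by (auto simp: persistent_def)
      then have "P \<le> colour j" using K0[of "k i"] kK[of i] 3(2) by (meson DiffI UN_I lessThan_iff not_le)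
      then have h2: "H (colour j) (\<delta> * \<delta>) \<le> 2" by (rule P)
      have "\<delta> * \<delta> \<le> \<bar>?s * t i\<bar>" unfolding abs_mult
        using 3(1) \<delta>(1) \<delta>(2)[OF i] False by (intro mult_mono) auto
      then have "H (colour j) \<bar>?s * t i\<bar> \<le> 2"
        using H_antimono[of "\<delta> * \<delta>" "\<bar>?s * t i\<bar>" "colour j"] \<delta>(1) h2 by simp
      then have "m j (?s * t i) \<le> (?s * t i)\<^sup>2 * 2" unfolding m_def by (intro mult_left_mono) auto
      also have "\<dots> = 2 * (t i)\<^sup>2 * ?s\<^sup>2" by (simp add: power2_eq_square)
      also have "\<dots> \<le> 2 * (t i)\<^sup>2 * m j ?s" by (intro mult_left_mono sq_le_m) auto
      also have "\<dots> \<le> D * m_colour q (t i) * m j ?s" using two by (intro mult_right_mono) auto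
      finally show ?thesis .
    qed
  qed (auto simp: m_colour_nonneg)
  have D0: "0 \<le> D" by (simp add: D_def)
  have "modular_le (\<lambda>j. u i j / 2 * t i) (D * m_colour q (t i) * 3)" if "i < n" for i
    using D0 m_colour_nonneg[of q] by (intro modular_le_le[OF bu[of i]] pt that) auto
  then have "modular_le (\<lambda>j. t i / 2 * u i j) (D * m_colour q (t i) * 3)" if "i < n" for i
    using that by (simp add: mult_ac)
  moreover have "disjoint_seqs n (\<lambda>i j. t i / 2 * u i j)"
    by (rule disjoint_seqs_scale[OF disjoint_seqs_blocks[OF M]]) (auto simp: u_def restr_def split: if_splits)
  ultimately have b1: "modular_le (\<lambda>j. \<Sum>i<n. t i / 2 * u i j) (\<Sum>i<n. D * m_colour q (t i) * 3)"
    by (intro modular_le_sum_disjoint)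
  have b2: "(\<lambda>j. \<Sum>i<n. t i / 2 * u i j) = (\<lambda>j. c / 2 * ?b j)"
    by (simp add: t_def sum_distrib_left mult_ac)
  have b3: "(\<Sum>i<n. D * m_colour q (t i) * 3) \<le> 9 * D + 1"
  proof -
    have "(\<Sum>i<n. D * m_colour q (t i) * 3) = 3 * D * (\<Sum>i<n. m_colour q (t i))"
      by (simp add: sum_distrib_left mult_ac)
    also have "\<dots> \<le> 3 * D * 3" using st D0 by (intro mult_left_mono) auto
    finally show ?thesis by simp
  qed
  have "modular_le (\<lambda>j. c / 2 * ?b j) (9 * D + 1)" using modular_le_mono[OF b1 b3] unfolding b2 .
  then have "norm (T (\<lambda>j. c / 2 * ?b j)) \<le> 9 * D + 1" using D0 by (intro norm_T_le_modular_le) auto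
  moreover have "T (\<lambda>j. c / 2 * ?b j) = (c / 2) *\<^sub>R T ?b"
    using uL by (intro T_scale T_lincomb(1))
  ultimately have "c / 2 * norm (T ?b) \<le> 9 * D + 1" using c by simp
  then have Tb: "norm (T ?b) \<le> 2 * (9 * D + 1) / c" using c by (simp add: field_simps)
  have "norm ((\<Sum>i<n. a i *\<^sub>R x (k i)) - T ?b) \<le> (\<Sum>i<n. \<bar>a i\<bar>) * (1 / A)"
    using er uL A unfolding u_def by (intro norm_block_error) auto
  also have "\<dots> \<le> A * (1 / A)" using A by (intro mult_right_mono) (auto simp: A_def)
  finally have "norm ((\<Sum>i<n. a i *\<^sub>R x (k i)) - T ?b) \<le> 1" using A by simp
  then have nb: "norm (\<Sum>i<n. a i *\<^sub>R x (k i)) \<le> norm (T ?b) + 1"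
    using norm_triangle_ineq2[of "\<Sum>i<n. a i *\<^sub>R x (k i)" "T ?b"] by linarith
  have "N a \<le> 2 * norm (\<Sum>i<n. a i *\<^sub>R x (k i))" using K1[OF k(1)] k(2) by simp
  also have "\<dots> \<le> 2 * (norm (T ?b) + 1)" using nb by (rule mult_left_mono) simp
  also have "\<dots> \<le> 2 * (2 * (9 * D + 1) / c + 1)" using Tb by (intro mult_left_mono add_right_mono) auto
  finally show "N a \<le> 2 * (2 * (9 * D + 1) / c + 1)" .
qed

end

section \<open>Realising the lattice\<close>

text \<open>The middle term is a model, hence nonnegative, so \<open>C\<close> may be replaced by
  its absolute value.\<close>

lemma dominates_trans:
  assumes "dominates V U" "dominates W V" "V \<in> SPw_models X"
  shows "dominates W U"
proof -
  obtain C D where C: "\<And>a. fin_supp a \<Longrightarrow> U a \<le> C * V a" and D: "\<And>a. fin_supp a \<Longrightarrow> V a \<le> D * W a"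
    using assms unfolding dominates_def by blast
  have "sm_seminorm V" using assms(3) by (auto simp: SPw_models_def generates_sm_def)
  then have V: "\<And>a. fin_supp a \<Longrightarrow> 0 \<le> V a" by (simp add: sm_seminorm_def)
  have "U a \<le> (\<bar>C\<bar> * D) * W a" if a: "fin_supp a" for a
  proof -
    have "U a \<le> \<bar>C\<bar> * V a"
      using C[OF a] mult_right_mono[OF abs_ge_self[of C] V[OF a]] by linarith
    also have "\<dots> \<le> \<bar>C\<bar> * (D * W a)" using D[OF a] by (intro mult_left_mono) auto
    finally show ?thesis by (simp add: mult.assoc)
  qed
  then show ?thesis unfolding dominates_def by blast
qed

lemma equiv_sm_equiv: "equiv (SPw_models X) (sm_equiv X)"
proof (rule equivI)
  show "trans (sm_equiv X)"
    unfolding trans_def sm_equiv_def using dominates_trans by blast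
  show "refl_on (SPw_models X) (sm_equiv X)"
    unfolding refl_on_def sm_equiv_def dominates_def by (auto intro: exI[of _ 1])
  show "sym (sm_equiv X)" unfolding sym_def sm_equiv_def by blast
  show "sm_equiv X \<subseteq> SPw_models X \<times> SPw_models X" unfolding sm_equiv_def by blast
qed

text \<open>The chain condition gives a maximal element among those below a finite join from
  \<open>A\<close>. Joining it with any element of \<open>A\<close> stays in that set, so it is an
  upper bound of \<open>A\<close>.\<close>

lemma finite_lub_of_no_ascending_chain:
  fixes A :: "'a::lattice set" and bot0 :: 'a
  assumes bot: "\<forall>x. bot0 \<le> x" and acc: "\<not> (\<exists>f :: nat \<Rightarrow> 'a. strict_mono f)"
  shows "\<exists>F z. finite F \<and> F \<subseteq> A \<and> (\<forall>x\<in>A. x \<le> z) \<and> (\<forall>w. (\<forall>x\<in>F. x \<le> w) \<longrightarrow> z \<le> w)"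
proof -
  \<comment> \<open>Elements below a finite join, phrased by upper bounds so that the empty join
    needs no separate treatment.\<close>
  define S where "S = {z. \<exists>F. finite F \<and> F \<subseteq> A \<and> (\<forall>w. (\<forall>x\<in>F. x \<le> w) \<longrightarrow> z \<le> w)}"
  have "bot0 \<in> S" unfolding S_def using bot by (auto intro: exI[of _ "{}"])
  have "\<exists>z\<in>S. \<forall>z'\<in>S. \<not> z < z'"
  proof (rule ccontr)
    assume "\<not> ?thesis"
    then obtain g where g: "\<And>z. z \<in> S \<Longrightarrow> g z \<in> S \<and> z < g z" by metis
    define f where "f n = (g ^^ n) bot0" for n
    have fS: "f n \<in> S" for n by (induction n) (auto simp: f_def \<open>bot0 \<in> S\<close> g)
    have "strict_mono f" unfolding strict_mono_Suc_iff using g[OF fS] by (simp add: f_def)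
    then show False using acc by blast
  qed
  then obtain z where z: "z \<in> S" "\<And>z'. z' \<in> S \<Longrightarrow> \<not> z < z'" by blast
  then obtain F where F: "finite F" "F \<subseteq> A" "\<And>w. (\<forall>x\<in>F. x \<le> w) \<Longrightarrow> z \<le> w" by (auto simp: S_def)
  have "x \<le> z" if x: "x \<in> A" for x
  proof -
    have "sup z x \<in> S" unfolding S_def
      using F x by (intro CollectI exI[of _ "insert x F"]) auto
    then have "\<not> z < sup z x" by (rule z(2))
    then have "sup z x = z" using sup_ge1[of z x] by (simp add: less_le)
    then show ?thesis by (metis sup_ge2)
  qed
  then show ?thesis using F by blast
qed

theorem theorem3p1:
  fixes bot0 :: "'a::lattice"
  assumes "countable (UNIV :: 'a set)"
    and "\<forall>x. bot0 \<le> x"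
    and "\<not> (\<exists>f :: nat \<Rightarrow> 'a. strict_mono f)"
  shows "\<exists>X. banach_subspace X \<and> reflexive_sp X \<and>
           (\<exists>\<phi> :: 'a \<Rightarrow> ((nat \<Rightarrow> real) \<Rightarrow> real) set.
               bij_betw \<phi> UNIV (SPw X) \<and> (\<forall>x y. x \<le> y \<longleftrightarrow> SPw_le (\<phi> x) (\<phi> y)))"
proof -
  define e :: "nat \<Rightarrow> 'a" where "e = from_nat_into UNIV"
  have "range e = UNIV" unfolding e_def using assms(1) by (intro range_from_nat_into) auto
  then have surj: "\<exists>p. e p = x" for x by (metis surjE)
  \<comment> \<open>The sequence \<open>e (colour n)\<close> visits every element infinitely often,
    since each colour has infinitely many places. The condition \<open>p \<le> n\<close> provides
    \<open>H_escape\<close>.\<close>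
  define B where "B p = {n. p \<le> n \<and> \<not> e p \<le> e (colour n)}" for p
  define H where "H p t = weight (B p) t" for p t
  interpret coloured H
  proof
    fix s t :: real and p :: nat
    assume t: "0 < t"
    then show "1 \<le> H p t" unfolding H_def by (rule weight_ge_1)
    have "H p t \<le> 1 + 2 * ln (1 + 1 / t) * (1 / 2) ^ 0"
      unfolding H_def by (rule weight_tail_le[OF t]) auto
    then show "H p t \<le> 1 + 2 * ln (1 + 1 / t)" by simp
    have "(\<lambda>p. 1 + 2 * ln (1 + 1 / t) * (1 / 2) ^ p) \<longlonglongrightarrow> 1 + 2 * ln (1 + 1 / t) * 0"
      by (intro tendsto_intros LIMSEQ_power_zero) auto
    then have "\<forall>\<^sub>F p in sequentially. 1 + 2 * ln (1 + 1 / t) * (1 / 2) ^ p < 2"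
      by (rule order_tendstoD(2)) simp
    then obtain P where P: "\<And>p. p \<ge> P \<Longrightarrow> 1 + 2 * ln (1 + 1 / t) * (1 / 2) ^ p < 2"
      by (auto simp: eventually_sequentially)
    have "H p t \<le> 2" if "p \<ge> P" for p
    proof -
      have "H p t \<le> 1 + 2 * ln (1 + 1 / t) * (1 / 2) ^ p"
        unfolding H_def by (rule weight_tail_le[OF t]) (auto simp: B_def)
      then show ?thesis using P[OF that] by linarith
    qed
    then show "\<exists>P. \<forall>p\<ge>P. H p t \<le> 2" by blast
  qed (auto simp: H_def intro: weight_antimono mult_weight_mono weight_mult)
  \<comment> \<open>By transitivity of the order, an index of \<open>B p\<close> outside
    \<open>B q\<close> is below \<open>q\<close>.\<close>
  have H_le: "H p t \<le> (1 + (\<Sum>n<q. fact n)) * H q t" if "e p \<le> e q" "0 < t" for p q t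
  proof -
    have "H p t \<le> H q t + (\<Sum>n<q. fact n)"
      unfolding H_def using that order_trans[OF that(1)]
      by (intro weight_le_weight) (auto simp: B_def)
    also have "\<dots> \<le> H q t + (\<Sum>n<q. fact n) * H q t"
      using mult_left_mono[OF H_ge_1[OF that(2), of q], of "\<Sum>n<q. fact n"] by (simp add: sum_nonneg)
    finally show ?thesis by (simp add: algebra_simps)
  qed
  have dom_iff: "dominates (colour_norm q) (colour_norm p) \<longleftrightarrow> e p \<le> e q" for p q
  proof
    assume "e p \<le> e q"
    then show "dominates (colour_norm q) (colour_norm p)" by (rule dominates_colour_norm[OF H_le])
  next
    assume "dominates (colour_norm q) (colour_norm p)"
    then obtain C t0 where t0: "0 < t0" and C: "\<And>t. 0 < t \<Longrightarrow> t \<le> t0 \<Longrightarrow> H p t \<le> C * H q t"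
      using dominates_NmD by blast
    show "e p \<le> e q"
    proof (rule ccontr)
      assume np: "\<not> e p \<le> e q"
      obtain i where i: "real p + 1 + 1 / t0 + 5 * \<bar>C\<bar> < real i" using reals_Archimedean2 by blast
      \<comment> \<open>Shifted by 1 because \<open>weight_separate\<close> speaks of
        \<open>Suc n\<close>, here a place of colour \<open>q\<close>. It lies in \<open>B p\<close>
        and not in \<open>B q\<close>, and by the choice of \<open>i\<close> it is beyond
        \<open>p\<close>, its scale is below \<open>t0\<close>, and it exceeds
        \<open>5 * C\<close>.\<close>
      define n where "n = place q i - 1"
      have "0 < 1 / t0" using t0 by simp
      then have ip: "real p + 1 < real i" "1 / t0 < real i" "5 * C < real i" using i by linarith+
      have "i \<le> place q i" by (rule place_ge)
      then have Sn: "Suc n = place q i" "i \<le> Suc n" "p \<le> Suc n" using ip by (auto simp: n_def)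
      have "Suc n \<in> B p" using np Sn by (simp add: B_def)
      moreover have "Suc n \<notin> B q" using Sn by (simp add: B_def)
      ultimately obtain t where t: "0 < t" "t \<le> 1 / lam (Suc n)" "real (Suc n) * H q t \<le> 5 * H p t"
        unfolding H_def by (rule weight_separate)
      have "1 / t0 \<le> lam (Suc n)" using ip(2) Sn(2) lam_ge[of "Suc n"] by linarith
      then have "1 / lam (Suc n) \<le> t0" using t0 lam_pos[of "Suc n"] by (simp add: field_simps)
      then have "H p t \<le> C * H q t" using C t by simp
      then have "real (Suc n) * H q t \<le> (5 * C) * H q t" using t(3) by simp
      then have "real (Suc n) \<le> 5 * C" using H_ge_1[OF t(1), of q] by simp
      then show False using ip(3) Sn(2) by linarith
    qed
  qed
  have classify: "\<exists>q. dominates N (colour_norm q) \<and> dominates (colour_norm q) N" if N: "N \<in> SPw_models X" for N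
  proof -
    obtain x where x: "weakly_null X x" and g: "generates_sm x N"
      using N by (auto simp: SPw_models_def)
    obtain F z where F: "finite F" "F \<subseteq> e ` active x" and ub: "\<And>y. y \<in> e ` active x \<Longrightarrow> y \<le> z"
      and lub: "\<And>w. (\<forall>y\<in>F. y \<le> w) \<Longrightarrow> z \<le> w"
      using finite_lub_of_no_ascending_chain[OF assms(2,3), of "e ` active x"] by blast
    obtain G where G: "finite G" "G \<subseteq> active x" "F = e ` G" using finite_subset_image[OF F] by blast
    obtain q where q: "e q = z" using surj by blast
    have "dominates (colour_norm q) N"
      by (rule colour_norm_dominates_model[OF x g H_le]) (use ub q in auto)
    moreover have "dominates N (colour_norm q)"
    proof (rule model_dominates_colour_norm[OF x g G(1,2)])
      fix t :: real assume t: "0 < t"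
      \<comment> \<open>Pays for the finitely many indices that lie below some \<open>p\<close> in
        \<open>G\<close> and may therefore be missing from \<open>B p\<close>.\<close>
      let ?c = "\<Sum>n<Max (insert 0 G). fact n :: real"
      have "H q t \<le> weight (\<Union>p\<in>G. B p) t + ?c"
        unfolding H_def
      proof (rule weight_le_weight[OF t])
        \<comment> \<open>An element above all of \<open>F\<close> is above \<open>z\<close>; so
          where \<open>z \<le> e (colour n)\<close> fails, it already fails for some member of
          \<open>F\<close>. This is how the join becomes a union.\<close>
        fix n assume n: "n \<in> B q"
        then have "\<not> z \<le> e (colour n)" using q by (simp add: B_def)
        then obtain p where p: "p \<in> G" "\<not> e p \<le> e (colour n)" using lub G(3) by blast
        show "n \<in> {..<Max (insert 0 G)} \<or> n \<in> (\<Union>p\<in>G. B p)"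
        proof (cases "p \<le> n")
          case True
          then show ?thesis using p by (auto simp: B_def)
        next
          case False
          have "p \<le> Max (insert 0 G)" using p G(1) by (intro Max_ge) auto
          then show ?thesis using False by auto
        qed
      qed simp
      also have "\<dots> \<le> (1 + (\<Sum>p\<in>G. H p t)) + ?c"
        unfolding H_def by (intro add_right_mono weight_UN t G(1))
      also have "\<dots> \<le> (1 + ?c) * (1 + (\<Sum>p\<in>G. H p t))"
      proof -
        have "0 \<le> (\<Sum>p\<in>G. H p t)" using H_ge_1[OF t] by (intro sum_nonneg) (meson order_trans zero_le_one)
        moreover have "0 \<le> ?c" by (intro sum_nonneg) auto
        ultimately show ?thesis by (simp add: algebra_simps)
      qed
      finally show "H q t \<le> (1 + ?c) * (1 + (\<Sum>p\<in>G. H p t))" .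
    qed
    ultimately show ?thesis by blast
  qed
  \<comment> \<open>Several colours may represent the same element; by \<open>dom_iff\<close> their
    models are equivalent, so any choice gives the same class.\<close>
  define idx where "idx y = (SOME p. e p = y)" for y
  have idx: "e (idx y) = y" for y unfolding idx_def using surj by (rule someI_ex)
  define \<phi> where "\<phi> y = sm_equiv X `` {colour_norm (idx y)}" for y
  note eq = equiv_sm_equiv[of X]
  have in\<phi>: "U \<in> \<phi> y \<longleftrightarrow> U \<in> SPw_models X \<and> dominates (colour_norm (idx y)) U \<and> dominates U (colour_norm (idx y))" for U y
    unfolding \<phi>_def by (auto simp: sm_equiv_def colour_norm_model)
  have le: "x \<le> y \<longleftrightarrow> SPw_le (\<phi> x) (\<phi> y)" for x y
  proof
    assume "x \<le> y"
    then have "dominates (colour_norm (idx y)) (colour_norm (idx x))" by (simp add: dom_iff idx)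
    moreover have "colour_norm (idx z) \<in> \<phi> z" for z by (simp add: in\<phi> colour_norm_model dom_iff)
    ultimately show "SPw_le (\<phi> x) (\<phi> y)" unfolding SPw_le_def by blast
  next
    assume "SPw_le (\<phi> x) (\<phi> y)"
    then obtain U V where U: "U \<in> \<phi> x" and V: "V \<in> \<phi> y" and UV: "dominates V U" by (auto simp: SPw_le_def)
    have "dominates V (colour_norm (idx x))"
      using dominates_trans[of U "colour_norm (idx x)" V X] U UV by (simp add: in\<phi>)
    then have "dominates (colour_norm (idx y)) (colour_norm (idx x))"
      using dominates_trans[of V "colour_norm (idx x)" "colour_norm (idx y)" X] V by (simp add: in\<phi>)
    then show "x \<le> y" by (simp add: dom_iff idx)
  qed
  have "bij_betw \<phi> UNIV (SPw X)"
    unfolding bij_betw_def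
  proof
    show "inj \<phi>"
    proof (rule injI)
      fix x y assume "\<phi> x = \<phi> y"
      then have "x \<le> y" "y \<le> x" by (metis le order_refl)+
      then show "x = y" by (rule antisym)
    qed
    show "range \<phi> = SPw X"
    proof
      show "range \<phi> \<subseteq> SPw X" unfolding \<phi>_def SPw_def using colour_norm_model by (auto intro: quotientI)
      show "SPw X \<subseteq> range \<phi>"
      proof
        fix c assume "c \<in> SPw X"
        then obtain N where N: "N \<in> SPw_models X" "c = sm_equiv X `` {N}"
          unfolding SPw_def by (auto elim: quotientE)
        obtain q where q: "dominates N (colour_norm q)" "dominates (colour_norm q) N" using classify[OF N(1)] by blast
        have "(N, colour_norm q) \<in> sm_equiv X" "(colour_norm q, colour_norm (idx (e q))) \<in> sm_equiv X"
          using q N(1) by (auto simp: sm_equiv_def colour_norm_model dom_iff idx)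
        then have "c = \<phi> (e q)" unfolding N(2) \<phi>_def using equiv_class_eq[OF eq] by metis
        then show "c \<in> range \<phi>" by blast
      qed
    qed
  qed
  then show ?thesis using banach_X reflexive_X le by blast
qed

end
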